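(* Let $\mathsf n^\natural=\sum_{\alpha\in\Pi}\mathsf n^\natural_\alpha\in\mathfrak w$ with $\mathsf n_\alpha^\natural\in\mathfrak g_\alpha$ and $\|\mathsf n^\natural_\alpha\|=1/\sqrt{\mathsf r}$ for all $\alpha\in\Pi$. Then $\mathfrak l^\star_{\mathsf n^\natural}(\infty)$ is centralizing. Indeed, $\mathfrak l_{\mathsf n^\natural}(\infty)=Z_{\mathfrak g}(\mathsf n^\natural)$ and $\mathfrak l^\star_{\mathsf n^\natural}(\infty)=\mathfrak u_{\mathsf n^\natural}$.
   Context: $\mathbf G$ is a connected semisimple linear algebraic group (over $\mathbb Q$) of $\mathbb R$-rank $\mathsf r\ge1$; $G=\mathbf G(\mathbb R)^\circ$, noncompact, with Lie algebra $\mathfrak g$. $B$ is the Killing form, $\theta$ a Cartan involution, $\langle x,y\rangle=-B(x,\theta y)$ with norm $\|\cdot\|$ and orthogonal complement $\perp$; $\mathfrak g=\mathfrak k\oplus\mathfrak p$; $\mathfrak a\subset\mathfrak p$ maximal abelian ($\dim\mathfrak a=\mathsf r$); $\Phi$ restricted root system, $\Phi^+$ positive roots, $\Pi$ simple roots, $\mathfrak g_\alpha$ root spaces; $\mathfrak m=Z_{\mathfrak k}(\mathfrak a)$; $\mathfrak w=\bigoplus_{\alpha\in\Phi^+}\mathfrak g_\alpha$; $\mathrm{ht}(\sum_{\alpha\in\Pi}c_\alpha\alpha)=\sum c_\alpha$. An element $\sum_{\alpha\in\Phi^+}\mathsf n_\alpha\in\mathfrak w$ is regular if $\mathsf n_\alpha\neq0$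 for all $\alpha\in\Pi$. For $\mathsf n=\mathsf n^\natural$ as in the claim: $\mathfrak m^\diamond=Z_{\mathfrak m}(\mathsf n^\natural)$, $\mathfrak m^\star=\mathfrak m\cap(\mathfrak m^\diamond)^\perp$; the limiting Lie algebra and the $\star$-limiting vector space are the limits in Grassmannians of $\mathfrak g$ (which exist) $$\mathfrak l_{\mathsf n}(\infty)=\lim_{t\to\infty}\mathrm{Ad}(\exp(t\mathsf n))(\mathfrak a\oplus\mathfrak m),\qquad \mathfrak l^\star_{\mathsf n}(\infty)=\lim_{t\to\infty}\mathrm{Ad}(\exp(t\mathsf n))(\mathfrak a\oplus\mathfrak m^\star).$$ For regular $\mathsf n\in\mathfrak w$, $\mathfrak u_{\mathsf n}=Z_{\mathfrak g}(\mathsf n)\cap\mathfrak w$ (the nilpotent part $\mathrm{nil}\,Z_{\mathfrak g}(\mathsf n)$ of the centralizer). $\mathfrak l^\star_{\mathsf n}(\infty)$ is centralizing if there is $z\in\bigoplus_{\alpha\in\Phi^+,\,\mathrm{ht}(\alpha)\ge2}\mathfrak g_\alpha$ with $\mathfrak l^\star_{\mathsf n}(\infty)=\mathfrak u_{\mathsf n+z}$. *)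

theory Defs
  imports "HOL-Analysis.Analysis" "HOL-Algebra.Solvable_Groups"
begin

section \<open>Linear algebraic groups\<close>

text \<open>A linear algebraic group over \<open>\<rat>\<close> is given by its complex points: a subgroup of
  \<open>GL\<^sub>N(\<complex>)\<close> cut out by polynomials with rational coefficients in the matrix entries.  Inverting the
  determinant gives no further closed sets, as denominators can be cleared.\<close>

inductive polyfun_over :: "complex set \<Rightarrow> (complex^'n^'n \<Rightarrow> complex) \<Rightarrow> bool" for K where
  const: "c \<in> K \<Longrightarrow> polyfun_over K (\<lambda>A. c)"
| entry: "polyfun_over K (\<lambda>A. A $ i $ j)"
| add: "polyfun_over K f \<Longrightarrow> polyfun_over K g \<Longrightarrow> polyfun_over K (\<lambda>A. f A + g A)"
| mult: "polyfun_over K f \<Longrightarrow> polyfun_over K g \<Longrightarrow> polyfun_over K (\<lambda>A. f A * g A)"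

definition closed_over :: "complex set \<Rightarrow> (complex^'n^'n) set \<Rightarrow> bool" where
  "closed_over K S \<longleftrightarrow>
    (\<exists>P. (\<forall>f\<in>P. polyfun_over K f) \<and> S = {A. invertible A \<and> (\<forall>f\<in>P. f A = 0)})"

abbreviation zariski_closed :: "(complex^'n^'n) set \<Rightarrow> bool" where
  "zariski_closed \<equiv> closed_over UNIV"

definition zariski_connected :: "(complex^'n^'n) set \<Rightarrow> bool" where
  "zariski_connected S \<longleftrightarrow>
    \<not> (\<exists>A B. zariski_closed A \<and> zariski_closed B \<and> A \<noteq> {} \<and> B \<noteq> {} \<and> A \<inter> B = {} \<and> A \<union> B = S)"

definition GL :: "(complex^'n^'n) monoid" where
  "GL = \<lparr>carrier = {A. invertible A}, mult = (**), one = mat 1\<rparr>"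

definition linear_algebraic_group_over_Q :: "(complex^'n^'n) set \<Rightarrow> bool" where
  "linear_algebraic_group_over_Q G \<longleftrightarrow> closed_over \<rat> G \<and> subgroup G GL"

text \<open>Triviality of the radical.\<close>

definition semisimple_group :: "(complex^'n^'n) set \<Rightarrow> bool" where
  "semisimple_group G \<longleftrightarrow>
    (\<forall>H. zariski_closed H \<and> zariski_connected H \<and> H \<lhd> GL\<lparr>carrier := G\<rparr> \<and>
         solvable (GL\<lparr>carrier := H\<rparr>) \<longrightarrow> H = {mat 1})"

definition real_points :: "(complex^'n^'n) set \<Rightarrow> (real^'n^'n) set" where
  "real_points G = {A. map_matrix complex_of_real A \<in> G}"

text \<open>The identity component is taken in the Euclidean topology.\<close>

definition real_points_component :: "(complex^'n^'n) set \<Rightarrow> (real^'n^'n) set" where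
  "real_points_component G = connected_component_set (real_points G) (mat 1)"

section \<open>The Lie algebra and the adjoint action\<close>

definition mexp :: "real^'n^'n \<Rightarrow> real^'n^'n" where
  "mexp X = (\<Sum>k. (((**) X ^^ k) (mat 1)) /\<^sub>R fact k)"

definition lie_algebra :: "(real^'n^'n) set \<Rightarrow> (real^'n^'n) set" where
  "lie_algebra H = {X. \<forall>t. mexp (t *\<^sub>R X) \<in> H}"

definition lie_bracket :: "real^'n^'n \<Rightarrow> real^'n^'n \<Rightarrow> real^'n^'n" where
  "lie_bracket X Y = X ** Y - Y ** X"

definition Ad :: "real^'n^'n \<Rightarrow> real^'n^'n \<Rightarrow> real^'n^'n" where
  "Ad A X = A ** X ** matrix_inv A"

text \<open>Trace of an endomorphism of a subspace; it does not depend on the basis chosen.\<close>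

definition trace_on :: "'a::euclidean_space set \<Rightarrow> ('a \<Rightarrow> 'a) \<Rightarrow> real" where
  "trace_on V f =
    (let B = (SOME B. independent B \<and> span B = V) in \<Sum>b\<in>B. representation B (f b) b)"

definition killing_form :: "(real^'n^'n) set \<Rightarrow> real^'n^'n \<Rightarrow> real^'n^'n \<Rightarrow> real" where
  "killing_form \<gg> x y = trace_on \<gg> (\<lambda>z. lie_bracket x (lie_bracket y z))"

definition cartan_inner ::
    "(real^'n^'n) set \<Rightarrow> (real^'n^'n \<Rightarrow> real^'n^'n) \<Rightarrow> real^'n^'n \<Rightarrow> real^'n^'n \<Rightarrow> real" where
  "cartan_inner \<gg> \<theta> x y = - killing_form \<gg> x (\<theta> y)"

definition cartan_norm :: "(real^'n^'n) set \<Rightarrow> (real^'n^'n \<Rightarrow> real^'n^'n) \<Rightarrow> real^'n^'n \<Rightarrow> real" where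
  "cartan_norm \<gg> \<theta> x = sqrt (cartan_inner \<gg> \<theta> x x)"

text \<open>The values of \<open>\<theta>\<close> outside \<open>\<gg>\<close> are irrelevant.\<close>

definition cartan_involution :: "(real^'n^'n) set \<Rightarrow> (real^'n^'n \<Rightarrow> real^'n^'n) \<Rightarrow> bool" where
  "cartan_involution \<gg> \<theta> \<longleftrightarrow>
    (\<forall>x\<in>\<gg>. \<theta> x \<in> \<gg> \<and> \<theta> (\<theta> x) = x) \<and>
    (\<forall>x\<in>\<gg>. \<forall>c. \<theta> (c *\<^sub>R x) = c *\<^sub>R \<theta> x) \<and>
    (\<forall>x\<in>\<gg>. \<forall>y\<in>\<gg>. \<theta> (x + y) = \<theta> x + \<theta> y \<and>
                   \<theta> (lie_bracket x y) = lie_bracket (\<theta> x) (\<theta> y)) \<and>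
    (\<forall>x\<in>\<gg>. x \<noteq> 0 \<longrightarrow> cartan_inner \<gg> \<theta> x x > 0)"

definition cartan_k :: "(real^'n^'n) set \<Rightarrow> (real^'n^'n \<Rightarrow> real^'n^'n) \<Rightarrow> (real^'n^'n) set" where
  "cartan_k \<gg> \<theta> = {x \<in> \<gg>. \<theta> x = x}"

definition cartan_p :: "(real^'n^'n) set \<Rightarrow> (real^'n^'n \<Rightarrow> real^'n^'n) \<Rightarrow> (real^'n^'n) set" where
  "cartan_p \<gg> \<theta> = {x \<in> \<gg>. \<theta> x = - x}"

definition centralizer_in :: "(real^'n^'n) set \<Rightarrow> (real^'n^'n) set \<Rightarrow> (real^'n^'n) set" where
  "centralizer_in V S = {x \<in> V. \<forall>s\<in>S. lie_bracket x s = 0}"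

definition abelian_subspace :: "(real^'n^'n) set \<Rightarrow> bool" where
  "abelian_subspace V \<longleftrightarrow> subspace V \<and> (\<forall>x\<in>V. \<forall>y\<in>V. lie_bracket x y = 0)"

definition maximal_abelian_in :: "(real^'n^'n) set \<Rightarrow> (real^'n^'n) set \<Rightarrow> bool" where
  "maximal_abelian_in V \<aa> \<longleftrightarrow>
    \<aa> \<subseteq> V \<and> abelian_subspace \<aa> \<and> (\<forall>\<bb>. \<aa> \<subseteq> \<bb> \<and> \<bb> \<subseteq> V \<and> abelian_subspace \<bb> \<longrightarrow> \<bb> = \<aa>)"

section \<open>Restricted roots\<close>

text \<open>A linear functional on \<open>\<aa>\<close> is a function that is linear on \<open>\<aa>\<close> and \<open>undefined\<close> off \<open>\<aa>\<close>, so that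
  functionals agreeing on \<open>\<aa>\<close> are equal.  Sums of functionals are always compared pointwise on \<open>\<aa>\<close>.\<close>

definition dual_space :: "'a::real_vector set \<Rightarrow> ('a \<Rightarrow> real) set" where
  "dual_space \<aa> = {\<alpha> \<in> extensional \<aa>.
     (\<forall>x\<in>\<aa>. \<forall>y\<in>\<aa>. \<alpha> (x + y) = \<alpha> x + \<alpha> y) \<and> (\<forall>x\<in>\<aa>. \<forall>c. \<alpha> (c *\<^sub>R x) = c * \<alpha> x)}"

definition root_space ::
    "(real^'n^'n) set \<Rightarrow> (real^'n^'n) set \<Rightarrow> (real^'n^'n \<Rightarrow> real) \<Rightarrow> (real^'n^'n) set" where
  "root_space \<gg> \<aa> \<alpha> = {x \<in> \<gg>. \<forall>H\<in>\<aa>. lie_bracket H x = \<alpha> H *\<^sub>R x}"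

definition restricted_roots ::
    "(real^'n^'n) set \<Rightarrow> (real^'n^'n) set \<Rightarrow> (real^'n^'n \<Rightarrow> real) set" where
  "restricted_roots \<gg> \<aa> =
    {\<alpha> \<in> dual_space \<aa>. (\<exists>H\<in>\<aa>. \<alpha> H \<noteq> 0) \<and> root_space \<gg> \<aa> \<alpha> \<noteq> {0}}"

text \<open>A set \<open>\<Delta>\<close> of simple roots: linearly independent, and every root is a combination of elements
  of \<open>\<Delta>\<close> with integer coefficients that are all nonnegative or all nonpositive.\<close>

definition simple_roots :: "'a::real_vector set \<Rightarrow> ('a \<Rightarrow> real) set \<Rightarrow> ('a \<Rightarrow> real) set \<Rightarrow> bool" where
  "simple_roots \<aa> \<Phi> \<Delta> \<longleftrightarrow>
    \<Delta> \<subseteq> \<Phi> \<and> finite \<Delta> \<and>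
    (\<forall>c :: ('a \<Rightarrow> real) \<Rightarrow> real. (\<forall>H\<in>\<aa>. (\<Sum>\<alpha>\<in>\<Delta>. c \<alpha> * \<alpha> H) = 0) \<longrightarrow> (\<forall>\<alpha>\<in>\<Delta>. c \<alpha> = 0)) \<and>
    (\<forall>\<beta>\<in>\<Phi>. \<exists>c :: ('a \<Rightarrow> real) \<Rightarrow> nat.
        (\<forall>H\<in>\<aa>. \<beta> H = (\<Sum>\<alpha>\<in>\<Delta>. real (c \<alpha>) * \<alpha> H)) \<or>
        (\<forall>H\<in>\<aa>. \<beta> H = - (\<Sum>\<alpha>\<in>\<Delta>. real (c \<alpha>) * \<alpha> H)))"

definition positive_roots ::
    "'a::real_vector set \<Rightarrow> ('a \<Rightarrow> real) set \<Rightarrow> ('a \<Rightarrow> real) set \<Rightarrow> ('a \<Rightarrow> real) set" where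
  "positive_roots \<aa> \<Phi> \<Delta> =
    {\<beta>\<in>\<Phi>. \<exists>c :: ('a \<Rightarrow> real) \<Rightarrow> nat. \<forall>H\<in>\<aa>. \<beta> H = (\<Sum>\<alpha>\<in>\<Delta>. real (c \<alpha>) * \<alpha> H)}"

definition height :: "'a::real_vector set \<Rightarrow> ('a \<Rightarrow> real) set \<Rightarrow> ('a \<Rightarrow> real) \<Rightarrow> real" where
  "height \<aa> \<Delta> \<beta> =
    (THE h. \<exists>c. (\<forall>H\<in>\<aa>. \<beta> H = (\<Sum>\<alpha>\<in>\<Delta>. c \<alpha> * \<alpha> H)) \<and> h = (\<Sum>\<alpha>\<in>\<Delta>. c \<alpha>))"

text \<open>The sum of the root spaces of a set \<open>R\<close> of roots; it is automatically direct.\<close>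

definition root_space_sum ::
    "(real^'n^'n) set \<Rightarrow> (real^'n^'n) set \<Rightarrow> (real^'n^'n \<Rightarrow> real) set \<Rightarrow> (real^'n^'n) set" where
  "root_space_sum \<gg> \<aa> R = span (\<Union>\<alpha>\<in>R. root_space \<gg> \<aa> \<alpha>)"

definition nil_w ::
    "(real^'n^'n) set \<Rightarrow> (real^'n^'n) set \<Rightarrow> (real^'n^'n \<Rightarrow> real) set \<Rightarrow> (real^'n^'n) set" where
  "nil_w \<gg> \<aa> \<Delta> = root_space_sum \<gg> \<aa> (positive_roots \<aa> (restricted_roots \<gg> \<aa>) \<Delta>)"

definition nil_w_ge2 ::
    "(real^'n^'n) set \<Rightarrow> (real^'n^'n) set \<Rightarrow> (real^'n^'n \<Rightarrow> real) set \<Rightarrow> (real^'n^'n) set" where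
  "nil_w_ge2 \<gg> \<aa> \<Delta> =
    root_space_sum \<gg> \<aa> {\<alpha> \<in> positive_roots \<aa> (restricted_roots \<gg> \<aa>) \<Delta>. height \<aa> \<Delta> \<alpha> \<ge> 2}"

section \<open>Grassmannians\<close>

text \<open>The Grassmannian of \<open>k\<close>-dimensional subspaces of \<open>V\<close>, with the quotient topology from the
  space of linearly independent \<open>k\<close>-tuples in \<open>V\<close>.\<close>

definition frames :: "'a::euclidean_space set \<Rightarrow> nat \<Rightarrow> (nat \<Rightarrow> 'a) topology" where
  "frames V k = subtopology (product_topology (\<lambda>_. top_of_set V) {..<k})
     {v. inj_on v {..<k} \<and> independent (v ` {..<k})}"

definition grassmannian :: "'a::euclidean_space set \<Rightarrow> nat \<Rightarrow> 'a set topology" where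
  "grassmannian V k = topology (\<lambda>U.
     U \<subseteq> {W. subspace W \<and> W \<subseteq> V \<and> dim W = k} \<and>
     openin (frames V k) {v \<in> topspace (frames V k). span (v ` {..<k}) \<in> U})"

lemma openin_grassmannian:
  "openin (grassmannian V k) U \<longleftrightarrow>
     U \<subseteq> {W. subspace W \<and> W \<subseteq> V \<and> dim W = k} \<and>
     openin (frames V k) {v \<in> topspace (frames V k). span (v ` {..<k}) \<in> U}"
proof -
  let ?P = "\<lambda>U. {v \<in> topspace (frames V k). span (v ` {..<k}) \<in> U}"
  let ?O = "\<lambda>U. U \<subseteq> {W. subspace W \<and> W \<subseteq> V \<and> dim W = k} \<and> openin (frames V k) (?P U)"
  have "istopology ?O"
    unfolding istopology_def
  proof (intro conjI allI impI)
    fix S T assume "?O S" "?O T"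
    moreover have "?P (S \<inter> T) = ?P S \<inter> ?P T" by auto
    ultimately show "openin (frames V k) (?P (S \<inter> T))" by auto
  next
    fix \<K> assume "\<forall>K\<in>\<K>. ?O K"
    moreover have "?P (\<Union>\<K>) = (\<Union>K\<in>\<K>. ?P K)" by auto
    ultimately show "openin (frames V k) (?P (\<Union>\<K>))" by (metis (no_types, lifting) openin_Union imageE)
  next
    fix \<K> assume "\<forall>K\<in>\<K>. ?O K"
    then show "\<Union>\<K> \<subseteq> {W. subspace W \<and> W \<subseteq> V \<and> dim W = k}" by (meson Sup_least)
  qed auto
  then show ?thesis
    by (simp add: grassmannian_def topology_inverse')
qed

lemma topspace_grassmannian:
  assumes "subspace V"
  shows "topspace (grassmannian V k) = {W. subspace W \<and> W \<subseteq> V \<and> dim W = k}"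
proof -
  have "span (v ` {..<k}) \<in> {W. subspace W \<and> W \<subseteq> V \<and> dim W = k}"
    if "v \<in> topspace (frames V k)" for v
  proof -
    have v: "v ` {..<k} \<subseteq> V" "inj_on v {..<k}" "independent (v ` {..<k})"
      using that by (auto simp: frames_def)
    then show ?thesis
      using span_minimal[OF v(1) assms] by (simp add: dim_eq_card_independent card_image)
  qed
  then have "{v \<in> topspace (frames V k).
      span (v ` {..<k}) \<in> {W. subspace W \<and> W \<subseteq> V \<and> dim W = k}} = topspace (frames V k)"
    by blast
  then have "openin (grassmannian V k) {W. subspace W \<and> W \<subseteq> V \<and> dim W = k}"
    unfolding openin_grassmannian by (metis (no_types, lifting) openin_topspace subset_refl)
  moreover have "topspace (grassmannian V k) \<subseteq> {W. subspace W \<and> W \<subseteq> V \<and> dim W = k}"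
    using openin_grassmannian[of V k "topspace (grassmannian V k)"] by simp
  ultimately show ?thesis
    by (intro subset_antisym openin_subset)
qed

section \<open>Limiting subspaces\<close>

definition cartan_m ::
    "(real^'n^'n) set \<Rightarrow> (real^'n^'n \<Rightarrow> real^'n^'n) \<Rightarrow> (real^'n^'n) set \<Rightarrow> (real^'n^'n) set" where
  "cartan_m \<gg> \<theta> \<aa> = centralizer_in (cartan_k \<gg> \<theta>) \<aa>"

definition m_diamond :: "(real^'n^'n) set \<Rightarrow> (real^'n^'n \<Rightarrow> real^'n^'n) \<Rightarrow> (real^'n^'n) set \<Rightarrow>
    real^'n^'n \<Rightarrow> (real^'n^'n) set" where
  "m_diamond \<gg> \<theta> \<aa> n = centralizer_in (cartan_m \<gg> \<theta> \<aa>) {n}"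

definition m_star :: "(real^'n^'n) set \<Rightarrow> (real^'n^'n \<Rightarrow> real^'n^'n) \<Rightarrow> (real^'n^'n) set \<Rightarrow>
    real^'n^'n \<Rightarrow> (real^'n^'n) set" where
  "m_star \<gg> \<theta> \<aa> n =
    {x \<in> cartan_m \<gg> \<theta> \<aa>. \<forall>y \<in> m_diamond \<gg> \<theta> \<aa> n. cartan_inner \<gg> \<theta> x y = 0}"

definition subspace_sum :: "'a::real_vector set \<Rightarrow> 'a set \<Rightarrow> 'a set" where
  "subspace_sum V W = {x + y | x y. x \<in> V \<and> y \<in> W}"

definition Ad_exp_tends_to ::
    "(real^'n^'n) set \<Rightarrow> real^'n^'n \<Rightarrow> (real^'n^'n) set \<Rightarrow> (real^'n^'n) set \<Rightarrow> bool" where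
  "Ad_exp_tends_to \<gg> n V L \<longleftrightarrow>
    limitin (grassmannian \<gg> (dim V)) (\<lambda>t::real. Ad (mexp (t *\<^sub>R n)) ` V) L at_top"

definition is_limiting_lie_algebra :: "(real^'n^'n) set \<Rightarrow> (real^'n^'n \<Rightarrow> real^'n^'n) \<Rightarrow>
    (real^'n^'n) set \<Rightarrow> real^'n^'n \<Rightarrow> (real^'n^'n) set \<Rightarrow> bool" where
  "is_limiting_lie_algebra \<gg> \<theta> \<aa> n L \<longleftrightarrow>
    Ad_exp_tends_to \<gg> n (subspace_sum \<aa> (cartan_m \<gg> \<theta> \<aa>)) L"

definition is_star_limiting_space :: "(real^'n^'n) set \<Rightarrow> (real^'n^'n \<Rightarrow> real^'n^'n) \<Rightarrow>
    (real^'n^'n) set \<Rightarrow> real^'n^'n \<Rightarrow> (real^'n^'n) set \<Rightarrow> bool" where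
  "is_star_limiting_space \<gg> \<theta> \<aa> n L \<longleftrightarrow>
    Ad_exp_tends_to \<gg> n (subspace_sum \<aa> (m_star \<gg> \<theta> \<aa> n)) L"

definition nil_centralizer :: "(real^'n^'n) set \<Rightarrow> (real^'n^'n) set \<Rightarrow>
    (real^'n^'n \<Rightarrow> real) set \<Rightarrow> real^'n^'n \<Rightarrow> (real^'n^'n) set" where
  "nil_centralizer \<gg> \<aa> \<Delta> n = centralizer_in \<gg> {n} \<inter> nil_w \<gg> \<aa> \<Delta>"

definition centralizing :: "(real^'n^'n) set \<Rightarrow> (real^'n^'n) set \<Rightarrow>
    (real^'n^'n \<Rightarrow> real) set \<Rightarrow> real^'n^'n \<Rightarrow> (real^'n^'n) set \<Rightarrow> bool" where
  "centralizing \<gg> \<aa> \<Delta> n L \<longleftrightarrow> (\<exists>z \<in> nil_w_ge2 \<gg> \<aa> \<Delta>. L = nil_centralizer \<gg> \<aa> \<Delta> (n + z))"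

end

theory Submission
  imports Defs
begin

text \<open>Choose \<open>h \<in> \<aa>\<close> with \<open>\<alpha>(h) = 2\<close> for all simple \<open>\<alpha>\<close>.  As differences of simple roots are not roots and
  the brackets \<open>[n\<^sub>\<alpha>, \<theta> n\<^sub>\<alpha>]\<close> span \<open>\<aa>\<close>, there is \<open>f\<close> such that \<open>(n, h, f)\<close> is an sl2-triple.  The eigenvalues
  of \<open>ad h\<close> are even, its zero eigenspace is \<open>\<aa> \<oplus> \<mm>\<close>, and its positive eigenspaces span \<open>\<ww>\<close>.  By sl2 theory
  \<open>ad n\<close> maps the eigenspace of \<open>2j\<close> onto that of \<open>2j + 2\<close> for \<open>j \<ge> 0\<close>, and \<open>dim Z(n) = dim (\<aa> \<oplus> \<mm>)\<close>.
  So a vector \<open>v \<in> Z(n)\<close> of weight \<open>2m\<close> is \<open>(ad n)\<^sup>m w\<close> for some \<open>w \<in> \<aa> \<oplus> \<mm>\<close>, hence the limit of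
  \<open>m! t\<^sup>-\<^sup>m Ad(exp tn) w\<close>; counting dimensions gives the first limit.  For \<open>m \<ge> 1\<close> the component of \<open>w\<close> in
  \<open>Z(n) \<inter> (\<aa> \<oplus> \<mm>) = \<mm>\<^sup>\<diamond>\<close> is irrelevant, which gives the second one.\<close>

section \<open>Inner products on a subspace\<close>

text \<open>The inner product \<open>- B(x, \<theta> y)\<close> lives on \<gg> only and differs from
  the Euclidean product of the matrix space, so projections and the spectral theorem are developed
  for a form given on a carrier. With eigenvalue 2j of ad h indexed by j, the normalization
  \<open>\<alpha>(h) = 2\<close> puts n in weight 1. As no odd eigenvalues occur, a vector of weight
  m is reached from weight 0 in exactly m steps. The sl2 facts come from adjointness instead of a
  decomposition into irreducibles: the adjoint of ad n is - ad (\<theta> n), so ad n is onto in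
  positive weights once ad (\<theta> n) is injective there, and \<theta> turns this into injectivity
  of ad n on negative weights. Here the triple enters: \<theta> n lowers weights too, but in general
  it does not complete n and h to an sl2-triple, so f needs its own coefficients on the
  \<open>\<theta> n\<^sub>\<alpha>\<close>. In the Grassmannian, lying in the limit is not enough to
  fix it: the equality of dimensions turns limits of single vectors into convergence of
  subspaces.\<close>

lemma linear_extension_on_subspace:
  fixes f :: "'a::euclidean_space \<Rightarrow> 'b::real_vector"
  assumes W: "subspace W"
    and add: "\<And>x y. x \<in> W \<Longrightarrow> y \<in> W \<Longrightarrow> f (x + y) = f x + f y"
    and scale: "\<And>c x. x \<in> W \<Longrightarrow> f (c *\<^sub>R x) = c *\<^sub>R f x"
  shows "\<exists>g. linear g \<and> (\<forall>x\<in>W. g x = f x)"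
proof -
  obtain B where B: "B \<subseteq> W" "independent B" "W \<subseteq> span B"
    using maximal_independent_subset[of W] by blast
  obtain g where g: "linear g" "\<forall>x\<in>B. g x = f x"
    using linear_independent_extend[OF B(2)] by blast
  have "x \<in> W \<and> g x = f x" if "x \<in> span B" for x
    using that
  proof (induction rule: span_induct_alt)
    case base
    then show ?case
      using scale[of 0 0] subspace_0[OF W] linear_0[OF g(1)] by simp
  next
    case (step c x y)
    then show ?case
      using B(1) g W by (auto simp: add scale linear_add linear_scale subspace_add subspace_scale subsetD)
  qed
  then show ?thesis
    using B(3) g(1) by blast
qed

text \<open>The form is constrained only on W, since the Cartan inner product is meaningful only on
  the Lie algebra. The axioms pass to subspaces, which makes induction on the dimension
  possible.\<close>

locale inner_on =
  fixes W :: "'a::euclidean_space set" and ip :: "'a \<Rightarrow> 'a \<Rightarrow> real"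
  assumes subspace_W: "subspace W"
    and add_left: "x \<in> W \<Longrightarrow> y \<in> W \<Longrightarrow> z \<in> W \<Longrightarrow> ip (x + y) z = ip x z + ip y z"
    and scale_left: "x \<in> W \<Longrightarrow> y \<in> W \<Longrightarrow> ip (c *\<^sub>R x) y = c * ip x y"
    and ip_sym: "x \<in> W \<Longrightarrow> y \<in> W \<Longrightarrow> ip x y = ip y x"
    and ip_pos: "x \<in> W \<Longrightarrow> x \<noteq> 0 \<Longrightarrow> ip x x > 0"
begin

lemma W_closed:
  "0 \<in> W" "x \<in> W \<Longrightarrow> y \<in> W \<Longrightarrow> x + y \<in> W" "x \<in> W \<Longrightarrow> y \<in> W \<Longrightarrow> x - y \<in> W"
  "x \<in> W \<Longrightarrow> c *\<^sub>R x \<in> W" "x \<in> W \<Longrightarrow> - x \<in> W"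
  using subspace_W by (auto simp: subspace_0 subspace_add subspace_diff subspace_scale subspace_neg)

lemma add_right: "x \<in> W \<Longrightarrow> y \<in> W \<Longrightarrow> z \<in> W \<Longrightarrow> ip z (x + y) = ip z x + ip z y"
  using add_left[of x y z] by (simp add: ip_sym W_closed)

lemma scale_right: "x \<in> W \<Longrightarrow> y \<in> W \<Longrightarrow> ip y (c *\<^sub>R x) = c * ip y x"
  using scale_left[of x y c] by (simp add: ip_sym W_closed)

lemma zero_left: "x \<in> W \<Longrightarrow> ip 0 x = 0"
  using scale_left[of x x 0] by simp

lemma zero_right: "x \<in> W \<Longrightarrow> ip x 0 = 0"
  using scale_right[of x x 0] by simp

lemma diff_left: "x \<in> W \<Longrightarrow> y \<in> W \<Longrightarrow> z \<in> W \<Longrightarrow> ip (x - y) z = ip x z - ip y z"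
  using add_left[of "x - y" y z] by (simp add: W_closed)

lemma minus_left: "x \<in> W \<Longrightarrow> y \<in> W \<Longrightarrow> ip (- x) y = - ip x y"
  using scale_left[of x y "- 1"] by simp

lemma minus_right: "x \<in> W \<Longrightarrow> y \<in> W \<Longrightarrow> ip y (- x) = - ip y x"
  using scale_right[of x y "- 1"] by simp

lemma ip_eq_0_iff: "x \<in> W \<Longrightarrow> ip x x = 0 \<longleftrightarrow> x = 0"
  using ip_pos[of x] zero_left[of 0] W_closed(1) by fastforce

lemma sum_left:
  assumes "finite I" "\<And>i. i \<in> I \<Longrightarrow> f i \<in> W" "y \<in> W"
  shows "ip (\<Sum>i\<in>I. f i) y = (\<Sum>i\<in>I. ip (f i) y)"
  using assms
  by (induction I rule: finite_induct) (auto simp: zero_left add_left subspace_sum subspace_W)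

lemma inner_on_subspace: "subspace U \<Longrightarrow> U \<subseteq> W \<Longrightarrow> inner_on U ip"
  by unfold_locales (auto simp: add_left scale_left ip_sym ip_pos subsetD)

lemma orthogonal_span:
  assumes "S \<subseteq> W" "y \<in> W" "\<And>s. s \<in> S \<Longrightarrow> ip y s = 0" "v \<in> span S"
  shows "ip y v = 0"
proof -
  have "v \<in> W \<and> ip y v = 0"
    using assms(4)
  proof (induction rule: span_induct_alt)
    case base
    then show ?case by (simp add: W_closed zero_right assms(2))
  next
    case (step c x z)
    then show ?case
      using assms by (auto simp: W_closed add_right scale_right)
  qed
  then show ?thesis ..
qed

text \<open>One Gram-Schmidt step per basis vector: q is the part of b orthogonal to
  \<open>span B\<close>, and the old projection of y is corrected by its Fourier coefficient along
  q. If q vanishes, b adds nothing to the span.\<close>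

lemma orthogonal_projection_span:
  assumes "finite B" "B \<subseteq> W" "y \<in> W"
  shows "\<exists>u\<in>span B. \<forall>v\<in>span B. ip (y - u) v = 0"
  using assms
proof (induction B arbitrary: y rule: finite_induct)
  case empty
  then show ?case by (simp add: zero_right)
next
  case (insert b B)
  have BW: "span B \<subseteq> W" "b \<in> W" "B \<subseteq> W"
    using insert.prems span_minimal[OF _ subspace_W, of B] by auto
  obtain p where p: "p \<in> span B" "\<forall>v\<in>span B. ip (b - p) v = 0"
    using insert.IH[of b] BW by blast
  obtain u where u: "u \<in> span B" "\<forall>v\<in>span B. ip (y - u) v = 0"
    using insert.IH[of y] BW insert.prems by blast
  define q where "q = b - p"
  have "p \<in> span (insert b B)" "b \<in> span (insert b B)"
    using p(1) span_mono[of B "insert b B"] by (auto simp: span_base)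
  then have q: "q \<in> W" "q \<in> span (insert b B)"
    using p(1) BW by (auto simp: q_def W_closed span_diff)
  have uW: "u \<in> W" "p \<in> W" "y \<in> W" using u p BW insert.prems by auto
  show ?case
  proof (cases "q = 0")
    case True
    then have "p = b" by (simp add: q_def)
    then have "b \<in> span B" using p(1) by blast
    then have "span (insert b B) = span B" by (rule span_redundant)
    then show ?thesis
      using u by metis
  next
    case False
    define c where "c = ip (y - u) q / ip q q"
    have qq: "ip q q \<noteq> 0" using False ip_eq_0_iff q by simp
    have "u + c *\<^sub>R q \<in> span (insert b B)"
      using u(1) q(2) by (intro span_add span_scale) (auto intro: span_mono[THEN subsetD, of B "insert b B"])
    moreover have "ip (y - (u + c *\<^sub>R q)) v = 0" if "v \<in> span (insert b B)" for v
    proof (rule orthogonal_span[OF _ _ _ that])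
      show "y - (u + c *\<^sub>R q) \<in> W" using uW q by (simp add: W_closed)
      show "insert b B \<subseteq> W" using BW by simp
      have split: "ip (y - (u + c *\<^sub>R q)) v = ip (y - u) v - c * ip q v" if "v \<in> W" for v
      proof -
        have "y - (u + c *\<^sub>R q) = (y - u) - c *\<^sub>R q" by simp
        then show ?thesis using uW q that by (simp only: diff_left W_closed scale_left)
      qed
      have orth: "ip (y - (u + c *\<^sub>R q)) v = 0" if "v \<in> span B" for v
        using that u(2) p(2) BW split[of v] by (auto simp: q_def)
      have "ip (y - (u + c *\<^sub>R q)) q = 0"
        using split[OF q(1)] qq by (simp add: c_def)
      moreover have "b = q + p" by (simp add: q_def)
      ultimately have "ip (y - (u + c *\<^sub>R q)) b = 0"
        using orth[OF p(1)] uW q by (simp add: add_right W_closed)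
      then show "ip (y - (u + c *\<^sub>R q)) s = 0" if "s \<in> insert b B" for s
        using that orth[OF span_base, of s] by auto
    qed
    ultimately show ?thesis by blast
  qed
qed

lemma orthogonal_projection:
  assumes "subspace U" "U \<subseteq> W" "y \<in> W"
  shows "\<exists>u\<in>U. \<forall>v\<in>U. ip (y - u) v = 0"
proof -
  obtain B where B: "B \<subseteq> U" "independent B" "U \<subseteq> span B"
    using maximal_independent_subset[of U] by blast
  have "span B = U" using B assms(1) by (simp add: span_minimal subset_antisym)
  moreover have "finite B" using B(2) independent_bound by blast
  ultimately show ?thesis
    using orthogonal_projection_span[of B y] B assms by auto
qed

text \<open>Nothing relates \<open>ip\<close> to the topology a priori. In a basis of W the
  expression becomes a finite sum of products of linear functionals, which are continuous in finite
  dimension.\<close>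

lemma continuous_on_quadratic:
  assumes T: "linear T" "T ` W \<subseteq> W"
  shows "continuous_on W (\<lambda>x. ip (T x) x)"
proof -
  obtain B where B: "B \<subseteq> W" "independent B" "W \<subseteq> span B"
    using maximal_independent_subset[of W] by blast
  have fin: "finite B" using B(2) independent_bound by blast
  have "\<exists>\<phi>. linear \<phi> \<and> (\<forall>x\<in>W. \<phi> x = ip (T x) b)" if "b \<in> B" for b
  proof (rule linear_extension_on_subspace[OF subspace_W])
    show "ip (T (x + y)) b = ip (T x) b + ip (T y) b" if "x \<in> W" "y \<in> W" for x y
      using that \<open>b \<in> B\<close> B T by (auto simp: linear_add add_left image_subset_iff)
    show "ip (T (c *\<^sub>R x)) b = c *\<^sub>R ip (T x) b" if "x \<in> W" for c x
      using that \<open>b \<in> B\<close> B T by (auto simp: linear_scale scale_left image_subset_iff)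
  qed
  then obtain \<phi> where \<phi>: "\<And>b. b \<in> B \<Longrightarrow> linear (\<phi> b)" "\<And>b x. b \<in> B \<Longrightarrow> x \<in> W \<Longrightarrow> \<phi> b x = ip (T x) b"
    by metis
  have "\<exists>\<psi>. linear \<psi> \<and> (\<forall>x\<in>W. \<psi> x = representation B x b)" for b
    by (rule linear_extension_on_subspace[OF subspace_W])
      (use B in \<open>auto simp: representation_add representation_scale subsetD\<close>)
  then obtain \<psi> where \<psi>: "\<And>b. linear (\<psi> b)" "\<And>b x. x \<in> W \<Longrightarrow> \<psi> b x = representation B x b"
    by metis
  have eq: "ip (T x) x = (\<Sum>b\<in>B. \<psi> b x * \<phi> b x)" if x: "x \<in> W" for x
  proof -
    have Tx: "T x \<in> W" using T x by auto
    have "x = (\<Sum>b\<in>B. \<psi> b x *\<^sub>R b)"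
      using sum_representation_eq[OF B(2) _ fin subset_refl, of x] x B(3) \<psi>(2) by (simp add: subsetD)
    then have "ip (T x) x = ip (\<Sum>b\<in>B. \<psi> b x *\<^sub>R b) (T x)"
      using ip_sym[OF Tx x] by simp
    also have "\<dots> = (\<Sum>b\<in>B. \<psi> b x * ip b (T x))"
      using fin B Tx by (subst sum_left) (auto simp: W_closed scale_left subsetD intro!: sum.cong)
    also have "\<dots> = (\<Sum>b\<in>B. \<psi> b x * \<phi> b x)"
      using B Tx x by (intro sum.cong) (auto simp: \<phi> ip_sym subsetD)
    finally show ?thesis .
  qed
  have "continuous_on W (\<lambda>x. \<Sum>b\<in>B. \<psi> b x * \<phi> b x)"
    by (intro continuous_on_sum continuous_on_mult linear_continuous_on linear_conv_bounded_linear[THEN iffD1] \<psi>(1) \<phi>(1))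
  then show ?thesis
    by (simp add: eq cong: continuous_on_cong)
qed

text \<open>The maximum of the Rayleigh quotient is an eigenvalue: a vector that is isotropic for the
  positive semidefinite form \<open>l ip(x, y) - ip(Tx, y)\<close> lies in its radical.\<close>

lemma symmetric_has_eigenvector:
  assumes T: "linear T" "T ` W \<subseteq> W"
    and sym: "\<And>x y. x \<in> W \<Longrightarrow> y \<in> W \<Longrightarrow> ip (T x) y = ip x (T y)"
    and "W \<noteq> {0}"
  shows "\<exists>x\<in>W. x \<noteq> 0 \<and> (\<exists>c. T x = c *\<^sub>R x)"
proof -
  define q where "q x = ip (T x) x / ip x x" for x
  let ?S = "W \<inter> sphere 0 1"
  have TW: "T x \<in> W" if "x \<in> W" for x using T(2) that by auto
  obtain w where w: "w \<in> W" "w \<noteq> 0" using \<open>W \<noteq> {0}\<close> W_closed(1) by blast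
  have "w /\<^sub>R norm w \<in> ?S" using w by (simp add: W_closed)
  then have "?S \<noteq> {}" by blast
  moreover have "compact ?S"
    using closed_subspace[OF subspace_W] by (simp add: closed_Int_compact)
  moreover have "continuous_on ?S q"
  proof -
    have "continuous_on ?S (\<lambda>x. ip (T x) x)" "continuous_on ?S (\<lambda>x. ip x x)"
      using continuous_on_quadratic[OF T] continuous_on_quadratic[OF linear_id]
      by (auto intro: continuous_on_subset)
    moreover have "ip x x \<noteq> 0" if "x \<in> ?S" for x
      using that ip_eq_0_iff[of x] by auto
    ultimately show ?thesis
      unfolding q_def by (intro continuous_intros) auto
  qed
  ultimately obtain x where x: "x \<in> ?S" "\<forall>y\<in>?S. q y \<le> q x"
    using continuous_attains_sup[of ?S q] by blast
  define c where "c = q x"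
  have xW: "x \<in> W" "x \<noteq> 0" using x by auto
  define D where "D y = c *\<^sub>R y - T y" for y
  have D: "D y \<in> W" if "y \<in> W" for y using that TW by (simp add: D_def W_closed)
  have D_lin: "D (y + s *\<^sub>R z) = D y + s *\<^sub>R D z" for y z s
    using T(1) by (simp add: D_def linear_add linear_scale algebra_simps)
  have Dsym: "ip (D y) z = ip (D z) y" if "y \<in> W" "z \<in> W" for y z
    using that sym[of y z] ip_sym[of y z] ip_sym[of y "T z"]
    by (simp add: D_def diff_left scale_left TW W_closed)
  have pos: "0 \<le> ip (D y) y" if y: "y \<in> W" for y
  proof (cases "y = 0")
    case False
    let ?y = "y /\<^sub>R norm y"
    have "q ?y \<le> c" using x(2) y False by (auto simp: c_def W_closed)
    moreover have "q ?y = q y"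
      using y False T(1) TW by (simp add: q_def linear_scale scale_left scale_right W_closed)
    ultimately have "ip (T y) y \<le> c * ip y y"
      using ip_pos[OF y False] by (simp only: q_def pos_divide_le_eq)
    then show ?thesis
      using y TW by (simp add: D_def diff_left scale_left W_closed)
  qed (use zero_right[OF D[OF y]] in simp)
  have "ip (T x) x = c * ip x x"
    using ip_eq_0_iff xW by (simp add: c_def q_def)
  then have isotropic: "ip (D x) x = 0"
    using xW TW by (simp add: D_def diff_left scale_left W_closed)
  define b where "b = ip (D x) (D x)"
  have b0: "b = 0"
  proof (rule ccontr)
    assume "b \<noteq> 0"
    then have b: "b > 0" using ip_pos[of "D x"] ip_eq_0_iff[of "D x"] D[OF xW(1)] by (fastforce simp: b_def)
    define a where "a = ip (D (D x)) (D x)"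
    have a: "a \<ge> 0" using pos D xW by (simp add: a_def)
    \<comment> \<open>The form at x + s D x equals s (2 b + s a). A small negative s makes it
      negative: this choice gives |s| a \<le> b, and the summand 1 covers the case a = 0.\<close>
    define s where "s = - b / (a + 1)"
    have "0 \<le> ip (D (x + s *\<^sub>R D x)) (x + s *\<^sub>R D x)"
      using D xW by (intro pos) (simp add: W_closed)
    also have "\<dots> = ip (D x) x + s * ip (D x) (D x) + s * (ip (D (D x)) x + s * ip (D (D x)) (D x))"
      using D xW by (simp add: D_lin add_left add_right scale_left scale_right W_closed algebra_simps)
    also have "\<dots> = s * (2 * b + s * a)"
      using Dsym[of "D x" x] D xW isotropic by (simp add: a_def b_def algebra_simps)
    finally have "0 \<le> s * (2 * b + s * a)" .
    moreover have "s < 0" using a b by (simp add: s_def divide_neg_pos)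
    moreover have "2 * b + s * a > 0"
    proof -
      have "b * a / (a + 1) \<le> b" using a b by (simp add: divide_le_eq)
      then show ?thesis using b by (simp add: s_def)
    qed
    ultimately show False by (simp add: zero_le_mult_iff)
  qed
  then have "D x = 0" using ip_eq_0_iff D xW by (simp add: b_def)
  then have "T x = c *\<^sub>R x" by (simp add: D_def)
  then show ?thesis using xW by blast
qed

end

section \<open>Simultaneous diagonalization of commuting symmetric operators\<close>

definition common_eigenvector :: "('a::real_vector \<Rightarrow> 'a) set \<Rightarrow> 'a \<Rightarrow> bool" where
  "common_eigenvector \<T> x \<longleftrightarrow> (\<forall>T\<in>\<T>. \<exists>c. T x = c *\<^sub>R x)"

text \<open>An eigenspace of a non-scalar T is a proper nonzero subspace, and it is invariant under
  everything that commutes with T. The induction runs over the dimension, so the family of operators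
  may be infinite.\<close>

lemma commuting_symmetric_common_eigenvector:
  assumes "inner_on W ip" "W \<noteq> {0}"
    and T: "\<And>T. T \<in> \<T> \<Longrightarrow> linear T" "\<And>T. T \<in> \<T> \<Longrightarrow> T ` W \<subseteq> W"
    and sym: "\<And>T x y. T \<in> \<T> \<Longrightarrow> x \<in> W \<Longrightarrow> y \<in> W \<Longrightarrow> ip (T x) y = ip x (T y)"
    and comm: "\<And>S T x. S \<in> \<T> \<Longrightarrow> T \<in> \<T> \<Longrightarrow> x \<in> W \<Longrightarrow> S (T x) = T (S x)"
  shows "\<exists>x\<in>W. x \<noteq> 0 \<and> common_eigenvector \<T> x"
  using assms
proof (induction "dim W" arbitrary: W rule: less_induct)
  case less
  interpret inner_on W ip by (rule less.prems)
  show ?case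
  proof (cases "\<forall>T\<in>\<T>. \<exists>c. \<forall>x\<in>W. T x = c *\<^sub>R x")
    case True
    moreover obtain x where "x \<in> W" "x \<noteq> 0" using less.prems(2) W_closed(1) by blast
    ultimately show ?thesis unfolding common_eigenvector_def by blast
  next
    case False
    then obtain T where T: "T \<in> \<T>" "\<And>c. \<exists>x\<in>W. T x \<noteq> c *\<^sub>R x" by blast
    obtain x c where x: "x \<in> W" "x \<noteq> 0" "T x = c *\<^sub>R x"
      using symmetric_has_eigenvector[of T] less.prems T(1) by blast
    define U where "U = {y \<in> W. T y = c *\<^sub>R y}"
    have lin: "linear T" using less.prems T by blast
    have U: "subspace U" "U \<subseteq> W"
      by (auto simp: U_def subspace_def W_closed linear_0[OF lin] linear_add[OF lin]
          linear_scale[OF lin] algebra_simps)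
    have "U \<subset> W" using T(2)[of c] by (auto simp: U_def)
    then have dimU: "dim U < dim W"
      using U subspace_W by (metis dim_subset le_neq_implies_less less_le subspace_dim_equal order_refl)
    have "\<exists>x\<in>U. x \<noteq> 0 \<and> common_eigenvector \<T> x"
    proof (rule less.hyps[OF dimU inner_on_subspace[OF U]])
      show "U \<noteq> {0}" using x by (auto simp: U_def)
      show "linear S" if "S \<in> \<T>" for S using less.prems that by blast
      show "S ` U \<subseteq> U" if S: "S \<in> \<T>" for S
      proof
        fix z assume "z \<in> S ` U"
        then obtain y where y: "y \<in> W" "T y = c *\<^sub>R y" "z = S y" by (auto simp: U_def)
        have "T (S y) = S (T y)" using less.prems(6) S T(1) y by metis
        also have "\<dots> = c *\<^sub>R S y" using less.prems(3) S y by (simp add: linear_scale)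
        finally show "z \<in> U" using less.prems(4)[OF S] y by (auto simp: U_def)
      qed
      show "ip (S y) z = ip y (S z)" if "S \<in> \<T>" "y \<in> U" "z \<in> U" for S y z
        using that U(2) less.prems(5) by blast
      show "S (S' y) = S' (S y)" if "S \<in> \<T>" "S' \<in> \<T>" "y \<in> U" for S S' y
        using that U(2) less.prems(6) by blast
    qed
    then show ?thesis using U by blast
  qed
qed

text \<open>The orthogonal complement U of all common eigenvectors is invariant by symmetry. If
  nonzero, it would contain a common eigenvector, which would then be orthogonal to itself.\<close>

lemma commuting_symmetric_diagonalizable:
  assumes inner: "inner_on W ip"
    and T: "\<And>T. T \<in> \<T> \<Longrightarrow> linear T" "\<And>T. T \<in> \<T> \<Longrightarrow> T ` W \<subseteq> W"
    and sym: "\<And>T x y. T \<in> \<T> \<Longrightarrow> x \<in> W \<Longrightarrow> y \<in> W \<Longrightarrow> ip (T x) y = ip x (T y)"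
    and comm: "\<And>S T x. S \<in> \<T> \<Longrightarrow> T \<in> \<T> \<Longrightarrow> x \<in> W \<Longrightarrow> S (T x) = T (S x)"
  shows "span {x \<in> W. common_eigenvector \<T> x} = W"
proof
  interpret inner_on W ip by (rule inner)
  define E where "E = {x \<in> W. common_eigenvector \<T> x}"
  show "span {x \<in> W. common_eigenvector \<T> x} \<subseteq> W"
    by (rule span_minimal[OF _ subspace_W]) auto
  then have EW: "span E \<subseteq> W" by (simp add: E_def)
  define U where "U = {y \<in> W. \<forall>e\<in>E. ip y e = 0}"
  have E: "e \<in> W" if "e \<in> E" for e using that by (simp add: E_def)
  have U: "subspace U" "U \<subseteq> W"
    by (auto simp: U_def subspace_def W_closed E zero_left add_left scale_left)
  have "U = {0}"
  proof (rule ccontr)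
    assume "U \<noteq> {0}"
    have "\<exists>x\<in>U. x \<noteq> 0 \<and> common_eigenvector \<T> x"
    proof (rule commuting_symmetric_common_eigenvector[OF inner_on_subspace[OF U] \<open>U \<noteq> {0}\<close>])
      show "S ` U \<subseteq> U" if S: "S \<in> \<T>" for S
      proof
        fix z assume "z \<in> S ` U"
        then obtain y where y: "y \<in> W" "\<forall>e\<in>E. ip y e = 0" "z = S y" by (auto simp: U_def)
        have "ip (S y) e = 0" if e: "e \<in> E" for e
        proof -
          obtain c where "S e = c *\<^sub>R e" using e S by (auto simp: E_def common_eigenvector_def)
          then have "ip (S y) e = ip y (c *\<^sub>R e)" using sym[OF S y(1) E[OF e]] by simp
          then show ?thesis using y E[OF e] e by (simp add: scale_right)
        qed
        then show "z \<in> U" using y T(2)[OF S] by (auto simp: U_def)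
      qed
      show "ip (S y) z = ip y (S z)" if "S \<in> \<T>" "y \<in> U" "z \<in> U" for S y z
        using that U(2) sym by blast
      show "S (S' y) = S' (S y)" if "S \<in> \<T>" "S' \<in> \<T>" "y \<in> U" for S S' y
        using that U(2) comm by blast
    qed (rule T(1))
    then obtain x where x: "x \<in> U" "x \<noteq> 0" "common_eigenvector \<T> x" by blast
    then have "x \<in> E" "x \<in> W" using U by (auto simp: E_def)
    then have "ip x x = 0" using x by (auto simp: U_def)
    then show False using ip_eq_0_iff \<open>x \<in> W\<close> x by blast
  qed
  show "W \<subseteq> span {x \<in> W. common_eigenvector \<T> x}"
  proof
    fix y assume y: "y \<in> W"
    obtain u where u: "u \<in> span E" "\<forall>v\<in>span E. ip (y - u) v = 0"
      using orthogonal_projection[OF subspace_span EW y] by blast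
    then have "y - u \<in> U" using y EW by (auto simp: U_def W_closed span_base subsetD)
    then show "y \<in> span {x \<in> W. common_eigenvector \<T> x}"
      using \<open>U = {0}\<close> u by (simp add: E_def)
  qed
qed

section \<open>The matrix exponential\<close>

text \<open>Square matrices with the matrix product and the operator norm form a Banach algebra; the type
  \<open>real^'n^'n\<close> itself carries the componentwise product.\<close>

typedef 'n sqmat = "UNIV :: (real^'n^'n) set"
  morphisms mat_of Sqmat ..

declare mat_of_inverse [simp] Sqmat_inverse [OF UNIV_I, simp]

lemma sqmat_eq_iff: "A = B \<longleftrightarrow> mat_of A = mat_of B"
  by (simp add: mat_of_inject)

lemma matrix_add_rdistrib: "(A + B) ** C = A ** C + B ** (C :: 'a::semiring_1^'n^'m)"
  by (vector matrix_matrix_mult_def sum.distrib[symmetric] distrib_right)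

lemma linear_times_vec: "bounded_linear ((*v) (A :: real^'n^'n))"
  by (simp add: linear_conv_bounded_linear[symmetric])

instantiation sqmat :: (finite) real_normed_algebra_1
begin

definition "0 = Sqmat 0"
definition "1 = Sqmat (mat 1)"
definition "A + B = Sqmat (mat_of A + mat_of B)"
definition "A - B = Sqmat (mat_of A - mat_of B)"
definition "- A = Sqmat (- mat_of A)"
definition "A * B = Sqmat (mat_of A ** mat_of B)"
definition "c *\<^sub>R A = Sqmat (c *\<^sub>R mat_of A)"
definition "norm A = onorm ((*v) (mat_of A))"
definition "dist A B = norm (A - B :: 'a sqmat)"
definition "sgn A = Sqmat (mat_of A /\<^sub>R norm (A :: 'a sqmat))"
definition uniformity_sqmat :: "('a sqmat \<times> 'a sqmat) filter" where
  "uniformity_sqmat = (INF e\<in>{0<..}. principal {(x, y). dist x y < e})"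
definition open_sqmat :: "'a sqmat set \<Rightarrow> bool" where
  "open_sqmat U = (\<forall>x\<in>U. \<forall>\<^sub>F (x', y) in uniformity. x' = x \<longrightarrow> y \<in> U)"

lemmas sqmat_defs = zero_sqmat_def one_sqmat_def plus_sqmat_def minus_sqmat_def uminus_sqmat_def
  times_sqmat_def scaleR_sqmat_def

instance
proof
  fix A B C :: "'a sqmat" and a b :: real
  show "A + B + C = A + (B + C)" "A + B = B + A" "0 + A = A" "- A + A = 0" "A - B = A + - B"
    "a *\<^sub>R (A + B) = a *\<^sub>R A + a *\<^sub>R B" "(a + b) *\<^sub>R A = a *\<^sub>R A + b *\<^sub>R A"
    "a *\<^sub>R b *\<^sub>R A = (a * b) *\<^sub>R A" "1 *\<^sub>R A = A"
    by (simp_all add: sqmat_defs sqmat_eq_iff algebra_simps)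
  show "A * B * C = A * (B * C)" "(A + B) * C = A * C + B * C" "A * (B + C) = A * B + A * C"
    "1 * A = A" "A * 1 = A" "a *\<^sub>R A * B = a *\<^sub>R (A * B)" "A * a *\<^sub>R B = a *\<^sub>R (A * B)"
    by (simp_all add: sqmat_defs sqmat_eq_iff matrix_mul_assoc matrix_add_ldistrib
        matrix_add_rdistrib matrix_scalar_ac scalar_matrix_assoc scalar_mult_eq_scaleR[symmetric])
  show "0 \<noteq> (1 :: 'a sqmat)"
    by (simp add: sqmat_defs sqmat_eq_iff vec_eq_iff mat_def)
  have norm_0: "mat_of A = 0 \<longleftrightarrow> norm A = 0" for A :: "'a sqmat"
  proof
    assume "norm A = 0"
    then have "\<bar>mat_of A $ i $ j\<bar> \<le> 0" for i j
      using matrix_component_le_onorm[of "mat_of A" i j] by (simp add: norm_sqmat_def)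
    then show "mat_of A = 0" by (simp add: vec_eq_iff)
  next
    assume "mat_of A = 0"
    moreover have "(*v) (0 :: real^'a^'a) = (\<lambda>x. 0)" by (simp add: fun_eq_iff)
    ultimately show "norm A = 0" by (simp add: norm_sqmat_def onorm_zero)
  qed
  show "norm A = 0 \<longleftrightarrow> A = 0"
    using norm_0[of A] by (simp add: zero_sqmat_def sqmat_eq_iff)
  show "norm (A + B) \<le> norm A + norm B"
    using onorm_triangle[OF linear_times_vec[of "mat_of A"] linear_times_vec[of "mat_of B"]]
    by (simp add: norm_sqmat_def plus_sqmat_def matrix_vector_mult_add_rdistrib[abs_def])
  show "norm (a *\<^sub>R A) = \<bar>a\<bar> * norm A"
    using onorm_scaleR[OF linear_times_vec[of "mat_of A"], of a]
    by (simp add: norm_sqmat_def scaleR_sqmat_def scaleR_matrix_vector_assoc)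
  show "norm (A * B) \<le> norm A * norm B"
    using onorm_compose[OF linear_times_vec[of "mat_of A"] linear_times_vec[of "mat_of B"]]
    by (simp add: norm_sqmat_def times_sqmat_def o_def matrix_vector_mul_assoc)
  show "norm (1 :: 'a sqmat) = 1"
    using onorm_id[where 'a = "real^'a"]
    by (simp add: norm_sqmat_def one_sqmat_def matrix_vector_mul_lid[abs_def])
qed (simp_all add: dist_sqmat_def sgn_sqmat_def scaleR_sqmat_def uniformity_sqmat_def open_sqmat_def)

end

text \<open>Carries limits, series and derivatives from the operator norm back to the Euclidean norm
  of matrices. Each entry is at most the operator norm, and there are \<open>CARD('n)\<close>
  squared entries.\<close>

lemma bounded_linear_mat_of: "bounded_linear (mat_of :: 'n::finite sqmat \<Rightarrow> _)"
proof (rule bounded_linear_intro)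
  show "norm (mat_of A) \<le> norm A * (real CARD('n) * real CARD('n))" for A :: "'n sqmat"
  proof -
    have "norm (mat_of A) \<le> (\<Sum>i\<in>UNIV. norm (mat_of A $ i))"
      unfolding norm_vec_def by (rule L2_set_le_sum) simp
    also have "\<dots> \<le> (\<Sum>i\<in>(UNIV::'n set). \<Sum>j\<in>(UNIV::'n set). norm A)"
    proof (rule sum_mono)
      fix i
      have "norm (mat_of A $ i) \<le> (\<Sum>j\<in>UNIV. norm (mat_of A $ i $ j))"
        unfolding norm_vec_def by (rule L2_set_le_sum) simp
      also have "\<dots> \<le> (\<Sum>j\<in>(UNIV::'n set). norm A)"
        by (intro sum_mono) (simp add: norm_sqmat_def matrix_component_le_onorm)
      finally show "norm (mat_of A $ i) \<le> (\<Sum>j\<in>(UNIV::'n set). norm A)" .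
    qed
    finally show ?thesis by (simp add: mult_ac)
  qed
qed (simp_all add: sqmat_defs)

lemma linear_Sqmat: "linear (Sqmat :: real^'n^'n \<Rightarrow> 'n sqmat)"
  by unfold_locales (simp_all add: sqmat_defs)

lemma bounded_linear_Sqmat: "bounded_linear (Sqmat :: real^'n^'n \<Rightarrow> 'n sqmat)"
  using linear_Sqmat linear_conv_bounded_linear by blast

instance sqmat :: (finite) banach
proof
  fix X :: "nat \<Rightarrow> 'a sqmat"
  assume "Cauchy X"
  then have "convergent (\<lambda>i. mat_of (X i))"
    by (intro Cauchy_convergent bounded_linear.Cauchy[OF bounded_linear_mat_of])
  then obtain L where "(\<lambda>i. mat_of (X i)) \<longlonglongrightarrow> L" by (auto simp: convergent_def)
  then have "(\<lambda>i. Sqmat (mat_of (X i))) \<longlonglongrightarrow> Sqmat L"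
    by (rule bounded_linear.tendsto[OF bounded_linear_Sqmat])
  then show "convergent X" by (auto simp: convergent_def)
qed

lemma mat_of_simps:
  "mat_of 0 = 0" "mat_of 1 = mat 1" "mat_of (A + B) = mat_of A + mat_of B"
  "mat_of (A - B) = mat_of A - mat_of B" "mat_of (- A) = - mat_of A"
  "mat_of (A * B) = mat_of A ** mat_of B" "mat_of (c *\<^sub>R A) = c *\<^sub>R mat_of A"
  by (simp_all add: sqmat_defs)

lemma Sqmat_simps:
  "Sqmat (A + B) = Sqmat A + Sqmat B" "Sqmat (A - B) = Sqmat A - Sqmat B" "Sqmat (- A) = - Sqmat A"
  "Sqmat (A ** B) = Sqmat A * Sqmat B" "Sqmat (c *\<^sub>R A) = c *\<^sub>R Sqmat A"
  by (simp_all add: sqmat_defs)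

lemma mexp_eq_exp: "mexp X = mat_of (exp (Sqmat X))"
proof -
  have "((**) X ^^ k) (mat 1) = mat_of (Sqmat X ^ k)" for k
    by (induction k) (simp_all add: mat_of_simps)
  then have "mexp X = (\<Sum>k. mat_of (Sqmat X ^ k /\<^sub>R fact k))"
    by (simp add: mexp_def mat_of_simps)
  also have "\<dots> = mat_of (\<Sum>k. Sqmat X ^ k /\<^sub>R fact k)"
    by (intro bounded_linear.suminf[OF bounded_linear_mat_of, symmetric] summable_exp_generic)
  finally show ?thesis by (simp add: exp_def)
qed

lemma mexp_0 [simp]: "mexp 0 = mat 1"
  by (simp add: mexp_eq_exp mat_of_simps zero_sqmat_def[symmetric])

lemma mexp_mult_minus: "mexp X ** mexp (- X) = mat 1"
  by (simp add: mexp_eq_exp Sqmat_simps mat_of_simps[symmetric] exp_minus_inverse)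

lemma invertible_mexp: "invertible (mexp X)"
  unfolding invertible_def using mexp_mult_minus[of X] mexp_mult_minus[of "- X"] by auto

lemma matrix_inv_eqI:
  fixes A B :: "real^'n^'n"
  assumes "A ** B = mat 1"
  shows "matrix_inv A = B"
proof -
  have "A ** B = mat 1 \<and> B ** A = mat 1"
    using assms matrix_left_right_inverse by blast
  then have "matrix_inv A ** A = mat 1"
    unfolding matrix_inv_def by (rule someI2) simp
  then have "matrix_inv A ** A ** B = B" by simp
  then show ?thesis using assms by (simp add: matrix_mul_assoc[symmetric])
qed

lemma matrix_inv_mexp: "matrix_inv (mexp X) = mexp (- X)"
  by (rule matrix_inv_eqI[OF mexp_mult_minus])

lemma exp_conjugate:
  fixes a b x :: "'a::{real_normed_algebra_1, banach}"
  assumes "a * b = 1" "b * a = 1"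
  shows "exp (a * x * b) = a * exp x * b"
proof -
  have pow: "(a * x * b) ^ k = a * x ^ k * b" for k
  proof (induction k)
    case (Suc k)
    have "(a * x * b) ^ Suc k = (a * x * b) * (a * x ^ k * b)"
      by (simp only: Suc power_Suc)
    also have "\<dots> = a * x * (b * a) * x ^ k * b"
      by (simp only: mult.assoc)
    finally show ?case using assms by (simp add: mult.assoc)
  qed (simp add: assms)
  have "bounded_linear (\<lambda>y. a * y * b)"
    by (intro bounded_linear_compose[OF bounded_linear_mult_left bounded_linear_mult_right])
  then have "a * (\<Sum>k. x ^ k /\<^sub>R fact k) * b = (\<Sum>k. a * (x ^ k /\<^sub>R fact k) * b)"
    by (intro bounded_linear.suminf summable_exp_generic)
  then show ?thesis
    by (simp add: exp_def pow)
qed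

lemma mexp_conjugate:
  fixes A B X :: "real^'n^'n"
  assumes "A ** B = mat 1" "B ** A = mat 1"
  shows "mexp (A ** X ** B) = A ** mexp X ** B"
  using exp_conjugate[of "Sqmat A" "Sqmat B" "Sqmat X"] assms
  by (simp add: mexp_eq_exp sqmat_eq_iff Sqmat_simps mat_of_simps)

section \<open>The Lie-Trotter product formula\<close>

lemma exp_of_nat_scaleR:
  fixes x :: "'a::{real_normed_algebra_1, banach}"
  shows "exp (real k *\<^sub>R x) = exp x ^ k"
  by (induction k) (simp_all add: scaleR_add_left exp_add_commuting)

lemma norm_power_diff_le:
  fixes a b :: "'a::real_normed_algebra_1"
  assumes "norm a \<le> M" "norm b \<le> M"
  shows "norm (a ^ Suc k - b ^ Suc k) \<le> real (Suc k) * M ^ k * norm (a - b)"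
proof (induction k)
  case (Suc k)
  have M: "M \<ge> 0" using assms(1) norm_ge_zero order_trans by blast
  have "a ^ Suc (Suc k) - b ^ Suc (Suc k) = a * (a ^ Suc k - b ^ Suc k) + (a - b) * b ^ Suc k"
    by (simp add: algebra_simps)
  also have "norm \<dots> \<le> norm a * norm (a ^ Suc k - b ^ Suc k) + norm (a - b) * norm (b ^ Suc k)"
    by (intro norm_triangle_le add_mono norm_mult_ineq)
  also have "\<dots> \<le> M * (real (Suc k) * M ^ k * norm (a - b)) + norm (a - b) * M ^ Suc k"
  proof (intro add_mono mult_mono)
    show "norm (b ^ Suc k) \<le> M ^ Suc k"
      by (rule order_trans[OF norm_power_ineq]) (intro power_mono assms(2) norm_ge_zero)
  qed (use assms Suc M in auto)
  also have "\<dots> = real (Suc (Suc k)) * M ^ Suc k * norm (a - b)"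
    by (simp add: algebra_simps)
  finally show ?case .
qed simp

text \<open>The two curves \<open>exp (sx) exp (sy)\<close> and \<open>exp (s(x + y))\<close> agree to first order at \<open>s = 0\<close>, so
  their values at \<open>s = 1/n\<close> differ by \<open>o(1/n)\<close>, and their \<open>n\<close>-th powers by \<open>o(1)\<close>.\<close>

lemma lie_trotter:
  fixes x y :: "'a::{real_normed_algebra_1, banach}"
  shows "(\<lambda>n. (exp (x /\<^sub>R real (Suc n)) * exp (y /\<^sub>R real (Suc n))) ^ Suc n) \<longlonglongrightarrow> exp (x + y)"
proof -
  define a where "a s = exp (s *\<^sub>R x) * exp (s *\<^sub>R y)" for s :: real
  define b where "b s = exp (s *\<^sub>R (x + y))" for s :: real
  define s where "s n = inverse (real (Suc n))" for n
  have s0: "s \<longlonglongrightarrow> 0" unfolding s_def by (rule LIMSEQ_inverse_real_of_nat)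
  have s_pos: "s n > 0" for n by (simp add: s_def)
  have "((\<lambda>s. a s - b s) has_vector_derivative 0) (at 0)"
  proof -
    have "(a has_vector_derivative (exp (0 *\<^sub>R x) * (exp (0 *\<^sub>R y) * y) + exp (0 *\<^sub>R x) * x * exp (0 *\<^sub>R y))) (at 0)"
      unfolding a_def by (intro has_vector_derivative_mult exp_scaleR_has_vector_derivative_right)
    moreover have "(b has_vector_derivative (exp (0 *\<^sub>R (x + y)) * (x + y))) (at 0)"
      unfolding b_def by (rule exp_scaleR_has_vector_derivative_right)
    ultimately have "((\<lambda>s. a s - b s) has_vector_derivative (y + x) - (x + y)) (at 0)"
      by (intro has_vector_derivative_diff) simp_all
    then show ?thesis by simp
  qed
  then have "((\<lambda>s. norm (a s - b s) / norm s) \<longlongrightarrow> 0) (at 0)"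
    by (simp add: has_vector_derivative_def has_derivative_at a_def b_def)
  moreover have "filterlim s (at 0) sequentially"
    using s0 s_pos by (intro filterlim_atI) (auto simp: less_imp_neq[symmetric])
  ultimately have "(\<lambda>n. norm (a (s n) - b (s n)) / norm (s n)) \<longlonglongrightarrow> 0"
    by (rule filterlim_compose)
  then have lim0: "(\<lambda>n. norm (a (s n) - b (s n)) / s n * exp (norm x + norm y)) \<longlonglongrightarrow> 0"
    using s_pos by (intro tendsto_mult_left_zero) (simp add: abs_of_pos)
  have bn: "b (s n) ^ Suc n = exp (x + y)" for n
    unfolding b_def exp_of_nat_scaleR[symmetric] by (simp add: s_def)
  have "(\<lambda>n. a (s n) ^ Suc n - b (s n) ^ Suc n) \<longlonglongrightarrow> 0"
  proof (rule Lim_null_comparison[OF _ lim0], rule always_eventually, rule allI)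
    fix n
    \<comment> \<open>This M bounds both \<open>a (s n)\<close> and \<open>b (s n)\<close>. As s n =
      1 / (n + 1), its power \<open>M ^ Suc n\<close> is \<open>exp (norm x + norm y)\<close> for
      every n; M \<ge> 1 allows the power n in the estimate to be raised to n + 1.\<close>
    define M where "M = exp (s n * (norm x + norm y))"
    have "norm (a (s n)) \<le> exp (norm (s n *\<^sub>R x)) * exp (norm (s n *\<^sub>R y))"
      unfolding a_def by (intro order_trans[OF norm_mult_ineq] mult_mono norm_exp) auto
    then have a: "norm (a (s n)) \<le> M"
      using s_pos[of n] by (simp add: M_def exp_add[symmetric] distrib_left)
    have "norm (b (s n)) \<le> exp (norm (s n *\<^sub>R (x + y)))"
      unfolding b_def by (rule norm_exp)
    also have "\<dots> \<le> M"
      using s_pos[of n] by (simp add: M_def norm_triangle_ineq)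
    finally have "norm (a (s n) ^ Suc n - b (s n) ^ Suc n) \<le> real (Suc n) * M ^ n * norm (a (s n) - b (s n))"
      using a by (intro norm_power_diff_le)
    also have "\<dots> \<le> real (Suc n) * M ^ Suc n * norm (a (s n) - b (s n))"
    proof -
      have "1 \<le> M" using s_pos[of n] by (simp add: M_def)
      then have "M ^ n \<le> M ^ Suc n" by (intro power_increasing) auto
      then show ?thesis by (intro mult_right_mono mult_left_mono) auto
    qed
    also have "M ^ Suc n = exp (norm x + norm y)"
      unfolding M_def by (subst exp_of_nat_mult[symmetric]) (simp add: s_def)
    also have "real (Suc n) * exp (norm x + norm y) * norm (a (s n) - b (s n)) =
        norm (a (s n) - b (s n)) / s n * exp (norm x + norm y)"
      by (simp add: s_def divide_inverse mult_ac del: of_nat_Suc)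
    finally show "norm (a (s n) ^ Suc n - b (s n) ^ Suc n) \<le>
        norm (a (s n) - b (s n)) / s n * exp (norm x + norm y)" .
  qed
  then have "(\<lambda>n. a (s n) ^ Suc n) \<longlonglongrightarrow> exp (x + y)"
    by (simp only: bn LIM_zero_iff)
  then show ?thesis by (simp add: a_def s_def)
qed

lemma mexp_has_vector_derivative:
  "((\<lambda>t. mexp (t *\<^sub>R X)) has_vector_derivative mexp (t *\<^sub>R X) ** X) (at t)"
  using bounded_linear.has_vector_derivative[OF bounded_linear_mat_of
      exp_scaleR_has_vector_derivative_right[of "Sqmat X" t UNIV]]
  by (simp add: mexp_eq_exp Sqmat_simps mat_of_simps)

section \<open>The Lie algebra of a closed matrix group\<close>

lemma Ad_mexp: "Ad (mexp X) Y = mexp X ** Y ** mexp (- X)"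
  by (simp add: Ad_def matrix_inv_mexp)

lemma Ad_mat_1: "Ad (mat 1) Y = Y"
  using Ad_mexp[of 0 Y] by simp

lemma linear_Ad: "linear (Ad A)"
  by unfold_locales
    (simp_all add: Ad_def matrix_add_ldistrib matrix_add_rdistrib matrix_scalar_ac scalar_matrix_assoc[symmetric])

lemma Ad_mexp_minus: "Ad (mexp (- X)) (Ad (mexp X) Y) = Y"
proof -
  have "Ad (mexp (- X)) (Ad (mexp X) Y) = (mexp (- X) ** mexp X) ** Y ** (mexp (- X) ** mexp X)"
    by (simp add: Ad_mexp matrix_mul_assoc)
  then show ?thesis using mexp_mult_minus[of "- X"] by simp
qed

lemma inj_Ad_mexp: "inj (Ad (mexp X))"
  by (metis Ad_mexp_minus injI)

lemma Ad_mexp_has_vector_derivative: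
  "((\<lambda>t. Ad (mexp (t *\<^sub>R X)) Y) has_vector_derivative Ad (mexp (t *\<^sub>R X)) (lie_bracket X Y)) (at t)"
proof -
  let ?x = "Sqmat X" and ?y = "Sqmat Y"
  have "((\<lambda>t. exp (t *\<^sub>R ?x) * ?y * exp (t *\<^sub>R (- ?x))) has_vector_derivative
      exp (t *\<^sub>R ?x) * ?y * (- ?x * exp (t *\<^sub>R (- ?x))) +
      (exp (t *\<^sub>R ?x) * ?x * ?y) * exp (t *\<^sub>R (- ?x))) (at t)"
    by (intro has_vector_derivative_mult exp_scaleR_has_vector_derivative_left has_vector_derivative_mult_left
        exp_scaleR_has_vector_derivative_right)
  also have "exp (t *\<^sub>R ?x) * ?y * (- ?x * exp (t *\<^sub>R (- ?x))) +
      (exp (t *\<^sub>R ?x) * ?x * ?y) * exp (t *\<^sub>R (- ?x)) =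
      exp (t *\<^sub>R ?x) * (?x * ?y - ?y * ?x) * exp (t *\<^sub>R (- ?x))"
    by (simp add: algebra_simps)
  finally have "((\<lambda>t. mat_of (exp (t *\<^sub>R ?x) * ?y * exp (t *\<^sub>R (- ?x)))) has_vector_derivative
      mat_of (exp (t *\<^sub>R ?x) * (?x * ?y - ?y * ?x) * exp (t *\<^sub>R (- ?x)))) (at t)"
    by (rule bounded_linear.has_vector_derivative[OF bounded_linear_mat_of])
  then show ?thesis
    unfolding Ad_mexp by (simp add: mexp_eq_exp lie_bracket_def Sqmat_simps mat_of_simps)
qed

text \<open>Uniqueness for a differential equation: the derivative of the left side is the same
  expression for [X, Y], whose order of nilpotency is one smaller, so by induction both sides have
  equal derivatives. They agree at t = 0.\<close>

lemma Ad_mexp_eq_sum: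
  assumes "(lie_bracket X ^^ Suc m) Y = 0"
  shows "Ad (mexp (t *\<^sub>R X)) Y = (\<Sum>k\<le>m. (t ^ k / fact k) *\<^sub>R (lie_bracket X ^^ k) Y)"
  using assms
proof (induction m arbitrary: Y t)
  case 0
  have "((\<lambda>t. Ad (mexp (t *\<^sub>R X)) Y) has_vector_derivative 0) (at t)" for t
    using Ad_mexp_has_vector_derivative[of X Y t] 0 by (simp add: linear_0[OF linear_Ad])
  then obtain c where c: "\<And>t. Ad (mexp (t *\<^sub>R X)) Y = c"
    using has_vector_derivative_zero_constant[of UNIV "\<lambda>t. Ad (mexp (t *\<^sub>R X)) Y"] by auto
  then have "c = Y" using c[of 0] by (simp add: Ad_mat_1)
  then show ?case using c by simp
next
  case (Suc m)
  let ?N = "lie_bracket X"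
  let ?g = "\<lambda>t. \<Sum>k\<le>Suc m. (t ^ k / fact k) *\<^sub>R (?N ^^ k) Y"
  have shift: "(?N ^^ k) (?N Y) = (?N ^^ Suc k) Y" for k
    by (simp add: funpow_swap1)
  have "((\<lambda>t. Ad (mexp (t *\<^sub>R X)) Y - ?g t) has_vector_derivative 0) (at t)" for t
  proof -
    have "Ad (mexp (t *\<^sub>R X)) (?N Y) = (\<Sum>k\<le>m. (t ^ k / fact k) *\<^sub>R (?N ^^ Suc k) Y)"
      using Suc.IH[of "?N Y" t] Suc.prems by (simp only: shift)
    moreover have "(?g has_vector_derivative (\<Sum>k\<le>m. (t ^ k / fact k) *\<^sub>R (?N ^^ Suc k) Y)) (at t)"
    proof -
      have "((\<lambda>t. t ^ Suc k / fact (Suc k)) has_real_derivative t ^ k / fact k) (at t)" for k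
        by (rule derivative_eq_intros refl | simp)+
      then have "((\<lambda>t. (t ^ Suc k / fact (Suc k)) *\<^sub>R (?N ^^ Suc k) Y) has_vector_derivative
          (t ^ k / fact k) *\<^sub>R (?N ^^ Suc k) Y) (at t)" for k
        using has_vector_derivative_scaleR[OF _ has_vector_derivative_const, of "\<lambda>t. t ^ Suc k / fact (Suc k)"
            "t ^ k / fact k" t UNIV "(?N ^^ Suc k) Y"]
        by (simp del: funpow.simps power_Suc fact_Suc)
      then have "((\<lambda>t. Y + (\<Sum>k\<le>m. (t ^ Suc k / fact (Suc k)) *\<^sub>R (?N ^^ Suc k) Y)) has_vector_derivative
          0 + (\<Sum>k\<le>m. (t ^ k / fact k) *\<^sub>R (?N ^^ Suc k) Y)) (at t)"
        by (intro has_vector_derivative_add has_vector_derivative_const has_vector_derivative_sum)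
      then show ?thesis
        by (simp add: sum.atMost_Suc_shift del: sum.atMost_Suc funpow.simps power_Suc fact_Suc)
    qed
    ultimately show ?thesis
      using has_vector_derivative_diff[OF Ad_mexp_has_vector_derivative[of X Y t]] by fastforce
  qed
  then obtain c where c: "\<And>t. Ad (mexp (t *\<^sub>R X)) Y - ?g t = c"
    using has_vector_derivative_zero_constant[of UNIV "\<lambda>t. Ad (mexp (t *\<^sub>R X)) Y - ?g t"] by auto
  have "?g 0 = Y"
    by (subst sum.atMost_Suc_shift) simp
  then have "c = 0" using c[of 0] by (simp only: scaleR_zero_left mexp_0 Ad_mat_1 diff_self)
  then show ?case using c[of t] by simp
qed

text \<open>Conjugation by exp (sX) turns the one-parameter group of Y into that of Ad (exp (sX)) Y
  and does not leave H.\<close>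

lemma lie_algebra_Ad:
  assumes mult: "\<And>A B. A \<in> H \<Longrightarrow> B \<in> H \<Longrightarrow> A ** B \<in> H"
    and "X \<in> lie_algebra H" "Y \<in> lie_algebra H"
  shows "Ad (mexp (s *\<^sub>R X)) Y \<in> lie_algebra H"
proof -
  let ?A = "mexp (s *\<^sub>R X)" and ?B = "mexp (- (s *\<^sub>R X))"
  have "?A \<in> H" "?B \<in> H"
    using assms(2) by (auto simp: lie_algebra_def simp flip: scaleR_minus_left)
  moreover have "mexp (t *\<^sub>R Ad ?A Y) = ?A ** mexp (t *\<^sub>R Y) ** ?B" for t
    using mexp_conjugate[of ?A ?B "t *\<^sub>R Y"] mexp_mult_minus[of "s *\<^sub>R X"] mexp_mult_minus[of "- (s *\<^sub>R X)"]
    by (simp add: Ad_mexp matrix_scalar_ac scalar_matrix_assoc[symmetric])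
  ultimately show ?thesis
    using assms by (simp add: lie_algebra_def)
qed

text \<open>Sums come from the Lie-Trotter formula, whose approximants are products of elements of
  H. Closedness is demanded only for invertible limits, because algebraic groups are closed inside
  GL; a limit that is an exponential is invertible.\<close>

lemma subspace_lie_algebra:
  assumes one: "mat 1 \<in> H"
    and mult: "\<And>A B. A \<in> H \<Longrightarrow> B \<in> H \<Longrightarrow> A ** B \<in> H"
    and closed: "\<And>A L. (\<And>k. A k \<in> H) \<Longrightarrow> A \<longlonglongrightarrow> L \<Longrightarrow> invertible L \<Longrightarrow> L \<in> H"
  shows "subspace (lie_algebra H)"
proof (rule subspaceI)
  fix X Y assume XY: "X \<in> lie_algebra H" "Y \<in> lie_algebra H"
  have "mexp (t *\<^sub>R (X + Y)) \<in> H" for t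
  proof (rule closed[OF _ _ invertible_mexp])
    let ?s = "\<lambda>k. t / real (Suc k)"
    let ?a = "\<lambda>k. exp (Sqmat (t *\<^sub>R X) /\<^sub>R real (Suc k)) * exp (Sqmat (t *\<^sub>R Y) /\<^sub>R real (Suc k))"
    show "mat_of (?a k ^ Suc k) \<in> H" for k
    proof -
      have "mat_of (?a k) = mexp (?s k *\<^sub>R X) ** mexp (?s k *\<^sub>R Y)"
        by (simp add: mexp_eq_exp Sqmat_simps mat_of_simps divide_inverse mult.commute)
      then have "mat_of (?a k) \<in> H" using XY mult by (simp add: lie_algebra_def)
      then have "mat_of (?a k ^ j) \<in> H" for j
        by (induction j) (auto simp: mat_of_simps one mult)
      then show ?thesis .
    qed
    show "(\<lambda>k. mat_of (?a k ^ Suc k)) \<longlonglongrightarrow> mexp (t *\<^sub>R (X + Y))"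
      using bounded_linear.tendsto[OF bounded_linear_mat_of lie_trotter[of "Sqmat (t *\<^sub>R X)" "Sqmat (t *\<^sub>R Y)"]]
      by (simp add: mexp_eq_exp Sqmat_simps scaleR_add_right)
  qed
  then show "X + Y \<in> lie_algebra H" by (simp add: lie_algebra_def)
qed (simp_all add: lie_algebra_def one)

text \<open>The bracket is the velocity at 0 of the curve Ad (exp (tX)) Y. The curve stays in the
  Lie algebra, and a subspace of a finite-dimensional space contains the limits of its difference
  quotients.\<close>

lemma lie_algebra_bracket:
  assumes "subspace (lie_algebra H)"
    and mult: "\<And>A B. A \<in> H \<Longrightarrow> B \<in> H \<Longrightarrow> A ** B \<in> H"
    and "X \<in> lie_algebra H" "Y \<in> lie_algebra H"
  shows "lie_bracket X Y \<in> lie_algebra H"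
proof -
  let ?c = "\<lambda>t. Ad (mexp (t *\<^sub>R X)) Y"
  have c: "?c t \<in> lie_algebra H" for t
    using assms by (intro lie_algebra_Ad)
  have "(?c has_vector_derivative lie_bracket X Y) (at 0)"
    using Ad_mexp_has_vector_derivative[of X Y 0] by (simp add: Ad_mat_1)
  then have lim: "((\<lambda>t. norm (?c t - ?c 0 - t *\<^sub>R lie_bracket X Y) / norm t) \<longlongrightarrow> 0) (at 0)"
    by (simp add: has_vector_derivative_def has_derivative_at)
  have "((\<lambda>t. (?c t - ?c 0) /\<^sub>R t - lie_bracket X Y) \<longlongrightarrow> 0) (at 0)"
  proof (rule Lim_null_comparison[OF _ lim])
    have "(?c t - ?c 0) /\<^sub>R t - lie_bracket X Y = (?c t - ?c 0 - t *\<^sub>R lie_bracket X Y) /\<^sub>R t"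
      if "t \<noteq> 0" for t
      using that by (simp add: scaleR_diff_right)
    then have "norm ((?c t - ?c 0) /\<^sub>R t - lie_bracket X Y) \<le>
        norm (?c t - ?c 0 - t *\<^sub>R lie_bracket X Y) / norm t" if "t \<noteq> 0" for t
      using that by (simp add: divide_inverse mult.commute)
    then show "\<forall>\<^sub>F t in at 0. norm ((?c t - ?c 0) /\<^sub>R t - lie_bracket X Y) \<le>
        norm (?c t - ?c 0 - t *\<^sub>R lie_bracket X Y) / norm t"
      by (simp add: eventually_at_filter)
  qed
  then have "((\<lambda>t. (?c t - ?c 0) /\<^sub>R t) \<longlongrightarrow> lie_bracket X Y) (at 0)"
    by (rule LIM_zero_cancel)
  moreover have "(?c t - ?c 0) /\<^sub>R t \<in> lie_algebra H" for t
    using c assms(1) by (intro subspace_scale subspace_diff)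
  ultimately show ?thesis
    using closed_subspace[OF assms(1)] by (intro Lim_in_closed_set[of "lie_algebra H" _ "at (0::real)"]) auto
qed

section \<open>Real points of a linear algebraic group\<close>

lemma continuous_on_polyfun: "polyfun_over K f \<Longrightarrow> continuous_on UNIV f"
  by (induction rule: polyfun_over.induct) (auto intro!: continuous_intros)

lemma map_matrix_of_real:
  "map_matrix complex_of_real (A ** B) = map_matrix complex_of_real A ** map_matrix complex_of_real B"
  "map_matrix complex_of_real (mat 1) = mat 1"
  by (simp_all add: map_matrix_def matrix_matrix_mult_def mat_def vec_eq_iff)

lemma real_points_group:
  assumes "linear_algebraic_group_over_Q G"
  shows "mat 1 \<in> real_points G"
    and "\<And>A B. A \<in> real_points G \<Longrightarrow> B \<in> real_points G \<Longrightarrow> A ** B \<in> real_points G"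
    and "\<And>A L. (\<And>k. A k \<in> real_points G) \<Longrightarrow> A \<longlonglongrightarrow> L \<Longrightarrow> invertible L \<Longrightarrow> L \<in> real_points G"
proof -
  have grp: "subgroup G GL" and "closed_over \<rat> G"
    using assms by (auto simp: linear_algebraic_group_over_Q_def)
  then obtain P where P: "\<And>f. f \<in> P \<Longrightarrow> polyfun_over \<rat> f" "G = {A. invertible A \<and> (\<forall>f\<in>P. f A = 0)}"
    by (auto simp: closed_over_def)
  show "mat 1 \<in> real_points G"
    using subgroup.one_closed[OF grp] by (simp add: real_points_def map_matrix_of_real GL_def)
  show "A ** B \<in> real_points G" if "A \<in> real_points G" "B \<in> real_points G" for A B
    using subgroup.m_closed[OF grp, of "map_matrix complex_of_real A" "map_matrix complex_of_real B"] that
    by (simp add: real_points_def map_matrix_of_real GL_def)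
  show "L \<in> real_points G" if A: "\<And>k. A k \<in> real_points G" "A \<longlonglongrightarrow> L" and "invertible L" for A L
  proof -
    have "(\<lambda>k. map_matrix complex_of_real (A k)) \<longlonglongrightarrow> map_matrix complex_of_real L"
      by (intro vec_tendstoI) (simp add: map_matrix_def tendsto_of_real tendsto_vec_nth A(2))
    moreover have "isCont f (map_matrix complex_of_real L)" if "f \<in> P" for f
      using continuous_on_polyfun[OF P(1)[OF that]] by (simp add: continuous_on_eq_continuous_at)
    ultimately have lim: "(\<lambda>k. f (map_matrix complex_of_real (A k))) \<longlonglongrightarrow> f (map_matrix complex_of_real L)" if "f \<in> P" for f
      using isCont_tendsto_compose that by blast
    have "(\<lambda>k. f (map_matrix complex_of_real (A k))) \<longlonglongrightarrow> 0" if "f \<in> P" for f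
    proof -
      have "f (map_matrix complex_of_real (A k)) = 0" for k
        using A(1)[of k] that by (auto simp: real_points_def P(2))
      then show ?thesis by simp
    qed
    then have "f (map_matrix complex_of_real L) = 0" if "f \<in> P" for f
      using LIMSEQ_unique[OF lim[OF that]] that by blast
    moreover have "invertible (map_matrix complex_of_real L)"
    proof -
      obtain B where "L ** B = mat 1" "B ** L = mat 1"
        using \<open>invertible L\<close> by (auto simp: invertible_def)
      then show ?thesis
        unfolding invertible_def by (metis map_matrix_of_real)
    qed
    ultimately show ?thesis by (simp add: real_points_def P(2))
  qed
qed

text \<open>A one-parameter group is a connected curve through the identity, so it never leaves the
  identity component. Thus the Lie algebra can be studied on all real points, where the polynomial
  equations are available.\<close>

lemma lie_algebra_component:
  "lie_algebra (real_points_component G) = lie_algebra (real_points G)"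
proof
  show "lie_algebra (real_points_component G) \<subseteq> lie_algebra (real_points G)"
    using connected_component_subset by (fastforce simp: lie_algebra_def real_points_component_def)
  show "lie_algebra (real_points G) \<subseteq> lie_algebra (real_points_component G)"
  proof
    fix X assume X: "X \<in> lie_algebra (real_points G)"
    let ?T = "range (\<lambda>t. mexp (t *\<^sub>R X))"
    have "continuous_on UNIV (\<lambda>t. mexp (t *\<^sub>R X))"
      using mexp_has_vector_derivative[of X]
      by (auto simp: continuous_on_eq_continuous_at intro: has_vector_derivative_continuous)
    then have "connected ?T" by (intro connected_continuous_image) auto
    moreover have "mat 1 \<in> ?T" using rangeI[of "\<lambda>t. mexp (t *\<^sub>R X)" 0] by simp
    moreover have "?T \<subseteq> real_points G" using X by (auto simp: lie_algebra_def)
    ultimately have "?T \<subseteq> real_points_component G"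
      unfolding real_points_component_def by (intro connected_component_maximal)
    then show "X \<in> lie_algebra (real_points_component G)" by (auto simp: lie_algebra_def)
  qed
qed

section \<open>Convergence in Grassmannians\<close>

text \<open>With coordinate functionals \<open>\<phi>\<close> dual to the \<open>v i\<close>, the map
  \<open>x \<mapsto> x + (\<Sum>i\<in>I. \<phi> i x (w i - v i))\<close> takes \<open>v i\<close> to \<open>w i\<close> and is injective for \<open>w\<close> close to \<open>v\<close>.\<close>

lemma eventually_independent:
  fixes v :: "'i \<Rightarrow> 'a::euclidean_space" and w :: "'t \<Rightarrow> 'i \<Rightarrow> 'a"
  assumes I: "finite I" and v: "inj_on v I" "independent (v ` I)"
    and lim: "\<And>i. i \<in> I \<Longrightarrow> ((\<lambda>t. w t i) \<longlongrightarrow> v i) F"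
  shows "\<forall>\<^sub>F t in F. inj_on (w t) I \<and> independent (w t ` I)"
proof -
  have "\<exists>\<phi>. linear \<phi> \<and> (\<forall>x\<in>v ` I. \<phi> x = (if x = v i then 1 else 0 :: real))" for i
    using linear_independent_extend[OF v(2), of "\<lambda>x. if x = v i then 1 else 0"] by blast
  then obtain \<phi> where \<phi>: "\<And>i. linear (\<phi> i)"
    "\<And>i x. x \<in> v ` I \<Longrightarrow> \<phi> i x = (if x = v i then 1 else 0 :: real)"
    by metis
  have "\<exists>K>0. \<forall>x. norm (\<phi> i x) \<le> norm x * K" for i
    using bounded_linear.pos_bounded \<phi>(1) linear_conv_bounded_linear by blast
  then obtain K where K: "\<And>i. K i > 0" "\<And>i x. \<bar>\<phi> i x\<bar> \<le> norm x * K i"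
    by (metis real_norm_def)
  define e where "e t = (\<Sum>i\<in>I. K i * norm (w t i - v i))" for t
  have "(e \<longlongrightarrow> (\<Sum>i\<in>I. K i * norm (v i - v i))) F"
    unfolding e_def by (intro tendsto_intros lim)
  then have "(e \<longlongrightarrow> 0) F" by simp
  then have "\<forall>\<^sub>F t in F. e t < 1" by (rule order_tendstoD) simp
  then show ?thesis
  proof (rule eventually_mono)
    fix t assume small: "e t < 1"
    define A where "A x = x + (\<Sum>i\<in>I. \<phi> i x *\<^sub>R (w t i - v i))" for x
    have lin: "linear A"
      unfolding A_def
      by (intro linear_compose_add linear_compose_sum ballI linear_compose_scale_right linear_ident)
        (use \<phi>(1) in \<open>auto simp: linear_iff scaleR_add_left\<close>)
    have "inj A"
    proof (rule linear_injective_0[OF lin, THEN iffD2], intro allI impI)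
      fix x assume "A x = 0"
      then have "norm x = norm (- (\<Sum>i\<in>I. \<phi> i x *\<^sub>R (w t i - v i)))"
        unfolding A_def by (intro arg_cong[of _ _ norm]) (simp only: eq_neg_iff_add_eq_0)
      also have "\<dots> = norm (\<Sum>i\<in>I. \<phi> i x *\<^sub>R (w t i - v i))"
        by (rule norm_minus_cancel)
      also have "\<dots> \<le> (\<Sum>i\<in>I. (norm x * K i) * norm (w t i - v i))"
        by (intro order_trans[OF norm_sum] sum_mono) (use K in \<open>auto intro: mult_right_mono\<close>)
      also have "\<dots> = norm x * e t"
        by (simp add: e_def sum_distrib_left mult.assoc)
      finally have "norm x \<le> norm x * e t" .
      moreover have "norm x * e t < norm x * 1" if "x \<noteq> 0"
        using that small by (intro mult_strict_left_mono) auto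
      ultimately show "x = 0" by fastforce
    qed
    have Av: "A (v i) = w t i" if i: "i \<in> I" for i
    proof -
      have "\<phi> j (v i) = (if j = i then 1 else 0)" if "j \<in> I" for j
        using \<phi>(2)[of "v i" j] i that v(1) by (auto dest: inj_onD)
      then have "(\<Sum>j\<in>I. \<phi> j (v i) *\<^sub>R (w t j - v j)) = (\<Sum>j\<in>I. if j = i then w t j - v j else 0)"
        by (intro sum.cong) auto
      also have "\<dots> = w t i - v i" using I i by (simp add: sum.delta)
      finally show ?thesis by (simp add: A_def)
    qed
    have img: "w t ` I = A ` v ` I" using Av by (auto simp: image_image)
    have "inj_on (A \<circ> v) I"
      using v(1) \<open>inj A\<close> by (intro comp_inj_on) (auto intro: inj_on_subset)
    then have "inj_on (w t) I" using Av by (simp cong: inj_on_cong)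
    moreover have "independent (w t ` I)"
      unfolding img using \<open>inj A\<close>
      by (intro linear_independent_injective_image lin v(2)) (auto intro: inj_on_subset)
    ultimately show "inj_on (w t) I \<and> independent (w t ` I)" ..
  qed
qed

text \<open>A basis of the limit chosen inside S has approximants in \<open>V t\<close> that are
  eventually independent. There are k of them in a k-dimensional space, so they span it; convergence
  of these frames passes to the quotient topology.\<close>

lemma limitin_grassmannian:
  fixes V :: "'t \<Rightarrow> 'a::euclidean_space set"
  assumes W: "subspace W"
    and V: "\<And>t. subspace (V t)" "\<And>t. V t \<subseteq> W" "\<And>t. dim (V t) = k"
    and L: "S \<subseteq> W" "dim (span S) = k"
    and approx: "\<And>v. v \<in> S \<Longrightarrow> \<exists>w. (\<forall>\<^sub>F t in F. w t \<in> V t) \<and> (w \<longlongrightarrow> v) F"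
  shows "limitin (grassmannian W k) V (span S) F"
proof -
  obtain B where B: "B \<subseteq> S" "independent B" "S \<subseteq> span B" "card B = dim S"
    using basis_exists[of S] by metis
  have fin: "finite B" using B(2) independent_bound by blast
  have cB: "card B = k" using B(4) L(2) by simp
  have spanB: "span B = span S"
    using B by (metis span_mono span_span subset_antisym)
  obtain v where v: "bij_betw v {..<k} B"
    using ex_bij_betw_nat_finite[OF fin] cB by (auto simp: atLeast0LessThan)
  then have v_inj: "inj_on v {..<k}" and v_im: "v ` {..<k} = B" by (auto simp: bij_betw_def)
  \<comment> \<open>Points of the product topology are extensional, so the limit frame and the
    approximating frames are cut down to the indices below k.\<close>
  define v' where "v' = restrict v {..<k}"
  have "\<exists>w. (\<forall>\<^sub>F t in F. w t \<in> V t) \<and> (w \<longlongrightarrow> v i) F" if "i < k" for i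
    using that v_im B(1) by (intro approx) auto
  then obtain w where w: "\<And>i. i < k \<Longrightarrow> \<forall>\<^sub>F t in F. w i t \<in> V t" "\<And>i. i < k \<Longrightarrow> (w i \<longlongrightarrow> v i) F"
    by metis
  define u where "u t = (\<lambda>i\<in>{..<k}. w i t)" for t
  have u: "u t ` {..<k} = (\<lambda>i. w i t) ` {..<k}" "inj_on (u t) {..<k} \<longleftrightarrow> inj_on (\<lambda>i. w i t) {..<k}" for t
    by (auto simp: u_def inj_on_def)
  have v': "v' ` {..<k} = B" "inj_on v' {..<k}"
    using v_im v_inj by (auto simp: v'_def inj_on_def)
  have ev: "\<forall>\<^sub>F t in F. \<forall>i\<in>{..<k}. w i t \<in> V t"
    using w(1) by (intro eventually_ball_finite) auto
  have indep: "\<forall>\<^sub>F t in F. inj_on (\<lambda>i. w i t) {..<k} \<and> independent ((\<lambda>i. w i t) ` {..<k})"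
    using eventually_independent[of "{..<k}" v "\<lambda>t i. w i t" F] v_inj v_im B(2) w(2) by simp
  have span_u: "\<forall>\<^sub>F t in F. u t \<in> topspace (frames W k) \<and> span (u t ` {..<k}) = V t"
    using ev indep
  proof eventually_elim
    case (elim t)
    have sub: "u t ` {..<k} \<subseteq> V t" using elim by (auto simp: u)
    have "dim (u t ` {..<k}) = k"
      using elim by (simp add: u dim_eq_card_independent card_image)
    then have "span (u t ` {..<k}) = V t"
      using sub V by (metis dim_span span_minimal subspace_dim_equal subspace_span order_refl)
    moreover have "u t \<in> topspace (frames W k)"
      using elim V(2)[of t] by (auto simp: frames_def u) (auto simp: u_def split: if_splits)
    ultimately show ?case by blast
  qed
  have lim_u: "limitin (frames W k) u v' F"
    unfolding frames_def
  proof (subst limitin_subtopology, unfold limitin_componentwise, intro conjI ballI)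
    show "v' \<in> {v. inj_on v {..<k} \<and> independent (v ` {..<k})}"
      using v' B(2) by simp
    show "\<forall>\<^sub>F t in F. u t \<in> {v. inj_on v {..<k} \<and> independent (v ` {..<k})}"
      using indep by (simp add: u)
    show "v' \<in> extensional {..<k}" by (simp add: v'_def)
    show "\<forall>\<^sub>F t in F. u t \<in> topspace (product_topology (\<lambda>_. top_of_set W) {..<k})"
      using span_u by (auto simp: frames_def elim: eventually_mono)
  next
    fix i assume "i \<in> {..<k}"
    then have i: "i < k" by simp
    have "v i \<in> W" using i v_im B(1) L(1) by blast
    moreover have "\<forall>\<^sub>F t in F. w i t \<in> W"
      using w(1)[OF i] by (rule eventually_mono) (use V(2) in blast)
    ultimately show "limitin (top_of_set W) (\<lambda>t. u t i) (v' i) F"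
      using w(2)[OF i] i by (simp add: limitin_subtopology u_def v'_def)
  qed
  show ?thesis
    unfolding limitin_def
  proof (intro conjI allI impI)
    show "span S \<in> topspace (grassmannian W k)"
      using L W by (simp add: topspace_grassmannian span_minimal)
    fix U assume U: "openin (grassmannian W k) U \<and> span S \<in> U"
    let ?P = "{v \<in> topspace (frames W k). span (v ` {..<k}) \<in> U}"
    have "v' \<in> topspace (frames W k)" using lim_u by (simp add: limitin_def)
    then have "v' \<in> ?P" using U v' spanB by simp
    moreover have "openin (frames W k) ?P" using U by (simp add: openin_grassmannian)
    ultimately have "\<forall>\<^sub>F t in F. u t \<in> ?P"
      using lim_u unfolding limitin_def by blast
    then show "\<forall>\<^sub>F t in F. V t \<in> U"
      using span_u by eventually_elim auto
  qed
qed

section \<open>The trace and the Killing form\<close>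

lemma linear_lie_bracket: "linear (lie_bracket X)"
proof (rule linearI)
  show "lie_bracket X (Y + Z) = lie_bracket X Y + lie_bracket X Z" for Y Z
    by (simp add: lie_bracket_def matrix_add_ldistrib matrix_add_rdistrib)
  show "lie_bracket X (c *\<^sub>R Y) = c *\<^sub>R lie_bracket X Y" for c Y
    by (simp add: lie_bracket_def matrix_scalar_ac scalar_matrix_assoc[symmetric] scaleR_diff_right)
qed

lemma lie_bracket_skew: "lie_bracket X Y = - lie_bracket Y X"
  by (simp add: lie_bracket_def)

lemma linear_lie_bracket_left: "linear (\<lambda>X. lie_bracket X Y)"
  by (subst lie_bracket_skew) (intro linear_compose_neg linear_lie_bracket)

lemmas lie_bracket_simps =
  linear_add[OF linear_lie_bracket] linear_diff[OF linear_lie_bracket] linear_neg[OF linear_lie_bracket]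
  linear_scale[OF linear_lie_bracket] linear_0[OF linear_lie_bracket]
  linear_add[OF linear_lie_bracket_left] linear_diff[OF linear_lie_bracket_left]
  linear_neg[OF linear_lie_bracket_left] linear_scale[OF linear_lie_bracket_left]
  linear_0[OF linear_lie_bracket_left]

lemma matrix_diff_distribs:
  fixes A B C :: "real^'n^'n"
  shows "A ** (B - C) = A ** B - A ** C" "(A - B) ** C = A ** C - B ** C"
  by (simp_all add: matrix_matrix_mult_def vec_eq_iff sum_subtractf right_diff_distrib left_diff_distrib)

lemma jacobi: "lie_bracket X (lie_bracket Y Z) = lie_bracket (lie_bracket X Y) Z + lie_bracket Y (lie_bracket X Z)"
  by (simp add: lie_bracket_def matrix_diff_distribs matrix_mul_assoc)

text \<open>The chosen basis depends on V alone, so the traces of all maps can be computed and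
  compared in one and the same basis.\<close>

lemma trace_on_basis:
  assumes "subspace (V :: 'a::euclidean_space set)"
  shows "\<exists>B. finite B \<and> independent B \<and> span B = V \<and>
    (\<forall>f. trace_on V f = (\<Sum>b\<in>B. representation B (f b) b))"
proof -
  define B where "B = (SOME B. independent B \<and> span B = V)"
  have "\<exists>B. independent B \<and> span B = V"
    using basis_exists[of V] assms by (metis span_minimal subset_antisym)
  then have "independent B \<and> span B = V"
    unfolding B_def by (rule someI_ex)
  moreover have "finite B" using \<open>independent B \<and> span B = V\<close> independent_bound by blast
  moreover have "trace_on V f = (\<Sum>b\<in>B. representation B (f b) b)" for f
    by (simp add: trace_on_def B_def Let_def)
  ultimately show ?thesis by auto
qed

lemma trace_on_cong:
  assumes "subspace V" "\<And>x. x \<in> V \<Longrightarrow> f x = g x"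
  shows "trace_on V f = trace_on V g"
  using trace_on_basis[OF assms(1)] assms(2) by (metis (no_types, lifting) span_base sum.cong)

lemma trace_on_add:
  assumes "subspace V" "\<And>x. x \<in> V \<Longrightarrow> f x \<in> V" "\<And>x. x \<in> V \<Longrightarrow> g x \<in> V"
  shows "trace_on V (\<lambda>x. f x + g x) = trace_on V f + trace_on V g"
proof -
  obtain B where B: "finite B" "independent B" "span B = V"
    "\<And>f. trace_on V f = (\<Sum>b\<in>B. representation B (f b) b)"
    using trace_on_basis[OF assms(1)] by blast
  have "B \<subseteq> V" using B(3) span_superset by blast
  then show ?thesis
    using assms B(2,3) by (auto simp: B(4) representation_add sum.distrib[symmetric] intro!: sum.cong)
qed

lemma trace_on_scale:
  assumes "subspace V" "\<And>x. x \<in> V \<Longrightarrow> f x \<in> V"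
  shows "trace_on V (\<lambda>x. c *\<^sub>R f x) = c * trace_on V f"
proof -
  obtain B where B: "finite B" "independent B" "span B = V"
    "\<And>f. trace_on V f = (\<Sum>b\<in>B. representation B (f b) b)"
    using trace_on_basis[OF assms(1)] by blast
  have "B \<subseteq> V" using B(3) span_superset by blast
  then show ?thesis
    using assms B(2,3) by (auto simp: B(4) representation_scale sum_distrib_left intro!: sum.cong)
qed

lemma trace_on_commute:
  assumes V: "subspace V" and f: "linear f" "f ` V \<subseteq> V" and g: "linear g" "g ` V \<subseteq> V"
  shows "trace_on V (\<lambda>x. f (g x)) = trace_on V (\<lambda>x. g (f x))"
proof -
  obtain B where B: "finite B" "independent B" "span B = V"
    "\<And>f. trace_on V f = (\<Sum>b\<in>B. representation B (f b) b)"
    using trace_on_basis[OF V] by blast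
  have BV: "B \<subseteq> V" using B(3) span_superset by blast
  have expand: "representation B (f (g b)) b = (\<Sum>c\<in>B. representation B (g b) c * representation B (f c) b)"
    if "linear f" "f ` V \<subseteq> V" "g ` V \<subseteq> V" "b \<in> B" for f g b
  proof -
    have gb: "g b \<in> span B" using that(3,4) BV unfolding B(3) by blast
    have eq: "f (g b) = (\<Sum>c\<in>B. representation B (g b) c *\<^sub>R f c)"
    proof -
      have "f (\<Sum>c\<in>B. representation B (g b) c *\<^sub>R c) = (\<Sum>c\<in>B. representation B (g b) c *\<^sub>R f c)"
        using that(1) by (simp add: linear_sum linear_scale)
      then show ?thesis
        unfolding sum_representation_eq[OF B(2) gb B(1) subset_refl] .
    qed
    have fc: "f c \<in> span B" if "c \<in> B" for c
      using that \<open>f ` V \<subseteq> V\<close> BV unfolding B(3) by blast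
    have "representation B (f (g b)) b =
        (\<Sum>c\<in>B. representation B (representation B (g b) c *\<^sub>R f c) b)"
      unfolding eq by (subst representation_sum[OF B(2)]) (auto intro: span_scale fc)
    also have "\<dots> = (\<Sum>c\<in>B. representation B (g b) c * representation B (f c) b)"
      by (intro sum.cong refl) (simp add: representation_scale[OF B(2) fc])
    finally show ?thesis .
  qed
  have "(\<Sum>b\<in>B. representation B (f (g b)) b) =
      (\<Sum>b\<in>B. \<Sum>c\<in>B. representation B (g b) c * representation B (f c) b)"
    by (intro sum.cong refl expand f g)
  also have "\<dots> = (\<Sum>c\<in>B. \<Sum>b\<in>B. representation B (f c) b * representation B (g b) c)"
    by (subst sum.swap) (simp add: mult.commute)
  also have "\<dots> = (\<Sum>c\<in>B. representation B (g (f c)) c)"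
    by (intro sum.cong refl expand[symmetric] f g)
  finally show ?thesis unfolding B(4) .
qed

section \<open>The Killing form and Cartan involutions\<close>

locale lie_subalgebra =
  fixes \<gg> :: "(real^'n^'n) set"
  assumes subspace_g: "subspace \<gg>"
    and bracket_closed: "x \<in> \<gg> \<Longrightarrow> y \<in> \<gg> \<Longrightarrow> lie_bracket x y \<in> \<gg>"
begin

lemma killing_sym: "x \<in> \<gg> \<Longrightarrow> y \<in> \<gg> \<Longrightarrow> killing_form \<gg> x y = killing_form \<gg> y x"
  unfolding killing_form_def
  by (intro trace_on_commute subspace_g linear_lie_bracket) (auto simp: bracket_closed)

lemma killing_add_left:
  assumes "x \<in> \<gg>" "y \<in> \<gg>" "z \<in> \<gg>"
  shows "killing_form \<gg> (x + y) z = killing_form \<gg> x z + killing_form \<gg> y z"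
  using assms trace_on_add[OF subspace_g, of "\<lambda>w. lie_bracket x (lie_bracket z w)" "\<lambda>w. lie_bracket y (lie_bracket z w)"]
  by (simp add: killing_form_def lie_bracket_simps bracket_closed)

lemma killing_scale_left:
  assumes "x \<in> \<gg>" "z \<in> \<gg>"
  shows "killing_form \<gg> (c *\<^sub>R x) z = c * killing_form \<gg> x z"
  using assms trace_on_scale[OF subspace_g, of "\<lambda>w. lie_bracket x (lie_bracket z w)" c]
  by (simp add: killing_form_def lie_bracket_simps bracket_closed)

text \<open>Writing z, x, y for their ad-operators, the two sides expand to tr(zxy) - tr(xzy) and -
  tr(xzy) + tr(xyz). They agree because the trace is cyclic.\<close>

lemma killing_invariant:
  assumes "x \<in> \<gg>" "y \<in> \<gg>" "z \<in> \<gg>"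
  shows "killing_form \<gg> (lie_bracket z x) y = - killing_form \<gg> x (lie_bracket z y)"
proof -
  let ?tr = "trace_on \<gg>" and ?ad = lie_bracket
  have ad_bracket: "?ad (?ad a b) w = ?ad a (?ad b w) + (- 1) *\<^sub>R ?ad b (?ad a w)" for a b w
    using jacobi[of a b w] by simp
  have tr: "?tr (\<lambda>w. f w + (- 1) *\<^sub>R g w) = ?tr f - ?tr g" if "f ` \<gg> \<subseteq> \<gg>" "g ` \<gg> \<subseteq> \<gg>" for f g
    using that trace_on_add[OF subspace_g, of f "\<lambda>w. (- 1) *\<^sub>R g w"] trace_on_scale[OF subspace_g, of g "- 1"]
      subspace_scale[OF subspace_g]
    by (auto simp: image_subset_iff subspace_neg[OF subspace_g])
  have "killing_form \<gg> (?ad z x) y = ?tr (\<lambda>w. ?ad z (?ad x (?ad y w))) - ?tr (\<lambda>w. ?ad x (?ad z (?ad y w)))"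
    unfolding killing_form_def ad_bracket using assms by (intro tr) (auto simp: bracket_closed)
  moreover have "killing_form \<gg> x (?ad z y) = ?tr (\<lambda>w. ?ad x (?ad z (?ad y w))) - ?tr (\<lambda>w. ?ad x (?ad y (?ad z w)))"
    unfolding killing_form_def ad_bracket lie_bracket_simps(1,4)
    using assms by (intro tr) (auto simp: bracket_closed)
  moreover have "?tr (\<lambda>w. ?ad z (?ad x (?ad y w))) = ?tr (\<lambda>w. ?ad x (?ad y (?ad z w)))"
    using assms
    by (intro trace_on_commute subspace_g linear_lie_bracket
        linear_compose[OF linear_lie_bracket linear_lie_bracket, unfolded o_def])
      (auto simp: bracket_closed)
  ultimately show ?thesis by simp
qed

lemma killing_center:
  assumes "x \<in> \<gg>" "y \<in> \<gg>" "\<And>z. z \<in> \<gg> \<Longrightarrow> lie_bracket x z = 0"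
  shows "killing_form \<gg> x y = 0"
proof -
  have "killing_form \<gg> x y = trace_on \<gg> (\<lambda>z. 0 *\<^sub>R z)"
    unfolding killing_form_def
    by (rule trace_on_cong[OF subspace_g]) (simp add: assms bracket_closed)
  also have "\<dots> = 0" by (subst trace_on_scale[OF subspace_g]) auto
  finally show ?thesis .
qed

end

locale cartan_pair = lie_subalgebra +
  fixes \<theta> :: "real^'n^'n \<Rightarrow> real^'n^'n"
  assumes cartan: "cartan_involution \<gg> \<theta>"
begin

lemma theta_closed: "x \<in> \<gg> \<Longrightarrow> \<theta> x \<in> \<gg>"
  and theta_theta: "x \<in> \<gg> \<Longrightarrow> \<theta> (\<theta> x) = x"
  and theta_add: "x \<in> \<gg> \<Longrightarrow> y \<in> \<gg> \<Longrightarrow> \<theta> (x + y) = \<theta> x + \<theta> y"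
  and theta_scale: "x \<in> \<gg> \<Longrightarrow> \<theta> (c *\<^sub>R x) = c *\<^sub>R \<theta> x"
  and theta_bracket: "x \<in> \<gg> \<Longrightarrow> y \<in> \<gg> \<Longrightarrow> \<theta> (lie_bracket x y) = lie_bracket (\<theta> x) (\<theta> y)"
  and cartan_inner_pos: "x \<in> \<gg> \<Longrightarrow> x \<noteq> 0 \<Longrightarrow> cartan_inner \<gg> \<theta> x x > 0"
  using cartan by (auto simp: cartan_involution_def)

lemma theta_0: "\<theta> 0 = 0"
  using theta_scale[of 0 0] subspace_0[OF subspace_g] by simp

lemma theta_minus: "x \<in> \<gg> \<Longrightarrow> \<theta> (- x) = - \<theta> x"
  using theta_scale[of x "- 1"] by simp

lemma theta_diff: "x \<in> \<gg> \<Longrightarrow> y \<in> \<gg> \<Longrightarrow> \<theta> (x - y) = \<theta> x - \<theta> y"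
  using theta_add[of x "- y"] by (simp add: theta_minus subspace_neg[OF subspace_g])

lemma theta_eq_0_iff: "x \<in> \<gg> \<Longrightarrow> \<theta> x = 0 \<longleftrightarrow> x = 0"
  using theta_theta[of x] theta_0 by auto

lemma killing_theta:
  assumes "x \<in> \<gg>" "y \<in> \<gg>"
  shows "killing_form \<gg> (\<theta> x) (\<theta> y) = killing_form \<gg> x y"
proof -
  let ?ad = lie_bracket
  \<comment> \<open>\<open>trace_on_commute\<close> asks for maps that are linear on the whole
    matrix space, while \<theta> is controlled only on \<gg>; hence a linear extension.\<close>
  obtain \<Theta> where \<Theta>: "linear \<Theta>" "\<And>x. x \<in> \<gg> \<Longrightarrow> \<Theta> x = \<theta> x"
    using linear_extension_on_subspace[OF subspace_g, of \<theta>] theta_add theta_scale by blast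
  have "killing_form \<gg> (\<theta> x) (\<theta> y) = trace_on \<gg> (\<lambda>w. \<Theta> (?ad x (?ad y (\<Theta> w))))"
    unfolding killing_form_def
    using assms by (intro trace_on_cong subspace_g) (simp add: \<Theta> theta_closed bracket_closed theta_bracket theta_theta)
  also have "\<dots> = trace_on \<gg> (\<lambda>w. ?ad x (?ad y (\<Theta> (\<Theta> w))))"
    using assms
    by (intro trace_on_commute subspace_g \<Theta>(1)
        linear_compose[OF \<Theta>(1) linear_compose[OF linear_lie_bracket linear_lie_bracket], unfolded o_def])
      (auto simp: bracket_closed \<Theta> theta_closed)
  also have "\<dots> = killing_form \<gg> x y"
    unfolding killing_form_def
    by (intro trace_on_cong subspace_g) (simp add: \<Theta> theta_closed theta_theta)
  finally show ?thesis .
qed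

sublocale inner_on \<gg> "cartan_inner \<gg> \<theta>"
proof
  fix x y assume "x \<in> \<gg>" "y \<in> \<gg>"
  then have "killing_form \<gg> x (\<theta> y) = killing_form \<gg> y (\<theta> x)"
    using killing_theta[of x "\<theta> y"] killing_sym[of y "\<theta> x"] by (simp add: theta_closed theta_theta)
  then show "cartan_inner \<gg> \<theta> x y = cartan_inner \<gg> \<theta> y x" by (simp add: cartan_inner_def)
next
  show "cartan_inner \<gg> \<theta> x x > 0" if "x \<in> \<gg>" "x \<noteq> 0" for x
    using that by (rule cartan_inner_pos)
  show "subspace \<gg>" by (rule subspace_g)
  show "cartan_inner \<gg> \<theta> (x + y) z = cartan_inner \<gg> \<theta> x z + cartan_inner \<gg> \<theta> y z"
    if "x \<in> \<gg>" "y \<in> \<gg>" "z \<in> \<gg>" for x y z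
    using that by (simp add: cartan_inner_def killing_add_left theta_closed)
  show "cartan_inner \<gg> \<theta> (c *\<^sub>R x) y = c * cartan_inner \<gg> \<theta> x y"
    if "x \<in> \<gg>" "y \<in> \<gg>" for c x y
    using that by (simp add: cartan_inner_def killing_scale_left theta_closed)
qed

text \<open>The adjoint of ad z is - ad (\<theta> z). So ad z is symmetric if \<theta> z = - z and
  skew if \<theta> z = z, and for z = n this links the raising operator with a lowering one.\<close>

lemma ip_bracket:
  assumes "x \<in> \<gg>" "y \<in> \<gg>" "z \<in> \<gg>"
  shows "cartan_inner \<gg> \<theta> (lie_bracket z x) y = - cartan_inner \<gg> \<theta> x (lie_bracket (\<theta> z) y)"
  using assms killing_invariant[of x "\<theta> y" z]
  by (simp add: cartan_inner_def theta_bracket theta_theta theta_closed)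

text \<open>A central x has ad x = 0, hence Killing form 0 with \<theta> x, which contradicts
  positivity unless x = 0.\<close>

lemma centerless:
  assumes "x \<in> \<gg>" "\<And>z. z \<in> \<gg> \<Longrightarrow> lie_bracket x z = 0"
  shows "x = 0"
  using killing_center[OF assms(1) theta_closed[OF assms(1)] assms(2)] cartan_inner_pos[OF assms(1)]
  by (auto simp: cartan_inner_def)

end

section \<open>Gradings by sl2-triples\<close>

lemma rank_nullity_on:
  fixes f :: "'a::euclidean_space \<Rightarrow> 'b::euclidean_space"
  assumes "subspace P" "linear f"
  shows "dim P = dim (f ` P) + dim {x \<in> P. f x = 0}"
proof -
  define K where "K = {x \<in> P. f x = 0}"
  define C where "C = {y \<in> P. \<forall>x\<in>K. orthogonal x y}"
  have K: "subspace K" "K \<subseteq> P"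
    using assms by (auto simp: K_def subspace_def linear_0 linear_add linear_scale)
  have C: "subspace C" "C \<subseteq> P"
    using assms(1) by (auto simp: C_def subspace_def orthogonal_clauses)
  have dimC: "dim C + dim K = dim P"
    unfolding C_def using dim_subspace_orthogonal_to_vectors[OF K(1) assms(1) K(2)] .
  have inj: "inj_on f C"
  proof (rule inj_onI)
    fix x y assume xy: "x \<in> C" "y \<in> C" "f x = f y"
    then have "x - y \<in> C" using C(1) by (simp add: subspace_diff)
    moreover from this have "x - y \<in> K"
      using xy(3) C(2) assms(2) by (auto simp: K_def linear_diff)
    ultimately have "orthogonal (x - y) (x - y)" by (simp add: C_def)
    then show "x = y" by (simp add: orthogonal_self)
  qed
  have "f ` P \<subseteq> f ` C"
  proof
    fix y assume "y \<in> f ` P"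
    then obtain x where x: "x \<in> P" "y = f x" by blast
    obtain u v where uv: "u \<in> span K" "\<And>w. w \<in> span K \<Longrightarrow> orthogonal v w" "x = u + v"
      using orthogonal_subspace_decomp_exists[of K x] by metis
    have u: "u \<in> K" using uv(1) unfolding span_eq_iff[THEN iffD2, OF K(1)] .
    then have "v \<in> P" using x uv(3) K(2) assms(1) by (metis add_diff_cancel_left' subsetD subspace_diff)
    then have "v \<in> C" using uv(2) by (auto simp: C_def orthogonal_commute span_base)
    moreover have "y = f v" using x uv(3) u assms(2) by (simp add: K_def linear_add)
    ultimately show "y \<in> f ` C" by blast
  qed
  then have "f ` P = f ` C" using C(2) by blast
  moreover have "dim (f ` C) = dim C"
    using assms(2) inj by (intro dim_image_eq) (simp_all add: span_eq_iff[THEN iffD2, OF C(1)])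
  ultimately show ?thesis using dimC by (simp add: K_def)
qed

lemma dim_direct_sum:
  fixes S T :: "'a::euclidean_space set"
  assumes "subspace S" "subspace T" "\<And>x. x \<in> S \<Longrightarrow> x \<in> T \<Longrightarrow> x = 0"
  shows "dim (subspace_sum S T) = dim S + dim T"
proof -
  have "S \<inter> T = {0}" using assms by (auto simp: subspace_0)
  then have "dim (S \<inter> T) = 0" by (simp only: dim_eq_0 subset_refl)
  then show ?thesis
    using dim_sums_Int[OF assms(1,2)] unfolding subspace_sum_def by linarith
qed

text \<open>Isolates what the root system has to supply: an sl2-triple, symmetry of ad h through
  \<open>\<theta> h = - h\<close>, and a basis of eigenvectors with even eigenvalues. Halving the
  eigenvalues makes ad n and ad f shift the index by one.\<close>

locale sl2_grading = cartan_pair +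
  fixes h n f :: "real^'n^'n"
  assumes in_g: "h \<in> \<gg>" "n \<in> \<gg>" "f \<in> \<gg>"
    and hn: "lie_bracket h n = 2 *\<^sub>R n"
    and hf: "lie_bracket h f = - 2 *\<^sub>R f"
    and nf: "lie_bracket n f = h"
    and theta_h: "\<theta> h = - h"
    and spanned: "\<gg> \<subseteq> span (\<Union>j::int. {x \<in> \<gg>. lie_bracket h x = (2 * real_of_int j) *\<^sub>R x})"
begin

abbreviation ip where "ip \<equiv> cartan_inner \<gg> \<theta>"

definition weight :: "int \<Rightarrow> (real^'n^'n) set" where
  "weight j = {x \<in> \<gg>. lie_bracket h x = (2 * real_of_int j) *\<^sub>R x}"

definition graded :: "int set \<Rightarrow> (real^'n^'n) set" where
  "graded I = span (\<Union>j\<in>I. weight j)"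

lemma weight_sub: "x \<in> weight j \<Longrightarrow> x \<in> \<gg>"
  by (simp add: weight_def)

lemma subspace_weight: "subspace (weight j)"
  by (auto simp: weight_def subspace_def W_closed lie_bracket_simps scaleR_add_right)

lemma subspace_graded: "subspace (graded I)"
  by (simp add: graded_def)

lemma weight_graded: "j \<in> I \<Longrightarrow> x \<in> weight j \<Longrightarrow> x \<in> graded I"
  by (auto simp: graded_def intro: span_base)

lemma graded_sub: "graded I \<subseteq> \<gg>"
  unfolding graded_def by (rule span_minimal[OF _ subspace_g]) (auto simp: weight_sub)

lemma graded_UNIV: "graded UNIV = \<gg>"
  using graded_sub spanned by (auto simp: graded_def weight_def)

lemma n_weight: "x \<in> weight j \<Longrightarrow> lie_bracket n x \<in> weight (j + 1)"
  using jacobi[of h n x] in_g by (simp add: weight_def bracket_closed hn lie_bracket_simps algebra_simps)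

lemma f_weight: "x \<in> weight j \<Longrightarrow> lie_bracket f x \<in> weight (j - 1)"
  using jacobi[of h f x] in_g by (simp add: weight_def bracket_closed hf lie_bracket_simps algebra_simps)

lemma theta_weight:
  assumes "x \<in> weight j"
  shows "\<theta> x \<in> weight (- j)"
proof -
  have "lie_bracket h (\<theta> x) = - \<theta> (lie_bracket h x)"
    using assms in_g by (simp add: theta_bracket weight_sub theta_h lie_bracket_simps)
  then show ?thesis
    using assms by (simp add: weight_def theta_closed theta_scale)
qed

lemma ip_theta: "x \<in> \<gg> \<Longrightarrow> y \<in> \<gg> \<Longrightarrow> ip (\<theta> x) (\<theta> y) = ip x y"
  by (simp add: cartan_inner_def killing_theta theta_closed)

lemma theta_n_weight: "x \<in> weight (j + 1) \<Longrightarrow> lie_bracket (\<theta> n) x \<in> weight j"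
  using n_weight[OF theta_weight[of x "j + 1"]] theta_weight[of "lie_bracket n (\<theta> x)" "- j"] in_g
  by (simp add: theta_bracket theta_theta theta_closed weight_sub)

text \<open>ad h is symmetric because \<theta> h = - h, and eigenvectors of a symmetric operator to
  different eigenvalues are orthogonal.\<close>

lemma weight_orthogonal:
  assumes "x \<in> weight i" "y \<in> weight j" "i \<noteq> j"
  shows "ip x y = 0"
proof -
  have "ip (lie_bracket h x) y = ip x (lie_bracket h y)"
    using ip_bracket[of x y h] assms in_g
    by (simp add: weight_sub theta_h lie_bracket_simps minus_right bracket_closed)
  then have "2 * real_of_int i * ip x y = 2 * real_of_int j * ip x y"
    using assms by (simp add: weight_def scale_left scale_right)
  then show ?thesis using assms(3) by simp
qed

lemma graded_disjoint:
  assumes "I \<inter> J = {}" "x \<in> graded I" "x \<in> graded J"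
  shows "x = 0"
proof -
  have "ip v x = 0" if "j \<in> J" "v \<in> weight j" for v j
  proof (rule orthogonal_span[OF _ _ _ assms(2)[unfolded graded_def]])
    show "ip v s = 0" if "s \<in> (\<Union>j\<in>I. weight j)" for s
      using that assms(1) \<open>j \<in> J\<close> \<open>v \<in> weight j\<close> weight_orthogonal by blast
  qed (use that weight_sub in auto)
  then have "ip x v = 0" if "j \<in> J" "v \<in> weight j" for v j
    using that ip_sym[of x v] assms(2) graded_sub weight_sub by (metis subsetD)
  then have "ip x x = 0"
    using assms(3) graded_sub weight_sub by (intro orthogonal_span[of "\<Union>j\<in>J. weight j" x x]) (auto simp: graded_def)
  then show ?thesis using ip_eq_0_iff assms(2) graded_sub by blast
qed

lemma graded_union: "graded (I \<union> J) = subspace_sum (graded I) (graded J)"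
  by (simp add: graded_def span_Un subspace_sum_def)

lemma graded_single: "graded {j} = weight j"
  by (simp add: graded_def subspace_weight)

lemma graded_homogeneous_components:
  assumes "x \<in> graded I"
  shows "\<exists>J xs. finite J \<and> J \<subseteq> I \<and> (\<forall>j\<in>J. xs j \<in> weight j) \<and> x = (\<Sum>j\<in>J. xs j)"
  using assms[unfolded graded_def]
proof (induction rule: span_induct_alt)
  case base
  show ?case by (rule exI[of _ "{}"]) simp
next
  case (step c x y)
  then obtain J xs i where J: "finite J" "J \<subseteq> I" "\<forall>j\<in>J. xs j \<in> weight j" "y = (\<Sum>j\<in>J. xs j)"
    and i: "i \<in> I" "x \<in> weight i" by blast
  define ys where "ys = xs(i := c *\<^sub>R x + (if i \<in> J then xs i else 0))"
  have "(\<Sum>j\<in>insert i J. ys j) = ys i + (\<Sum>j\<in>J - {i}. xs j)"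
    using J(1) by (subst sum.insert_remove) (auto simp: ys_def intro!: sum.cong)
  also have "\<dots> = c *\<^sub>R x + y"
    using J(1,4) by (cases "i \<in> J") (auto simp: ys_def sum.remove)
  finally have "c *\<^sub>R x + y = (\<Sum>j\<in>insert i J. ys j)" ..
  moreover have "ys j \<in> weight j" if "j \<in> insert i J" for j
    using that J(3) i subspace_weight[of i]
    by (auto simp: ys_def subspace_add subspace_scale subspace_0)
  ultimately show ?case
    using J(1,2) i(1) by (intro exI[of _ "insert i J"] exI[of _ ys]) auto
qed

text \<open>Pairing with \<open>ys k\<close> isolates one summand. The shift j + 1 fits the use,
  where \<open>ys j\<close> is the bracket of n with a component of weight j.\<close>

lemma homogeneous_sum_eq_0:
  assumes "finite J" "\<And>j. j \<in> J \<Longrightarrow> ys j \<in> weight (j + 1)" "(\<Sum>j\<in>J. ys j) = 0" "k \<in> J"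
  shows "ys k = 0"
proof -
  have "0 = ip (\<Sum>j\<in>J. ys j) (ys k)"
    using zero_left[OF weight_sub[OF assms(2)[OF assms(4)]]] assms(3) by simp
  also have "\<dots> = (\<Sum>j\<in>J. ip (ys j) (ys k))"
    using assms weight_sub by (intro sum_left) blast+
  also have "\<dots> = (\<Sum>j\<in>J. if j = k then ip (ys k) (ys k) else 0)"
    using assms(2,4) by (intro sum.cong) (auto intro!: weight_orthogonal)
  also have "\<dots> = ip (ys k) (ys k)"
    using assms by simp
  finally show ?thesis
    using ip_eq_0_iff assms weight_sub by metis
qed

text \<open>Eigenvalues of ad h are bounded by its operator norm.\<close>

lemma weight_eventually_zero: "\<exists>M. \<forall>j x. x \<in> weight j \<longrightarrow> \<bar>j\<bar> > M \<longrightarrow> x = 0"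
proof -
  obtain K where K: "\<And>x. norm (lie_bracket h x) \<le> norm x * K"
    using linear_lie_bracket[of h] bounded_linear.pos_bounded linear_conv_bounded_linear by blast
  show ?thesis
  proof (intro exI allI impI)
    fix j x assume x: "x \<in> weight j" and j: "\<bar>j\<bar> > \<lceil>K\<rceil>"
    show "x = 0"
    proof (rule ccontr)
      assume "x \<noteq> 0"
      have "\<bar>2 * real_of_int j\<bar> * norm x \<le> K * norm x"
        using K[of x] x by (simp add: weight_def mult.commute)
      then have "2 * real_of_int \<bar>j\<bar> \<le> K" using \<open>x \<noteq> 0\<close> by simp
      then show False using j by linarith
    qed
  qed
qed

text \<open>Applying \<open>f\<close> repeatedly to a highest weight vector of negative weight would produce nonzero
  vectors of arbitrarily negative weight.\<close>

lemma ker_n_negative: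
  assumes "x \<in> weight k" "k < 0" "lie_bracket n x = 0"
  shows "x = 0"
proof (rule ccontr)
  assume "x \<noteq> 0"
  define u where "u i = (lie_bracket f ^^ i) x" for i
  have u_Suc: "u (Suc i) = lie_bracket f (u i)" for i by (simp add: u_def)
  have u_weight: "u i \<in> weight (k - int i)" for i
  proof (induction i)
    case (Suc i)
    then show ?case using f_weight[OF Suc] by (simp add: u_Suc algebra_simps)
  qed (simp add: u_def assms(1))
  have hu: "lie_bracket h (u i) = (2 * (real_of_int k - real i)) *\<^sub>R u i" for i
    using u_weight[of i] by (simp add: weight_def)
  \<comment> \<open>The standard sl2 identity: for a vector killed by n with h-eigenvalue 2k,
    raising the (i+1)-st lowered vector gives (i + 1)(2k - i) times the i-th one. For k < 0 no
    factor vanishes.\<close>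
  have n_u: "lie_bracket n (u (Suc i)) = (real (Suc i) * (2 * real_of_int k - real i)) *\<^sub>R u i" for i
  proof (induction i)
    case 0
    have "u 0 = x" by (simp add: u_def)
    then show ?case
      using jacobi[of n f x] hu[of 0] assms(3) by (simp add: u_Suc nf lie_bracket_simps)
  next
    case (Suc i)
    have "lie_bracket n (u (Suc (Suc i))) = lie_bracket h (u (Suc i)) + lie_bracket f (lie_bracket n (u (Suc i)))"
      using jacobi[of n f "u (Suc i)"] by (simp only: u_Suc[of "Suc i"] nf)
    also have "\<dots> = (2 * (real_of_int k - real (Suc i)) + real (Suc i) * (2 * real_of_int k - real i)) *\<^sub>R u (Suc i)"
      by (simp only: hu Suc lie_bracket_simps u_Suc[of i, symmetric] scaleR_add_left)
    also have "2 * (real_of_int k - real (Suc i)) + real (Suc i) * (2 * real_of_int k - real i) =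
        real (Suc (Suc i)) * (2 * real_of_int k - real (Suc i))"
      by (simp add: algebra_simps)
    finally show ?case .
  qed
  have u_nz: "u i \<noteq> 0" for i
  proof (induction i)
    case (Suc i)
    have "real (Suc i) * (2 * real_of_int k - real i) \<noteq> 0" using assms(2) by auto
    then show ?case using n_u[of i] Suc by (auto simp: lie_bracket_simps)
  qed (simp add: u_def \<open>x \<noteq> 0\<close>)
  obtain M where M: "\<And>j x. x \<in> weight j \<Longrightarrow> \<bar>j\<bar> > M \<Longrightarrow> x = 0"
    using weight_eventually_zero by blast
  have "\<bar>k - int (nat \<bar>M\<bar> + 1)\<bar> > M" using assms(2) by linarith
  then show False using M u_weight u_nz by blast
qed

text \<open>\<theta> exchanges ad (\<theta> n) with ad n and weight j + 1 with the negative weight -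
  (j + 1).\<close>

lemma ker_theta_n_positive:
  assumes "y \<in> weight (j + 1)" "0 \<le> j" "lie_bracket (\<theta> n) y = 0"
  shows "y = 0"
proof -
  have "lie_bracket n (\<theta> y) = \<theta> (lie_bracket (\<theta> n) y)"
    using assms(1) in_g by (simp add: theta_bracket theta_closed weight_sub theta_theta)
  then have "\<theta> y = 0"
    using ker_n_negative[OF theta_weight[OF assms(1)]] assms by (simp add: theta_0)
  then show ?thesis using assms(1) by (simp add: theta_eq_0_iff weight_sub)
qed

text \<open>\<open>ad n\<close> and \<open>- ad (\<theta> n)\<close> are adjoint to each other.\<close>

lemma n_surjective:
  assumes y: "y \<in> weight (j + 1)" and "0 \<le> j"
  shows "\<exists>x\<in>weight j. lie_bracket n x = y"
proof -
  let ?U = "lie_bracket n ` weight j"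
  have U: "subspace ?U" "?U \<subseteq> \<gg>"
    using n_weight weight_sub by (auto intro: linear_subspace_image linear_lie_bracket subspace_weight)
  obtain x where x: "x \<in> weight j" "\<forall>v\<in>?U. ip (y - lie_bracket n x) v = 0"
    using orthogonal_projection[OF U weight_sub[OF y]] by blast
  \<comment> \<open>The part of y orthogonal to the image of ad n. By adjointness ad (\<theta> n)
    kills it, and in positive weight this forces z = 0.\<close>
  define z where "z = y - lie_bracket n x"
  have z: "z \<in> weight (j + 1)"
    using y x n_weight subspace_weight by (simp add: z_def subspace_diff)
  let ?t = "lie_bracket (\<theta> n) z"
  have t: "?t \<in> weight j" by (rule theta_n_weight[OF z])
  have "ip ?t ?t = - ip (lie_bracket n ?t) z"
    using ip_bracket[of ?t z n] t z in_g by (simp add: weight_sub)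
  also have "\<dots> = - ip z (lie_bracket n ?t)"
    using t z in_g by (simp add: ip_sym weight_sub bracket_closed)
  also have "\<dots> = 0" using x(2) t by (simp add: z_def)
  finally have "?t = 0" using ip_eq_0_iff weight_sub[OF t] by blast
  then have "z = 0" using ker_theta_n_positive z assms(2) by blast
  then show ?thesis using x(1) by (auto simp: z_def)
qed

lemma n_power_surjective: "v \<in> weight (int m) \<Longrightarrow> \<exists>w\<in>weight 0. (lie_bracket n ^^ m) w = v"
proof (induction m arbitrary: v)
  case (Suc m)
  then obtain x where x: "x \<in> weight (int m)" "lie_bracket n x = v"
    using n_surjective[of v "int m"] by (auto simp: add.commute)
  then obtain w where "w \<in> weight 0" "(lie_bracket n ^^ m) w = x" using Suc.IH by blast
  then show ?case using x by auto
qed auto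

section \<open>The centralizer of n and its limits\<close>

definition Z :: "(real^'n^'n) set" where
  "Z = centralizer_in \<gg> {n}"

lemma Z_iff: "x \<in> Z \<longleftrightarrow> x \<in> \<gg> \<and> lie_bracket n x = 0"
  unfolding Z_def centralizer_in_def using lie_bracket_skew[of x n] by auto

lemma subspace_Z: "subspace Z"
  by (auto simp: subspace_def Z_iff W_closed lie_bracket_simps)

text \<open>ad n is homogeneous of degree one, so the images of the components of x have distinct
  weights and can cancel only by vanishing one by one.\<close>

lemma Z_graded: "Z \<inter> graded I = span (\<Union>j\<in>I. Z \<inter> weight j)"
proof
  show "span (\<Union>j\<in>I. Z \<inter> weight j) \<subseteq> Z \<inter> graded I"
  proof (intro span_minimal subspace_inter subspace_Z subspace_graded subsetI)
    fix x assume "x \<in> (\<Union>j\<in>I. Z \<inter> weight j)"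
    then obtain j where "j \<in> I" "x \<in> Z" "x \<in> weight j" by blast
    then show "x \<in> Z \<inter> graded I" by (blast intro: weight_graded)
  qed
  show "Z \<inter> graded I \<subseteq> span (\<Union>j\<in>I. Z \<inter> weight j)"
  proof
    fix x assume x: "x \<in> Z \<inter> graded I"
    obtain J xs where J: "finite J" "J \<subseteq> I" "\<forall>j\<in>J. xs j \<in> weight j" "x = (\<Sum>j\<in>J. xs j)"
      using graded_homogeneous_components[OF IntD2[OF x]] by blast
    have zero: "(\<Sum>j\<in>J. lie_bracket n (xs j)) = 0"
      using x J(4) by (simp add: Z_iff linear_sum[OF linear_lie_bracket])
    have "lie_bracket n (xs j) = 0" if "j \<in> J" for j
    proof (rule homogeneous_sum_eq_0[OF J(1) _ zero that])
      show "lie_bracket n (xs i) \<in> weight (i + 1)" if "i \<in> J" for i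
        using J(3) that by (intro n_weight) blast
    qed
    then have "xs j \<in> Z \<inter> weight j" if "j \<in> J" for j
      using that J(3) weight_sub by (simp add: Z_iff) blast
    then have "xs j \<in> (\<Union>j\<in>I. Z \<inter> weight j)" if "j \<in> J" for j
      using that J(2) by blast
    then show "x \<in> span (\<Union>j\<in>I. Z \<inter> weight j)"
      unfolding J(4) by (intro span_sum span_base)
  qed
qed

lemma Z_nonneg: "Z \<subseteq> graded {0..}"
proof -
  have "Z = Z \<inter> graded UNIV" unfolding graded_UNIV by (auto simp: Z_iff)
  also have "\<dots> = span (\<Union>j\<in>UNIV. Z \<inter> weight j)" by (rule Z_graded)
  also have "\<dots> \<subseteq> graded {0..}"
  proof (intro span_minimal subspace_graded subsetI)
    fix x assume "x \<in> (\<Union>j\<in>UNIV. Z \<inter> weight j)"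
    then obtain j where j: "x \<in> weight j" "lie_bracket n x = 0" by (auto simp: Z_iff)
    then show "x \<in> graded {0..}"
      using ker_n_negative[OF j(1)] subspace_0[OF subspace_graded] weight_graded[of j "{0..}" x] by (cases "j < 0") auto
  qed
  finally show ?thesis .
qed

lemma atLeast_0_union: "{0::int..} = {0} \<union> {1..}"
  by auto

lemma dim_graded_nonneg: "dim (graded {0..}) = dim (weight 0) + dim (graded {1..})"
  unfolding atLeast_0_union graded_union graded_single[symmetric]
  by (intro dim_direct_sum subspace_graded graded_disjoint[of "{0}" "{1..}"]) auto

lemma n_image_nonneg: "lie_bracket n ` graded {0..} = graded {1..}"
proof
  have "lie_bracket n ` graded {0..} = span (lie_bracket n ` (\<Union>j\<in>{0..}. weight j))"
    unfolding graded_def by (rule linear_span_image[OF linear_lie_bracket, symmetric])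
  also have "\<dots> \<subseteq> graded {1..}"
    by (intro span_minimal subspace_graded) (auto intro!: weight_graded[OF _ n_weight])
  finally show "lie_bracket n ` graded {0..} \<subseteq> graded {1..}" .
  show "graded {1..} \<subseteq> lie_bracket n ` graded {0..}"
    unfolding graded_def[of "{1..}"]
  proof (intro span_minimal linear_subspace_image linear_lie_bracket subspace_graded subsetI)
    fix y assume "y \<in> (\<Union>j\<in>{1..}. weight j)"
    then obtain j where "1 \<le> j" "y \<in> weight (j - 1 + 1)" by auto
    then show "y \<in> lie_bracket n ` graded {0..}"
      using n_surjective[of y "j - 1"] weight_graded[of "j - 1" "{0..}"] by auto
  qed
qed

text \<open>Rank-nullity for ad n on the part of nonnegative weight: the kernel is Z, and the image
  is the part of positive weight, which is smaller by exactly the dimension of weight 0.\<close>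

lemma dim_Z: "dim Z = dim (weight 0)"
proof -
  have "{x \<in> graded {0..}. lie_bracket n x = 0} = Z"
    using Z_nonneg graded_sub[of "{0..}"] by (auto simp: Z_iff)
  then show ?thesis
    using rank_nullity_on[OF subspace_graded linear_lie_bracket, of "{0..}" n] n_image_nonneg dim_graded_nonneg by simp
qed

lemma dim_Z_split: "dim Z = dim (Z \<inter> weight 0) + dim (Z \<inter> graded {1..})"
proof -
  have Z_eq: "Z = subspace_sum (Z \<inter> weight 0) (Z \<inter> graded {1..})"
  proof -
    have "Z = Z \<inter> graded ({0} \<union> {1..})"
      using Z_nonneg unfolding atLeast_0_union by blast
    also have "\<dots> = span ((\<Union>j\<in>{0}. Z \<inter> weight j) \<union> (\<Union>j\<in>{1..}. Z \<inter> weight j))"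
      unfolding Z_graded UN_Un ..
    also have "\<dots> = subspace_sum (Z \<inter> graded {0}) (Z \<inter> graded {1..})"
      by (simp only: span_Un Z_graded subspace_sum_def)
    finally show ?thesis by (simp add: graded_single)
  qed
  have "x = 0" if "x \<in> Z \<inter> weight 0" "x \<in> Z \<inter> graded {1..}" for x
    using that graded_disjoint[of "{0}" "{1..}" x] by (simp add: graded_single)
  then have "dim (subspace_sum (Z \<inter> weight 0) (Z \<inter> graded {1..})) = dim (Z \<inter> weight 0) + dim (Z \<inter> graded {1..})"
    by (intro dim_direct_sum subspace_inter subspace_Z subspace_weight subspace_graded)
  with arg_cong[OF Z_eq, of dim] show ?thesis by (rule trans)
qed

text \<open>Since n commutes with v, Ad (exp (tn)) w is a polynomial in t of degree at most m with
  coefficient v / m! at t^m. Rescaling does not leave the moving subspace and sends the lower terms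
  to 0.\<close>

lemma Ad_exp_rescaled_limit:
  assumes "w \<in> U" "subspace U" "(lie_bracket n ^^ m) w = v" "lie_bracket n v = 0"
  shows "\<exists>w. (\<forall>\<^sub>F t in at_top. w t \<in> Ad (mexp (t *\<^sub>R n)) ` U) \<and> (w \<longlongrightarrow> v) at_top"
proof (intro exI conjI)
  let ?N = "lie_bracket n"
  \<comment> \<open>At t = 0 and m > 0 the quotient is 0 by convention, which still lies in the
    subspace; the comparison with the polynomial is made for t > 0 only.\<close>
  let ?w = "\<lambda>t. (fact m / t ^ m) *\<^sub>R Ad (mexp (t *\<^sub>R n)) w"
  show "\<forall>\<^sub>F t in at_top. ?w t \<in> Ad (mexp (t *\<^sub>R n)) ` U"
  proof (intro always_eventually allI image_eqI)
    show "?w t = Ad (mexp (t *\<^sub>R n)) ((fact m / t ^ m) *\<^sub>R w)" for t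
      by (simp only: linear_scale[OF linear_Ad])
    show "(fact m / t ^ m) *\<^sub>R w \<in> U" for t
      using assms(1,2) by (simp add: subspace_scale)
  qed
  have Ad: "Ad (mexp (t *\<^sub>R n)) w = (\<Sum>k\<le>m. (t ^ k / fact k) *\<^sub>R (?N ^^ k) w)" for t
    using assms(3,4) by (intro Ad_mexp_eq_sum) simp
  have "((\<lambda>t::real. (\<Sum>k<m. (fact m / fact k * inverse (t ^ (m - k))) *\<^sub>R (?N ^^ k) w) + v) \<longlongrightarrow>
      (\<Sum>k<m. (fact m / fact k * 0) *\<^sub>R (?N ^^ k) w) + v) at_top"
  proof (rule tendsto_add[OF tendsto_sum tendsto_const])
    fix k assume "k \<in> {..<m}"
    then have "filterlim (\<lambda>t::real. t ^ (m - k)) at_top at_top"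
      by (intro filterlim_pow_at_top filterlim_ident) simp
    then have "((\<lambda>t::real. inverse (t ^ (m - k))) \<longlongrightarrow> 0) at_top"
      by (rule tendsto_inverse_0_at_top)
    then show "((\<lambda>t::real. (fact m / fact k * inverse (t ^ (m - k))) *\<^sub>R (?N ^^ k) w) \<longlongrightarrow>
        (fact m / fact k * 0) *\<^sub>R (?N ^^ k) w) at_top"
      by (intro tendsto_scaleR tendsto_mult tendsto_const)
  qed
  then have "((\<lambda>t::real. (\<Sum>k<m. (fact m / fact k * inverse (t ^ (m - k))) *\<^sub>R (?N ^^ k) w) + v) \<longlongrightarrow> v) at_top"
    by simp
  moreover have "\<forall>\<^sub>F t in at_top. (\<Sum>k<m. (fact m / fact k * inverse (t ^ (m - k))) *\<^sub>R (?N ^^ k) w) + v = ?w t"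
    using eventually_gt_at_top[of 0]
  proof eventually_elim
    case (elim t)
    have "?w t = (\<Sum>k\<le>m. (fact m / t ^ m * (t ^ k / fact k)) *\<^sub>R (?N ^^ k) w)"
      by (simp add: Ad scaleR_sum_right)
    also have "\<dots> = (\<Sum>k<m. (fact m / t ^ m * (t ^ k / fact k)) *\<^sub>R (?N ^^ k) w) + v"
      using elim assms(3) by (simp add: lessThan_Suc_atMost[symmetric])
    also have "(\<Sum>k<m. (fact m / t ^ m * (t ^ k / fact k)) *\<^sub>R (?N ^^ k) w) =
        (\<Sum>k<m. (fact m / fact k * inverse (t ^ (m - k))) *\<^sub>R (?N ^^ k) w)"
      using elim by (intro sum.cong refl) (simp add: power_diff divide_simps)
    finally show ?case ..
  qed
  ultimately show "(?w \<longlongrightarrow> v) at_top"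
    by (rule Lim_transform_eventually)
qed

text \<open>The threshold \<open>m0\<close> serves both limits: 0 yields the whole centralizer, 1
  only its part of positive weight. Homogeneous vectors span the candidate, so it suffices to lift
  these.\<close>

lemma Ad_exp_tends_to_homogeneous:
  assumes Ad: "\<And>t x. x \<in> \<gg> \<Longrightarrow> Ad (mexp (t *\<^sub>R n)) x \<in> \<gg>"
    and U: "subspace U" "U \<subseteq> \<gg>" "dim (Z \<inter> graded {int m0..}) = dim U"
    and lift: "\<And>m v. m0 \<le> m \<Longrightarrow> v \<in> Z \<inter> weight (int m) \<Longrightarrow> \<exists>w\<in>U. (lie_bracket n ^^ m) w = v"
  shows "Ad_exp_tends_to \<gg> n U (Z \<inter> graded {int m0..})"
  unfolding Ad_exp_tends_to_def Z_graded
proof (rule limitin_grassmannian[OF subspace_g])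
  show "subspace (Ad (mexp (t *\<^sub>R n)) ` U)" for t
    by (intro linear_subspace_image linear_Ad U)
  show "Ad (mexp (t *\<^sub>R n)) ` U \<subseteq> \<gg>" for t
    using Ad U(2) by blast
  show "dim (Ad (mexp (t *\<^sub>R n)) ` U) = dim U" for t
    by (intro dim_image_eq linear_Ad) (rule inj_on_subset[OF inj_Ad_mexp], simp)
  show "(\<Union>j\<in>{int m0..}. Z \<inter> weight j) \<subseteq> \<gg>" using weight_sub by auto
  show "dim (span (\<Union>j\<in>{int m0..}. Z \<inter> weight j)) = dim U"
    using U(3) by (simp only: Z_graded)
  fix v assume "v \<in> (\<Union>j\<in>{int m0..}. Z \<inter> weight j)"
  then obtain j where j: "int m0 \<le> j" "v \<in> Z \<inter> weight j" by auto
  define m where "m = nat j"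
  have m: "j = int m" "m0 \<le> m" using j(1) by (simp_all add: m_def)
  obtain w where "w \<in> U" "(lie_bracket n ^^ m) w = v" using lift[of m v] m j by auto
  moreover have "lie_bracket n v = 0" using j(2) by (simp add: Z_iff)
  ultimately show "\<exists>w. (\<forall>\<^sub>F t in at_top. w t \<in> Ad (mexp (t *\<^sub>R n)) ` U) \<and> (w \<longlongrightarrow> v) at_top"
    using U(1) by (intro Ad_exp_rescaled_limit)
qed

end

section \<open>Restricted roots\<close>

lemma span_image_eq_sum:
  assumes "finite I" "x \<in> span (t ` I)"
  shows "\<exists>c. x = (\<Sum>i\<in>I. c i *\<^sub>R (t i :: 'a::real_vector))"
  using assms(2)
proof (induction rule: span_induct_alt)
  case base
  show ?case by (rule exI[of _ "\<lambda>_. 0"]) simp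
next
  case (step k y z)
  then obtain c i where c: "z = (\<Sum>i\<in>I. c i *\<^sub>R t i)" "i \<in> I" "y = t i" by blast
  have "k *\<^sub>R y + z = (\<Sum>j\<in>I. ((if j = i then k else 0) + c j) *\<^sub>R t j)"
    using assms(1) c by (simp add: scaleR_add_left sum.distrib if_distrib[of "\<lambda>a. a *\<^sub>R _"] cong: if_cong)
  then show ?case by (intro exI[of _ "\<lambda>j. (if j = i then k else 0) + c j"])
qed

locale restricted_root_system = cartan_pair +
  fixes \<aa> :: "(real^'n^'n) set" and \<Delta> :: "(real^'n^'n \<Rightarrow> real) set"
  assumes maximal: "maximal_abelian_in (cartan_p \<gg> \<theta>) \<aa>"
    and simple: "simple_roots \<aa> (restricted_roots \<gg> \<aa>) \<Delta>"
begin

abbreviation ip where "ip \<equiv> cartan_inner \<gg> \<theta>"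
abbreviation \<Phi> where "\<Phi> \<equiv> restricted_roots \<gg> \<aa>"
abbreviation \<gg>\<^sub>0 where "\<gg>\<^sub>0 \<equiv> centralizer_in \<gg> \<aa>"
abbreviation rs where "rs \<equiv> root_space \<gg> \<aa>"

lemma a_p: "H \<in> \<aa> \<Longrightarrow> H \<in> \<gg> \<and> \<theta> H = - H"
  using maximal by (auto simp: maximal_abelian_in_def cartan_p_def)

lemma a_sub: "H \<in> \<aa> \<Longrightarrow> H \<in> \<gg>"
  and theta_a: "H \<in> \<aa> \<Longrightarrow> \<theta> H = - H"
  by (simp_all add: a_p)

lemma subspace_a: "subspace \<aa>"
  and a_abelian: "H \<in> \<aa> \<Longrightarrow> H' \<in> \<aa> \<Longrightarrow> lie_bracket H H' = 0"
  using maximal by (auto simp: maximal_abelian_in_def abelian_subspace_def)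

lemma finite_simple: "finite \<Delta>"
  and simple_sub: "\<alpha> \<in> \<Delta> \<Longrightarrow> \<alpha> \<in> \<Phi>"
  and simple_independent: "(\<And>H. H \<in> \<aa> \<Longrightarrow> (\<Sum>\<alpha>\<in>\<Delta>. c \<alpha> * \<alpha> H) = 0) \<Longrightarrow> \<alpha> \<in> \<Delta> \<Longrightarrow> c \<alpha> = 0"
  and root_expansion: "\<beta> \<in> \<Phi> \<Longrightarrow> \<exists>c :: _ \<Rightarrow> nat. (\<forall>H\<in>\<aa>. \<beta> H = (\<Sum>\<alpha>\<in>\<Delta>. real (c \<alpha>) * \<alpha> H)) \<or>
        (\<forall>H\<in>\<aa>. \<beta> H = - (\<Sum>\<alpha>\<in>\<Delta>. real (c \<alpha>) * \<alpha> H))"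
  using simple by (auto simp: simple_roots_def)

lemma rs_sub: "x \<in> rs \<alpha> \<Longrightarrow> x \<in> \<gg>"
  and rs_bracket: "x \<in> rs \<alpha> \<Longrightarrow> H \<in> \<aa> \<Longrightarrow> lie_bracket H x = \<alpha> H *\<^sub>R x"
  by (auto simp: root_space_def)

lemma ad_a_symmetric:
  assumes "H \<in> \<aa>" "x \<in> \<gg>" "y \<in> \<gg>"
  shows "ip (lie_bracket H x) y = ip x (lie_bracket H y)"
  using ip_bracket[OF assms(2,3) a_sub[OF assms(1)]] assms
  by (simp add: theta_a lie_bracket_simps minus_right bracket_closed a_sub)

lemma common_eigenvector_cases:
  assumes x: "x \<in> \<gg>" and ev: "common_eigenvector (lie_bracket ` \<aa>) x"
  shows "x \<in> \<gg>\<^sub>0 \<or> (\<exists>\<alpha>\<in>\<Phi>. x \<in> rs \<alpha>)"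
proof (cases "x \<in> \<gg>\<^sub>0")
  case False
  obtain c where c: "\<And>H. H \<in> \<aa> \<Longrightarrow> lie_bracket H x = c H *\<^sub>R x"
    using ev by (auto simp: common_eigenvector_def) metis
  \<comment> \<open>The eigenvalue c is arbitrary off \<aa>; restriction makes it the unique
    extensional representative that \<open>dual_space\<close> requires.\<close>
  define \<alpha> where "\<alpha> = restrict c \<aa>"
  obtain H0 where H0: "H0 \<in> \<aa>" "lie_bracket H0 x \<noteq> 0"
    using False x lie_bracket_skew[of x] by (auto simp: centralizer_in_def)
  have x0: "x \<noteq> 0" using H0 by (auto simp: lie_bracket_simps)
  have "\<alpha> \<in> dual_space \<aa>"
  proof -
    have "c (H + H') = c H + c H'" if "H \<in> \<aa>" "H' \<in> \<aa>" for H H'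
    proof -
      have "c (H + H') *\<^sub>R x = (c H + c H') *\<^sub>R x"
        using that c[of H] c[of H'] c[of "H + H'"] subspace_add[OF subspace_a]
        by (simp add: lie_bracket_simps scaleR_add_left)
      then show ?thesis using x0 by simp
    qed
    moreover have "c (k *\<^sub>R H) = k * c H" if "H \<in> \<aa>" for k H
    proof -
      have "c (k *\<^sub>R H) *\<^sub>R x = lie_bracket (k *\<^sub>R H) x"
        using that c[of "k *\<^sub>R H"] subspace_scale[OF subspace_a] by simp
      also have "\<dots> = (k * c H) *\<^sub>R x"
        using that c[of H] by (simp add: lie_bracket_simps)
      finally show ?thesis using x0 by simp
    qed
    ultimately show ?thesis
      using subspace_add[OF subspace_a] subspace_scale[OF subspace_a] by (auto simp: dual_space_def \<alpha>_def)
  qed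
  moreover have xr: "x \<in> rs \<alpha>" using x c by (simp add: root_space_def \<alpha>_def)
  moreover have "\<alpha> H0 \<noteq> 0" using H0 c[OF H0(1)] by (auto simp: \<alpha>_def)
  ultimately have "\<alpha> \<in> \<Phi>"
    using x0 H0(1) by (auto simp: restricted_roots_def)
  then show ?thesis using xr by blast
qed simp

text \<open>The operators ad H with H in \<aa> commute by the Jacobi identity and are symmetric
  because \<theta> H = - H, so they are simultaneously diagonalizable.\<close>

lemma root_decomposition: "\<gg> \<subseteq> span (\<gg>\<^sub>0 \<union> (\<Union>\<alpha>\<in>\<Phi>. rs \<alpha>))"
proof -
  have "\<gg> = span {x \<in> \<gg>. common_eigenvector (lie_bracket ` \<aa>) x}"
  proof (rule commuting_symmetric_diagonalizable[OF inner_on_axioms, symmetric])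
    show "S (T x) = T (S x)" if ST: "S \<in> lie_bracket ` \<aa>" "T \<in> lie_bracket ` \<aa>" for S T x
    proof -
      obtain H H' where "H \<in> \<aa>" "H' \<in> \<aa>" "S = lie_bracket H" "T = lie_bracket H'"
        using ST by blast
      then show ?thesis using jacobi[of H H' x] a_abelian[of H H'] by (simp add: lie_bracket_simps)
    qed
  qed (auto simp: linear_lie_bracket bracket_closed a_sub ad_a_symmetric)
  also have "\<dots> \<subseteq> span (\<gg>\<^sub>0 \<union> (\<Union>\<alpha>\<in>\<Phi>. rs \<alpha>))"
    using common_eigenvector_cases by (intro span_mono) blast
  finally show ?thesis .
qed

text \<open>Adjoining x to \<aa> gives an abelian subspace of the -1 eigenspace of \<theta>, and
  \<aa> is maximal among these.\<close>

lemma p_centralizer: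
  assumes x: "x \<in> \<gg>" "\<theta> x = - x" and comm: "\<And>H. H \<in> \<aa> \<Longrightarrow> lie_bracket H x = 0"
  shows "x \<in> \<aa>"
proof -
  let ?b = "span (insert x \<aa>)"
  have form: "\<exists>k u. y = u + k *\<^sub>R x \<and> u \<in> \<aa>" if "y \<in> ?b" for y
    using that span_breakdown_eq[of y x \<aa>] span_eq_iff[THEN iffD2, OF subspace_a]
    by (metis diff_add_cancel)
  have xH: "lie_bracket x H = 0" if "H \<in> \<aa>" for H
    using comm[OF that] lie_bracket_skew[of x H] by simp
  have xx: "lie_bracket x x = 0" by (simp add: lie_bracket_def)
  have "?b \<subseteq> cartan_p \<gg> \<theta>"
  proof
    fix y assume "y \<in> ?b"
    then obtain k u where "y = u + k *\<^sub>R x" "u \<in> \<aa>" using form by blast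
    then show "y \<in> cartan_p \<gg> \<theta>"
      using x a_sub theta_a by (simp add: cartan_p_def W_closed theta_add theta_scale)
  qed
  moreover have "lie_bracket y z = 0" if y: "y \<in> ?b" and z: "z \<in> ?b" for y z
  proof -
    obtain k u where y': "y = u + k *\<^sub>R x" "u \<in> \<aa>" using form[OF y] by blast
    obtain l v where z': "z = v + l *\<^sub>R x" "v \<in> \<aa>" using form[OF z] by blast
    show ?thesis
      unfolding y' z' using a_abelian[OF y'(2) z'(2)] comm[OF y'(2)] xH[OF z'(2)] xx
      by (simp add: lie_bracket_simps)
  qed
  ultimately have "?b = \<aa>"
    using maximal span_superset[of "insert x \<aa>"] by (auto simp: maximal_abelian_in_def abelian_subspace_def)
  then show ?thesis using span_base[of x "insert x \<aa>"] by simp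
qed

text \<open>The centralizer of \<aa> is stable under \<theta>, so it contains the
  \<theta>-eigenparts of each of its elements. The -1 part falls into \<aa> by maximality, the +1
  part into \<mm>.\<close>

lemma g0_decomposition: "\<gg>\<^sub>0 = subspace_sum \<aa> (cartan_m \<gg> \<theta> \<aa>)"
proof
  show "subspace_sum \<aa> (cartan_m \<gg> \<theta> \<aa>) \<subseteq> \<gg>\<^sub>0"
    using a_sub a_abelian
    by (auto simp: subspace_sum_def cartan_m_def cartan_k_def centralizer_in_def W_closed lie_bracket_simps)
  show "\<gg>\<^sub>0 \<subseteq> subspace_sum \<aa> (cartan_m \<gg> \<theta> \<aa>)"
  proof
    fix x assume x0: "x \<in> \<gg>\<^sub>0"
    then have x: "x \<in> \<gg>" and "\<And>H. H \<in> \<aa> \<Longrightarrow> lie_bracket x H = 0" by (auto simp: centralizer_in_def)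
    then have xH: "lie_bracket H x = 0" if "H \<in> \<aa>" for H
      using that lie_bracket_skew[of H x] by simp
    have tH: "lie_bracket H (\<theta> x) = 0" if "H \<in> \<aa>" for H
    proof -
      have "lie_bracket H (\<theta> x) = - \<theta> (lie_bracket H x)"
        using that x by (simp add: theta_bracket a_sub theta_a lie_bracket_simps)
      then show ?thesis using xH[OF that] by (simp add: theta_0)
    qed
    have tx: "\<theta> x \<in> \<gg>" using x by (rule theta_closed)
    define p where "p = (1 / 2) *\<^sub>R (x - \<theta> x)"
    define k where "k = (1 / 2) *\<^sub>R (x + \<theta> x)"
    have "p \<in> \<aa>"
    proof (rule p_centralizer)
      show "\<theta> p = - p"
        using x tx by (simp add: p_def theta_scale theta_diff theta_theta W_closed scaleR_diff_right)
    qed (use x tx xH tH in \<open>simp_all add: p_def W_closed lie_bracket_simps\<close>)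
    moreover have "lie_bracket k H = 0" if "H \<in> \<aa>" for H
      using xH[OF that] tH[OF that] by (subst lie_bracket_skew) (simp add: k_def lie_bracket_simps)
    then have "k \<in> cartan_m \<gg> \<theta> \<aa>"
      using x tx by (simp add: cartan_m_def cartan_k_def centralizer_in_def k_def W_closed
          theta_scale theta_add theta_theta add.commute)
    moreover have "x = p + k" by (simp add: p_def k_def scaleR_add_right[symmetric] scaleR_2[symmetric])
    ultimately show "x \<in> subspace_sum \<aa> (cartan_m \<gg> \<theta> \<aa>)"
      by (auto simp: subspace_sum_def)
  qed
qed

text \<open>If all simple roots vanish at H, so do all roots; then ad H = 0 by the root
  decomposition, and the center is trivial.\<close>

lemma simple_roots_separate:
  assumes H: "H \<in> \<aa>" "\<And>\<alpha>. \<alpha> \<in> \<Delta> \<Longrightarrow> \<alpha> H = 0"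
  shows "H = 0"
proof (rule centerless[OF a_sub[OF H(1)]])
  have "(\<Sum>\<alpha>\<in>\<Delta>. real (c \<alpha>) * \<alpha> H) = 0" for c
    by (intro sum.neutral ballI) (metis H(2) mult_zero_right)
  then have "\<beta> H = 0" if "\<beta> \<in> \<Phi>" for \<beta>
    using root_expansion[OF that] H(1) by auto
  note roots = this
  have "lie_bracket H y = 0" if "y \<in> \<gg>\<^sub>0 \<union> (\<Union>\<alpha>\<in>\<Phi>. rs \<alpha>)" for y
    using that
  proof
    assume "y \<in> \<gg>\<^sub>0"
    then show ?thesis
      using H(1) lie_bracket_skew[of H y] by (auto simp: centralizer_in_def)
  next
    assume "y \<in> (\<Union>\<alpha>\<in>\<Phi>. rs \<alpha>)"
    then obtain \<alpha> where "\<alpha> \<in> \<Phi>" "y \<in> rs \<alpha>" by blast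
    then show ?thesis using rs_bracket[of y \<alpha> H] H(1) roots by simp
  qed
  then show "lie_bracket H z = 0" if "z \<in> \<gg>" for z
    using linear_eq_0_on_span[OF linear_lie_bracket, of _ H z] that root_decomposition by blast
qed

text \<open>\<theta> maps a root space to that of the negative root. The fact is phrased with
  brackets since the pointwise negative of an extensional functional need not be
  extensional.\<close>

lemma theta_rs:
  assumes "x \<in> rs \<alpha>" "H \<in> \<aa>"
  shows "lie_bracket H (\<theta> x) = - \<alpha> H *\<^sub>R \<theta> x"
proof -
  have "lie_bracket H (\<theta> x) = - \<theta> (lie_bracket H x)"
    using assms by (simp add: theta_bracket a_sub rs_sub theta_a lie_bracket_simps)
  then show ?thesis
    using assms by (simp add: rs_bracket theta_scale rs_sub)
qed

lemma rs_orthogonal: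
  assumes "x \<in> rs \<alpha>" "y \<in> rs \<beta>" "H \<in> \<aa>" "\<alpha> H \<noteq> \<beta> H"
  shows "ip x y = 0"
proof -
  have "\<alpha> H * ip x y = \<beta> H * ip x y"
    using ad_a_symmetric[OF assms(3) rs_sub[OF assms(1)] rs_sub[OF assms(2)]] assms
    by (simp add: rs_bracket scale_left scale_right rs_sub)
  then show ?thesis using assms(4) by simp
qed

text \<open>Linear independence makes the coefficients unique. With c = 0 the conclusion is absurd,
  which shows that distinct simple roots differ somewhere on \<aa>.\<close>

lemma simple_root_combination:
  assumes "\<alpha> \<in> \<Delta>" "\<beta> \<in> \<Delta>" "\<alpha> \<noteq> \<beta>"
    and "\<And>H. H \<in> \<aa> \<Longrightarrow> \<alpha> H - \<beta> H = (\<Sum>\<gamma>\<in>\<Delta>. c \<gamma> * \<gamma> H)"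
  shows "c \<alpha> = 1 \<and> c \<beta> = - 1"
proof -
  define d where "d \<gamma> = (if \<gamma> = \<alpha> then 1 else 0) - (if \<gamma> = \<beta> then 1 else 0) - c \<gamma>" for \<gamma>
  have "(\<Sum>\<gamma>\<in>\<Delta>. d \<gamma> * \<gamma> H) = 0" if "H \<in> \<aa>" for H
  proof -
    have "(\<Sum>\<gamma>\<in>\<Delta>. d \<gamma> * \<gamma> H) =
        (\<Sum>\<gamma>\<in>\<Delta>. if \<gamma> = \<alpha> then \<gamma> H else 0) - (\<Sum>\<gamma>\<in>\<Delta>. if \<gamma> = \<beta> then \<gamma> H else 0) - (\<Sum>\<gamma>\<in>\<Delta>. c \<gamma> * \<gamma> H)"
      unfolding sum_subtractf[symmetric] by (intro sum.cong refl) (simp add: d_def algebra_simps)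
    then show ?thesis
      using assms(1,2) assms(4)[OF that] finite_simple by simp
  qed
  then have "d \<alpha> = 0" "d \<beta> = 0"
    using simple_independent[of d] assms(1,2) by blast+
  then show ?thesis using assms(3) by (simp add: d_def)
qed

text \<open>The difference of two distinct simple roots is not a root, as its coefficients have mixed signs.\<close>

lemma simple_bracket_theta:
  assumes ab: "\<alpha> \<in> \<Delta>" "\<beta> \<in> \<Delta>" "\<alpha> \<noteq> \<beta>" and x: "x \<in> rs \<alpha>" and y: "y \<in> rs \<beta>"
  shows "lie_bracket x (\<theta> y) = 0"
proof (rule ccontr)
  assume nz: "lie_bracket x (\<theta> y) \<noteq> 0"
  let ?z = "lie_bracket x (\<theta> y)"
  have zg: "?z \<in> \<gg>" using x y by (simp add: bracket_closed rs_sub theta_closed)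
  have z: "lie_bracket H ?z = (\<alpha> H - \<beta> H) *\<^sub>R ?z" if "H \<in> \<aa>" for H
    using jacobi[of H x "\<theta> y"] that x y by (simp add: rs_bracket theta_rs lie_bracket_simps algebra_simps)
  then have "common_eigenvector (lie_bracket ` \<aa>) ?z" by (auto simp: common_eigenvector_def)
  then consider "?z \<in> \<gg>\<^sub>0" | \<gamma> where "\<gamma> \<in> \<Phi>" "?z \<in> rs \<gamma>"
    using common_eigenvector_cases zg by blast
  then show False
  proof cases
    case 1
    then have "\<alpha> H - \<beta> H = 0" if "H \<in> \<aa>" for H
      using z[OF that] nz lie_bracket_skew[of H ?z] that by (simp add: centralizer_in_def)
    then show False using simple_root_combination[OF ab, of "\<lambda>_. 0"] by simp
  next
    case 2
    have eq: "\<gamma> H = \<alpha> H - \<beta> H" if "H \<in> \<aa>" for H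
      using z[OF that] rs_bracket[OF 2(2) that] nz by (metis scaleR_cancel_right)
    obtain c :: "_ \<Rightarrow> nat" where
      "(\<forall>H\<in>\<aa>. \<gamma> H = (\<Sum>\<alpha>\<in>\<Delta>. real (c \<alpha>) * \<alpha> H)) \<or> (\<forall>H\<in>\<aa>. \<gamma> H = - (\<Sum>\<alpha>\<in>\<Delta>. real (c \<alpha>) * \<alpha> H))"
      using root_expansion[OF 2(1)] by blast
    then show False
    proof
      assume "\<forall>H\<in>\<aa>. \<gamma> H = (\<Sum>\<alpha>\<in>\<Delta>. real (c \<alpha>) * \<alpha> H)"
      then have "real (c \<beta>) = - 1"
        using simple_root_combination[OF ab, of "\<lambda>\<gamma>. real (c \<gamma>)"] eq by simp
      then show False by simp
    next
      assume "\<forall>H\<in>\<aa>. \<gamma> H = - (\<Sum>\<alpha>\<in>\<Delta>. real (c \<alpha>) * \<alpha> H)"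
      then have "- real (c \<alpha>) = 1"
        using simple_root_combination[OF ab, of "\<lambda>\<gamma>. - real (c \<gamma>)"] eq by (simp add: sum_negf)
      then show False by simp
    qed
  qed
qed

text \<open>The weights \<alpha> and - \<alpha> cancel, so the bracket commutes with \<aa>, and
  \<theta> negates it; hence it lies in \<aa>. The pairing shows it to be a multiple of the vector
  dual to \<alpha>.\<close>

lemma bracket_theta_self:
  assumes x: "x \<in> rs \<alpha>"
  shows "lie_bracket x (\<theta> x) \<in> \<aa>"
    and "H \<in> \<aa> \<Longrightarrow> ip (lie_bracket x (\<theta> x)) H = - \<alpha> H * ip (\<theta> x) (\<theta> x)"
proof -
  have xg: "x \<in> \<gg>" "\<theta> x \<in> \<gg>" using x by (simp_all add: rs_sub theta_closed)
  show "lie_bracket x (\<theta> x) \<in> \<aa>"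
  proof (rule p_centralizer)
    show "\<theta> (lie_bracket x (\<theta> x)) = - lie_bracket x (\<theta> x)"
      using xg by (simp add: theta_bracket theta_theta) (rule lie_bracket_skew)
    show "lie_bracket H (lie_bracket x (\<theta> x)) = 0" if "H \<in> \<aa>" for H
      using jacobi[of H x "\<theta> x"] that x by (simp add: rs_bracket theta_rs lie_bracket_simps)
  qed (use xg in \<open>simp add: bracket_closed\<close>)
  show "ip (lie_bracket x (\<theta> x)) H = - \<alpha> H * ip (\<theta> x) (\<theta> x)" if H: "H \<in> \<aa>"
  proof -
    have "ip (lie_bracket x (\<theta> x)) H = - ip (\<theta> x) (lie_bracket (\<theta> x) H)"
      using ip_bracket[of "\<theta> x" H x] xg a_sub[OF H] by simp
    also have "lie_bracket (\<theta> x) H = \<alpha> H *\<^sub>R \<theta> x"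
      using theta_rs[OF x H] lie_bracket_skew[of "\<theta> x" H] by simp
    finally show ?thesis using xg by (simp add: scale_right)
  qed
qed

end

section \<open>The sl2-triple through a sum of simple root vectors\<close>

locale simple_root_vectors = restricted_root_system \<gg> \<theta> \<aa> \<Delta>
  for \<gg> :: "(real^'n^'n) set" and \<theta> \<aa> \<Delta> +
  fixes nc :: "(real^'n^'n \<Rightarrow> real) \<Rightarrow> real^'n^'n"
  assumes nc_rs: "\<alpha> \<in> \<Delta> \<Longrightarrow> nc \<alpha> \<in> root_space \<gg> \<aa> \<alpha>"
    and nc_nonzero: "\<alpha> \<in> \<Delta> \<Longrightarrow> nc \<alpha> \<noteq> 0"
begin

definition n where "n = (\<Sum>\<alpha>\<in>\<Delta>. nc \<alpha>)"

text \<open>A negative multiple of the usual coroot: it represents a negative multiple of \<alpha>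
  for the inner product on \<aa>.\<close>

definition coroot where "coroot \<alpha> = lie_bracket (nc \<alpha>) (\<theta> (nc \<alpha>))"

lemma nc_g: "\<alpha> \<in> \<Delta> \<Longrightarrow> nc \<alpha> \<in> \<gg>"
  using nc_rs rs_sub by blast

lemma n_g: "n \<in> \<gg>"
  unfolding n_def by (intro subspace_sum[OF subspace_g] nc_g)

lemma coroot_a: "\<alpha> \<in> \<Delta> \<Longrightarrow> coroot \<alpha> \<in> \<aa>"
  unfolding coroot_def by (rule bracket_theta_self(1)[OF nc_rs])

lemma ip_coroot:
  assumes "\<alpha> \<in> \<Delta>"
  shows "\<exists>s>0. \<forall>H\<in>\<aa>. ip (coroot \<alpha>) H = - s * \<alpha> H"
proof (intro exI conjI ballI)
  show "ip (\<theta> (nc \<alpha>)) (\<theta> (nc \<alpha>)) > 0"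
    using assms nc_nonzero theta_eq_0_iff[OF nc_g] by (intro ip_pos theta_closed nc_g) auto
  show "ip (coroot \<alpha>) H = - ip (\<theta> (nc \<alpha>)) (\<theta> (nc \<alpha>)) * \<alpha> H" if "H \<in> \<aa>" for H
    using bracket_theta_self(2)[OF nc_rs[OF assms] that] by (simp add: coroot_def)
qed

text \<open>A vector of \<aa> orthogonal to all coroots is annihilated by all simple roots, hence
  zero.\<close>

lemma coroot_span: "\<aa> \<subseteq> span (coroot ` \<Delta>)"
proof
  fix H assume H: "H \<in> \<aa>"
  have sub: "span (coroot ` \<Delta>) \<subseteq> \<aa>"
    using coroot_a by (intro span_minimal subspace_a) auto
  then obtain u where u: "u \<in> span (coroot ` \<Delta>)" "\<forall>v\<in>span (coroot ` \<Delta>). ip (H - u) v = 0"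
    using orthogonal_projection[of "span (coroot ` \<Delta>)" H] H a_sub by blast
  have Hu: "H - u \<in> \<aa>" using H u(1) sub subspace_a by (auto intro: subspace_diff)
  have "\<alpha> (H - u) = 0" if \<alpha>: "\<alpha> \<in> \<Delta>" for \<alpha>
  proof -
    obtain s where s: "s > 0" "ip (coroot \<alpha>) (H - u) = - s * \<alpha> (H - u)"
      using ip_coroot[OF \<alpha>] Hu by blast
    have "ip (H - u) (coroot \<alpha>) = 0" using u(2) \<alpha> by (simp add: span_base)
    then show ?thesis
      using s ip_sym[OF a_sub[OF Hu] a_sub[OF coroot_a[OF \<alpha>]]] by simp
  qed
  then have "H - u = 0" by (rule simple_roots_separate[OF Hu])
  then show "H \<in> span (coroot ` \<Delta>)" using u(1) by simp
qed

text \<open>The vector dual to a simple root \<open>\<alpha>\<close> is proportional to the component of \<open>coroot \<alpha>\<close> orthogonal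
  to the other coroots.\<close>

lemma fundamental_coweight:
  assumes \<alpha>: "\<alpha> \<in> \<Delta>"
  shows "\<exists>e\<in>\<aa>. \<alpha> e = 1 \<and> (\<forall>\<beta>\<in>\<Delta> - {\<alpha>}. \<beta> e = 0)"
proof -
  obtain s where s: "\<And>\<beta>. \<beta> \<in> \<Delta> \<Longrightarrow> s \<beta> > 0"
    "\<And>\<beta> H. \<beta> \<in> \<Delta> \<Longrightarrow> H \<in> \<aa> \<Longrightarrow> ip (coroot \<beta>) H = - s \<beta> * \<beta> H"
    using ip_coroot by metis
  let ?T = "span (coroot ` (\<Delta> - {\<alpha>}))"
  have T: "?T \<subseteq> \<aa>" using coroot_a by (intro span_minimal subspace_a) auto
  obtain u where u: "u \<in> ?T" "\<forall>v\<in>?T. ip (coroot \<alpha> - u) v = 0"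
    using orthogonal_projection[of ?T "coroot \<alpha>"] T a_sub coroot_a[OF \<alpha>] by (meson subsetD subsetI subspace_span)
  define e where "e = coroot \<alpha> - u"
  have e: "e \<in> \<aa>" using u(1) T coroot_a[OF \<alpha>] subspace_a by (auto simp: e_def intro: subspace_diff)
  have others: "\<beta> e = 0" if "\<beta> \<in> \<Delta> - {\<alpha>}" for \<beta>
  proof -
    have "ip e (coroot \<beta>) = 0" using u(2) that by (auto simp: e_def intro: span_base)
    then show ?thesis
      using s[of \<beta>] e that ip_sym[OF a_sub[OF e] a_sub[OF coroot_a], of \<beta>] by force
  qed
  have "e \<noteq> 0"
  proof
    assume "e = 0"
    then have "coroot \<alpha> \<in> ?T" using u(1) by (simp add: e_def)
    then obtain c where c: "coroot \<alpha> = (\<Sum>\<beta>\<in>\<Delta> - {\<alpha>}. c \<beta> *\<^sub>R coroot \<beta>)"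
      using span_image_eq_sum[of "\<Delta> - {\<alpha>}"] finite_simple by blast
    \<comment> \<open>Pairing with H turns the relation among coroots into one among simple roots,
      each coefficient picking up the factor \<open>s \<beta>\<close>. The coefficient of \<alpha>
      is \<open>s \<alpha>\<close> > 0, against independence.\<close>
    define d where "d \<beta> = (if \<beta> = \<alpha> then s \<alpha> else - c \<beta> * s \<beta>)" for \<beta>
    have "(\<Sum>\<beta>\<in>\<Delta>. d \<beta> * \<beta> H) = 0" if H: "H \<in> \<aa>" for H
    proof -
      have "- s \<alpha> * \<alpha> H = ip (\<Sum>\<beta>\<in>\<Delta> - {\<alpha>}. c \<beta> *\<^sub>R coroot \<beta>) H"
        using s(2)[OF \<alpha> H] c by simp
      also have "\<dots> = (\<Sum>\<beta>\<in>\<Delta> - {\<alpha>}. ip (c \<beta> *\<^sub>R coroot \<beta>) H)"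
        using finite_simple a_sub coroot_a H by (intro sum_left) (auto intro: W_closed)
      also have "\<dots> = (\<Sum>\<beta>\<in>\<Delta> - {\<alpha>}. d \<beta> * \<beta> H)"
        using a_sub coroot_a H s(2) by (intro sum.cong refl) (auto simp: scale_left d_def)
      finally show ?thesis
        using finite_simple \<alpha> by (simp add: sum.remove[of \<Delta> \<alpha>] d_def)
    qed
    then have "d \<alpha> = 0" using simple_independent[of d] \<alpha> by blast
    then show False using s(1)[OF \<alpha>] by (simp add: d_def)
  qed
  then have "\<alpha> e \<noteq> 0" using simple_roots_separate[OF e] others by blast
  have scale: "\<beta> ((1 / \<alpha> e) *\<^sub>R e) = \<beta> e / \<alpha> e" if "\<beta> \<in> \<Delta>" for \<beta>
    using simple_sub[OF that] e by (simp add: restricted_roots_def dual_space_def)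
  show ?thesis
  proof (intro bexI[of _ "(1 / \<alpha> e) *\<^sub>R e"] conjI ballI)
    show "(1 / \<alpha> e) *\<^sub>R e \<in> \<aa>" using e subspace_a by (rule subspace_scale[rotated])
    show "\<alpha> ((1 / \<alpha> e) *\<^sub>R e) = 1" using scale[OF \<alpha>] \<open>\<alpha> e \<noteq> 0\<close> by simp
    show "\<beta> ((1 / \<alpha> e) *\<^sub>R e) = 0" if "\<beta> \<in> \<Delta> - {\<alpha>}" for \<beta>
      using scale[of \<beta>] others[OF that] that by simp
  qed
qed

lemma exists_h: "\<exists>h\<in>\<aa>. \<forall>\<alpha>\<in>\<Delta>. \<alpha> h = 2"
proof -
  obtain e where e: "\<And>\<alpha>. \<alpha> \<in> \<Delta> \<Longrightarrow> e \<alpha> \<in> \<aa> \<and> \<alpha> (e \<alpha>) = 1 \<and> (\<forall>\<beta>\<in>\<Delta> - {\<alpha>}. \<beta> (e \<alpha>) = 0)"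
    using fundamental_coweight by metis
  \<comment> \<open>Twice the sum of the fundamental coweights.\<close>
  define h where "h = (\<Sum>\<alpha>\<in>\<Delta>. 2 *\<^sub>R e \<alpha>)"
  have in_a: "2 *\<^sub>R e \<alpha> \<in> \<aa>" if "\<alpha> \<in> \<Delta>" for \<alpha>
    using e[OF that] subspace_a by (simp add: subspace_scale)
  have h: "h \<in> \<aa>" unfolding h_def by (intro subspace_sum[OF subspace_a] in_a)
  moreover have "\<beta> h = 2" if \<beta>: "\<beta> \<in> \<Delta>" for \<beta>
  proof -
    have add: "\<beta> (x + y) = \<beta> x + \<beta> y" and sc: "\<beta> (c *\<^sub>R x) = c * \<beta> x"
      if "x \<in> \<aa>" "y \<in> \<aa>" for x y c
      using simple_sub[OF \<beta>] that by (auto simp: restricted_roots_def dual_space_def)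
    have zero: "\<beta> 0 = 0" using sc[of 0 0 0] subspace_0[OF subspace_a] by simp
    have "\<beta> (\<Sum>\<alpha>\<in>A. 2 *\<^sub>R e \<alpha>) = (\<Sum>\<alpha>\<in>A. \<beta> (2 *\<^sub>R e \<alpha>))" if "finite A" "A \<subseteq> \<Delta>" for A
      using that
    proof (induction A rule: finite_induct)
      case (insert a A)
      then show ?case using in_a by (simp add: add subspace_sum[OF subspace_a] subset_iff)
    qed (simp add: zero)
    then have "\<beta> h = (\<Sum>\<alpha>\<in>\<Delta>. \<beta> (2 *\<^sub>R e \<alpha>))" using finite_simple by (simp add: h_def)
    also have "\<dots> = (\<Sum>\<alpha>\<in>\<Delta>. if \<alpha> = \<beta> then 2 else 0)"
    proof (intro sum.cong refl)
      fix \<alpha> assume "\<alpha> \<in> \<Delta>"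
      then show "\<beta> (2 *\<^sub>R e \<alpha>) = (if \<alpha> = \<beta> then 2 else 0)"
        using e[of \<alpha>] sc[of "e \<alpha>" 0 2] \<beta> subspace_0[OF subspace_a] by auto
    qed
    finally show ?thesis using \<beta> finite_simple by simp
  qed
  ultimately show ?thesis by blast
qed

definition h where "h = (SOME h. h \<in> \<aa> \<and> (\<forall>\<alpha>\<in>\<Delta>. \<alpha> h = 2))"

lemma h_a: "h \<in> \<aa>" and simple_h: "\<alpha> \<in> \<Delta> \<Longrightarrow> \<alpha> h = 2"
  using someI_ex[of "\<lambda>h. h \<in> \<aa> \<and> (\<forall>\<alpha>\<in>\<Delta>. \<alpha> h = 2)"] exists_h by (auto simp: h_def)

lemma exists_f: "\<exists>f\<in>\<gg>. lie_bracket h f = - 2 *\<^sub>R f \<and> lie_bracket n f = h"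
proof -
  obtain d where d: "h = (\<Sum>\<alpha>\<in>\<Delta>. d \<alpha> *\<^sub>R coroot \<alpha>)"
    using span_image_eq_sum[OF finite_simple] coroot_span h_a by blast
  \<comment> \<open>The coefficients of h in the coroots are reused: mixed brackets of simple root
    vectors vanish, so bracketing with n returns exactly the expansion of h.\<close>
  define f where "f = (\<Sum>\<alpha>\<in>\<Delta>. d \<alpha> *\<^sub>R \<theta> (nc \<alpha>))"
  have "f \<in> \<gg>"
    unfolding f_def by (intro subspace_sum[OF subspace_g] W_closed theta_closed nc_g)
  moreover have "lie_bracket h f = - 2 *\<^sub>R f"
    using theta_rs[OF nc_rs h_a]
    by (simp add: f_def linear_sum[OF linear_lie_bracket] lie_bracket_simps simple_h scaleR_sum_right
        sum_negf[symmetric] mult.commute)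
  moreover have "lie_bracket n f = h"
  proof -
    have "lie_bracket n f = (\<Sum>\<beta>\<in>\<Delta>. d \<beta> *\<^sub>R lie_bracket n (\<theta> (nc \<beta>)))"
      by (simp add: f_def linear_sum[OF linear_lie_bracket] lie_bracket_simps)
    also have "\<dots> = (\<Sum>\<beta>\<in>\<Delta>. d \<beta> *\<^sub>R coroot \<beta>)"
    proof (intro sum.cong refl)
      fix \<beta> assume \<beta>: "\<beta> \<in> \<Delta>"
      have "lie_bracket n (\<theta> (nc \<beta>)) = (\<Sum>\<alpha>\<in>\<Delta>. lie_bracket (nc \<alpha>) (\<theta> (nc \<beta>)))"
        by (simp add: n_def linear_sum[OF linear_lie_bracket_left])
      also have "\<dots> = (\<Sum>\<alpha>\<in>\<Delta>. if \<alpha> = \<beta> then coroot \<beta> else 0)"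
        using simple_bracket_theta nc_rs \<beta> by (intro sum.cong refl) (auto simp: coroot_def)
      finally show "d \<beta> *\<^sub>R lie_bracket n (\<theta> (nc \<beta>)) = d \<beta> *\<^sub>R coroot \<beta>"
        using \<beta> finite_simple by simp
    qed
    also have "\<dots> = h" by (rule d[symmetric])
    finally show ?thesis .
  qed
  ultimately show ?thesis by blast
qed

lemma hn: "lie_bracket h n = 2 *\<^sub>R n"
  using rs_bracket[OF nc_rs h_a]
  by (simp add: n_def linear_sum[OF linear_lie_bracket] simple_h scaleR_sum_right)

end

section \<open>The limits\<close>

context simple_root_vectors
begin

definition f where "f = (SOME f. f \<in> \<gg> \<and> lie_bracket h f = - 2 *\<^sub>R f \<and> lie_bracket n f = h)"

lemma f_g: "f \<in> \<gg>" and hf: "lie_bracket h f = - 2 *\<^sub>R f" and nf: "lie_bracket n f = h"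
  using someI_ex[of "\<lambda>f. f \<in> \<gg> \<and> lie_bracket h f = - 2 *\<^sub>R f \<and> lie_bracket n f = h"] exists_f
  by (auto simp: f_def)

text \<open>h evaluates to twice the sum of the coefficients, so the weight index of a positive root
  is its height; it is at least 1 unless all coefficients vanish.\<close>

lemma combination_level:
  fixes c :: "(real^'n^'n \<Rightarrow> real) \<Rightarrow> nat"
  assumes "H \<in> \<aa>" "(\<Sum>\<alpha>\<in>\<Delta>. real (c \<alpha>) * \<alpha> H) \<noteq> 0"
  shows "\<exists>m\<ge>1. (\<Sum>\<alpha>\<in>\<Delta>. real (c \<alpha>) * \<alpha> h) = 2 * real_of_int m"
proof (intro exI conjI)
  have "\<exists>\<alpha>\<in>\<Delta>. c \<alpha> \<noteq> 0"
    using assms(2) by (metis (no_types, lifting) mult_eq_0_iff of_nat_0 sum.neutral)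
  then have "sum c \<Delta> \<noteq> 0" using finite_simple by simp
  then show "1 \<le> int (sum c \<Delta>)" by linarith
  show "(\<Sum>\<alpha>\<in>\<Delta>. real (c \<alpha>) * \<alpha> h) = 2 * real_of_int (int (sum c \<Delta>))"
    by (simp add: simple_h sum_distrib_left mult.commute)
qed

abbreviation positive where "positive \<equiv> positive_roots \<aa> \<Phi> \<Delta>"

lemma positive_root_level:
  assumes "\<beta> \<in> positive"
  shows "\<exists>m\<ge>1. \<beta> h = 2 * real_of_int m"
proof -
  obtain c :: "_ \<Rightarrow> nat" where c: "\<forall>H\<in>\<aa>. \<beta> H = (\<Sum>\<alpha>\<in>\<Delta>. real (c \<alpha>) * \<alpha> H)"
    using assms by (auto simp: positive_roots_def)
  moreover obtain H where "H \<in> \<aa>" "\<beta> H \<noteq> 0"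
    using assms by (auto simp: positive_roots_def restricted_roots_def)
  ultimately show ?thesis using combination_level[of H c] h_a by auto
qed

lemma negative_root_level:
  assumes "\<beta> \<in> \<Phi>" "\<beta> \<notin> positive"
  shows "\<exists>m\<le>- 1. \<beta> h = 2 * real_of_int m"
proof -
  obtain c :: "_ \<Rightarrow> nat" where c: "\<forall>H\<in>\<aa>. \<beta> H = - (\<Sum>\<alpha>\<in>\<Delta>. real (c \<alpha>) * \<alpha> H)"
    using assms root_expansion[OF assms(1)] by (auto simp: positive_roots_def)
  moreover obtain H where "H \<in> \<aa>" "\<beta> H \<noteq> 0"
    using assms by (auto simp: restricted_roots_def)
  ultimately obtain m where "m \<ge> 1" "\<beta> h = - (2 * real_of_int m)"
    using combination_level[of H c] h_a by auto
  then show ?thesis by (intro exI[of _ "- m"]) simp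
qed

lemma g0_level: "x \<in> \<gg>\<^sub>0 \<Longrightarrow> x \<in> {x \<in> \<gg>. lie_bracket h x = (2 * real_of_int 0) *\<^sub>R x}"
  using h_a lie_bracket_skew[of h x] by (simp add: centralizer_in_def)

lemma rs_level: "x \<in> rs \<beta> \<Longrightarrow> \<beta> h = 2 * real_of_int m \<Longrightarrow>
    x \<in> {x \<in> \<gg>. lie_bracket h x = (2 * real_of_int m) *\<^sub>R x}"
  using rs_bracket[OF _ h_a] rs_sub by simp

lemma root_level: "\<beta> \<in> \<Phi> \<Longrightarrow> \<exists>m. m \<noteq> 0 \<and> \<beta> h = 2 * real_of_int m"
  using positive_root_level[of \<beta>] negative_root_level[of \<beta>] by force

sublocale sl2: sl2_grading \<gg> \<theta> h n f
proof
  show "\<gg> \<subseteq> span (\<Union>j::int. {x \<in> \<gg>. lie_bracket h x = (2 * real_of_int j) *\<^sub>R x})"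
  proof (rule order_trans[OF root_decomposition], rule span_mono, rule subsetI)
    fix x assume "x \<in> \<gg>\<^sub>0 \<union> (\<Union>\<alpha>\<in>\<Phi>. rs \<alpha>)"
    then consider "x \<in> \<gg>\<^sub>0" | \<alpha> where "\<alpha> \<in> \<Phi>" "x \<in> rs \<alpha>" by blast
    then show "x \<in> (\<Union>j::int. {x \<in> \<gg>. lie_bracket h x = (2 * real_of_int j) *\<^sub>R x})"
    proof cases
      case 1
      from g0_level[OF this] show ?thesis by blast
    next
      case 2
      then obtain m where m: "\<alpha> h = 2 * real_of_int m" using root_level by blast
      from rs_level[OF 2(2) m] show ?thesis by blast
    qed
  qed
qed (use h_a in \<open>auto simp: a_sub theta_a n_g f_g hn hf nf\<close>)

lemma g0_weight: "x \<in> \<gg>\<^sub>0 \<Longrightarrow> x \<in> sl2.weight 0"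
  using g0_level by (simp add: sl2.weight_def)

lemma rs_weight: "x \<in> rs \<beta> \<Longrightarrow> \<beta> h = 2 * real_of_int m \<Longrightarrow> x \<in> sl2.weight m"
  using rs_level by (simp add: sl2.weight_def)

text \<open>The remaining summands of the root decomposition have weight at most 0. So for x of
  positive weight the part outside \<ww> lies in both a positive and a nonpositive graded piece and
  vanishes.\<close>

lemma nil_w_eq: "nil_w \<gg> \<aa> \<Delta> = sl2.graded {1..}"
proof
  let ?S = "\<gg>\<^sub>0 \<union> (\<Union>\<alpha>\<in>\<Phi> - positive. rs \<alpha>)"
  show sub: "nil_w \<gg> \<aa> \<Delta> \<subseteq> sl2.graded {1..}"
    unfolding nil_w_def root_space_sum_def
  proof (intro span_minimal sl2.subspace_graded subsetI)
    fix x assume "x \<in> (\<Union>\<alpha>\<in>positive. rs \<alpha>)"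
    then obtain \<alpha> where "\<alpha> \<in> positive" "x \<in> rs \<alpha>" by blast
    then obtain m where "m \<ge> 1" "x \<in> sl2.weight m" using positive_root_level[of \<alpha>] rs_weight[of x \<alpha>] by blast
    then show "x \<in> sl2.graded {1..}" by (intro sl2.weight_graded) auto
  qed
  have S: "span ?S \<subseteq> sl2.graded {..0}"
  proof (intro span_minimal sl2.subspace_graded subsetI)
    fix x assume "x \<in> ?S"
    then consider "x \<in> \<gg>\<^sub>0" | \<alpha> where "\<alpha> \<in> \<Phi>" "\<alpha> \<notin> positive" "x \<in> rs \<alpha>" by blast
    then obtain m where "m \<le> 0" "x \<in> sl2.weight m"
    proof cases
      case 1
      then show ?thesis using g0_weight that[of 0] by simp
    next
      case 2
      then obtain m where "m \<le> - 1" "x \<in> sl2.weight m" using negative_root_level[of \<alpha>] rs_weight[of x \<alpha>] by blast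
      then show ?thesis using that[of m] by simp
    qed
    then show "x \<in> sl2.graded {..0}" by (intro sl2.weight_graded) auto
  qed
  show "sl2.graded {1..} \<subseteq> nil_w \<gg> \<aa> \<Delta>"
  proof
    fix x assume x: "x \<in> sl2.graded {1..}"
    have "\<gg>\<^sub>0 \<union> (\<Union>\<alpha>\<in>\<Phi>. rs \<alpha>) \<subseteq> (\<Union>\<alpha>\<in>positive. rs \<alpha>) \<union> ?S"
      by blast
    then have "\<gg> \<subseteq> span ((\<Union>\<alpha>\<in>positive. rs \<alpha>) \<union> ?S)"
      using root_decomposition span_mono order_trans by meson
    then have "x \<in> span ((\<Union>\<alpha>\<in>positive. rs \<alpha>) \<union> ?S)"
      using x sl2.graded_sub[of "{1..}"] by blast
    then obtain w v where wv: "w \<in> nil_w \<gg> \<aa> \<Delta>" "v \<in> span ?S" "x = w + v"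
      unfolding span_Un nil_w_def root_space_sum_def by blast
    have "v = x - w" using wv(3) by simp
    then have "v \<in> sl2.graded {1..}"
      using x sub wv(1) sl2.subspace_graded by (auto intro: subspace_diff)
    moreover have "v \<in> sl2.graded {..0}" using wv(2) S by blast
    moreover have "{1..} \<inter> {..0::int} = {}" by auto
    ultimately have "v = 0" using sl2.graded_disjoint[of "{1..}" "{..0}" v] by blast
    then show "x \<in> nil_w \<gg> \<aa> \<Delta>" using wv by simp
  qed
qed

text \<open>No root vanishes at h, so the root-space part of a vector of weight 0 lies in nonzero
  weights as well as in weight 0.\<close>

lemma weight_0_eq: "sl2.weight 0 = \<gg>\<^sub>0"
proof
  show "\<gg>\<^sub>0 \<subseteq> sl2.weight 0" using g0_weight by blast
  have g0: "subspace \<gg>\<^sub>0"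
    by (auto simp: subspace_def centralizer_in_def W_closed lie_bracket_simps)
  have S: "span (\<Union>\<alpha>\<in>\<Phi>. rs \<alpha>) \<subseteq> sl2.graded (- {0})"
  proof (intro span_minimal sl2.subspace_graded subsetI)
    fix x assume "x \<in> (\<Union>\<alpha>\<in>\<Phi>. rs \<alpha>)"
    then obtain \<alpha> where "\<alpha> \<in> \<Phi>" "x \<in> rs \<alpha>" by blast
    then obtain m where "m \<noteq> 0" "x \<in> sl2.weight m" using root_level[of \<alpha>] rs_weight[of x \<alpha>] by blast
    then show "x \<in> sl2.graded (- {0})" by (intro sl2.weight_graded) auto
  qed
  show "sl2.weight 0 \<subseteq> \<gg>\<^sub>0"
  proof
    fix x assume x: "x \<in> sl2.weight 0"
    then have "x \<in> span (\<gg>\<^sub>0 \<union> (\<Union>\<alpha>\<in>\<Phi>. rs \<alpha>))"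
      using sl2.weight_sub root_decomposition by blast
    then obtain z v where zv: "z \<in> span \<gg>\<^sub>0" "v \<in> span (\<Union>\<alpha>\<in>\<Phi>. rs \<alpha>)" "x = z + v"
      unfolding span_Un by blast
    have z: "z \<in> \<gg>\<^sub>0" using zv(1) unfolding span_eq_iff[THEN iffD2, OF g0] .
    have "v = x - z" using zv(3) by simp
    then have "v \<in> sl2.graded {0}"
      unfolding sl2.graded_single using x g0_weight[OF z] sl2.subspace_weight by (simp add: subspace_diff)
    moreover have "v \<in> sl2.graded (- {0})" using zv(2) S by blast
    ultimately have "v = 0" using sl2.graded_disjoint[of "{0}" "- {0}"] by blast
    then show "x \<in> \<gg>\<^sub>0" using zv(3) z by simp
  qed
qed

section \<open>The weight zero space, its centralizing part and the orthogonal complement\<close>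

abbreviation \<mm> where "\<mm> \<equiv> cartan_m \<gg> \<theta> \<aa>"
abbreviation \<mm>\<^sub>d where "\<mm>\<^sub>d \<equiv> m_diamond \<gg> \<theta> \<aa> n"

lemma weight_0_sum: "sl2.weight 0 = subspace_sum \<aa> \<mm>"
  by (simp only: weight_0_eq g0_decomposition)

lemma m_iff: "x \<in> \<mm> \<longleftrightarrow> x \<in> \<gg>\<^sub>0 \<and> \<theta> x = x"
  by (auto simp: cartan_m_def cartan_k_def centralizer_in_def)

lemma ip_a_m:
  assumes "a \<in> \<aa>" "m \<in> \<mm>"
  shows "ip a m = 0"
proof -
  have g: "a \<in> \<gg>" "m \<in> \<gg>" using assms a_sub by (auto simp: m_iff centralizer_in_def)
  have "ip a m = ip (\<theta> a) (\<theta> m)" using g by (simp add: sl2.ip_theta)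
  also have "\<dots> = - ip a m" using assms g by (simp add: theta_a m_iff minus_left)
  finally show ?thesis by simp
qed

text \<open>For \<open>x = a + m\<close> the brackets \<open>[a, n]\<close> and \<open>[m, n]\<close> are orthogonal, since \<open>ad a\<close> is symmetric,
  \<open>ad m\<close> is skew and the two commute.\<close>

lemma Z_weight_0: "sl2.Z \<inter> sl2.weight 0 = \<mm>\<^sub>d"
proof
  show "\<mm>\<^sub>d \<subseteq> sl2.Z \<inter> sl2.weight 0"
    using g0_weight by (auto simp: m_diamond_def centralizer_in_def[of \<mm>] m_iff sl2.Z_def centralizer_in_def[of \<gg>])
  show "sl2.Z \<inter> sl2.weight 0 \<subseteq> \<mm>\<^sub>d"
  proof
    fix x assume x: "x \<in> sl2.Z \<inter> sl2.weight 0"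
    then obtain a m where am: "a \<in> \<aa>" "m \<in> \<mm>" "x = a + m"
      by (auto simp: weight_0_sum subspace_sum_def)
    have g: "a \<in> \<gg>" "m \<in> \<gg>" using am a_sub by (auto simp: m_iff centralizer_in_def)
    let ?an = "lie_bracket a n" and ?mn = "lie_bracket m n"
    have an: "?an \<in> \<gg>" "?mn \<in> \<gg>" using g n_g by (simp_all add: bracket_closed)
    have "lie_bracket x n = 0" using x by (auto simp: sl2.Z_def centralizer_in_def)
    then have mn: "?mn = - ?an"
      by (simp add: am(3) lie_bracket_simps eq_neg_iff_add_eq_0 add.commute)
    have "lie_bracket m a = 0" using am by (auto simp: m_iff centralizer_in_def)
    then have comm: "lie_bracket m ?an = lie_bracket a ?mn"
      using jacobi[of m a n] by (simp add: lie_bracket_simps)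
    have "ip ?mn ?an = - ip n (lie_bracket m ?an)"
      using ip_bracket[of n ?an m] g n_g an am(2) by (simp add: m_iff)
    also have "\<dots> = - ip n (lie_bracket a ?mn)" by (simp only: comm)
    also have "\<dots> = - ip ?an ?mn"
      using ad_a_symmetric[OF am(1) n_g an(2)] by simp
    also have "\<dots> = - ip ?mn ?an" using ip_sym an by simp
    finally have "ip ?mn ?an = 0" by simp
    then have "ip ?an ?an = 0" using an by (simp add: mn minus_left)
    then have an0: "?an = 0" using ip_eq_0_iff an(1) by blast
    \<comment> \<open>[a, n] is the sum of the \<open>\<alpha> a *\<^sub>R nc \<alpha>\<close>. The
      \<open>nc \<alpha>\<close> are nonzero and pairwise orthogonal, so every coefficient
      vanishes.\<close>
    have "\<beta> a = 0" if \<beta>: "\<beta> \<in> \<Delta>" for \<beta>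
    proof -
      have "0 = (\<Sum>\<alpha>\<in>\<Delta>. \<alpha> a *\<^sub>R nc \<alpha>)"
        using an0 rs_bracket[OF nc_rs am(1)] by (simp add: n_def linear_sum[OF linear_lie_bracket])
      then have "0 = ip (\<Sum>\<alpha>\<in>\<Delta>. \<alpha> a *\<^sub>R nc \<alpha>) (nc \<beta>)"
        using zero_left[OF nc_g[OF \<beta>]] by simp
      also have "\<dots> = (\<Sum>\<alpha>\<in>\<Delta>. ip (\<alpha> a *\<^sub>R nc \<alpha>) (nc \<beta>))"
        using nc_g \<beta> finite_simple by (intro sum_left) (auto intro: W_closed)
      also have "\<dots> = (\<Sum>\<alpha>\<in>\<Delta>. if \<alpha> = \<beta> then \<beta> a * ip (nc \<beta>) (nc \<beta>) else 0)"
      proof (intro sum.cong refl)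
        fix \<alpha> assume \<alpha>: "\<alpha> \<in> \<Delta>"
        have "ip (nc \<alpha>) (nc \<beta>) = 0" if ne: "\<alpha> \<noteq> \<beta>"
        proof -
          obtain H where "H \<in> \<aa>" "\<alpha> H \<noteq> \<beta> H"
            using simple_root_combination[OF \<alpha> \<beta> ne, of "\<lambda>_. 0"] by auto
          then show ?thesis using rs_orthogonal[OF nc_rs[OF \<alpha>] nc_rs[OF \<beta>]] by blast
        qed
        then show "ip (\<alpha> a *\<^sub>R nc \<alpha>) (nc \<beta>) = (if \<alpha> = \<beta> then \<beta> a * ip (nc \<beta>) (nc \<beta>) else 0)"
          using \<alpha> \<beta> nc_g by (simp add: scale_left)
      qed
      also have "\<dots> = \<beta> a * ip (nc \<beta>) (nc \<beta>)" using \<beta> finite_simple by simp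
      finally show ?thesis using ip_pos[OF nc_g[OF \<beta>] nc_nonzero[OF \<beta>]] by simp
    qed
    then have "a = 0" by (rule simple_roots_separate[OF am(1)])
    then show "x \<in> \<mm>\<^sub>d"
      using am x by (simp add: m_diamond_def centralizer_in_def sl2.Z_def)
  qed
qed

text \<open>Since \<aa> is orthogonal to \<mm>, adding \<aa> turns the complement taken inside \<mm>
  into the complement inside the whole weight zero space, where orthogonal projection
  applies.\<close>

lemma star_space_eq: "subspace_sum \<aa> (m_star \<gg> \<theta> \<aa> n) = {x \<in> sl2.weight 0. \<forall>y\<in>\<mm>\<^sub>d. ip x y = 0}"
proof -
  have "ip (a + m) y = ip m y" if "a \<in> \<aa>" "m \<in> \<mm>" "y \<in> \<mm>\<^sub>d" for a m y
  proof -
    have y: "y \<in> \<mm>" using that by (simp add: m_diamond_def centralizer_in_def)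
    then have "a \<in> \<gg>" "m \<in> \<gg>" "y \<in> \<gg>" using that a_sub by (auto simp: m_iff centralizer_in_def)
    then show ?thesis using ip_a_m[OF that(1) y] by (simp add: add_left)
  qed
  note ip_sum = this
  show ?thesis
  proof (rule Set.set_eqI, rule iffI)
    fix x assume "x \<in> subspace_sum \<aa> (m_star \<gg> \<theta> \<aa> n)"
    then obtain a m where am: "a \<in> \<aa>" "m \<in> \<mm>" "\<forall>y\<in>\<mm>\<^sub>d. ip m y = 0" "x = a + m"
      unfolding subspace_sum_def m_star_def by blast
    then have "x \<in> sl2.weight 0" unfolding weight_0_sum subspace_sum_def by blast
    then show "x \<in> {x \<in> sl2.weight 0. \<forall>y\<in>\<mm>\<^sub>d. ip x y = 0}"
      using am(3) ip_sum[OF am(1,2)] by (simp add: am(4))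
  next
    fix x assume x: "x \<in> {x \<in> sl2.weight 0. \<forall>y\<in>\<mm>\<^sub>d. ip x y = 0}"
    then obtain a m where am: "a \<in> \<aa>" "m \<in> \<mm>" "x = a + m"
      unfolding weight_0_sum subspace_sum_def by blast
    have "ip m y = 0" if "y \<in> \<mm>\<^sub>d" for y
      using x ip_sum[OF am(1,2) that] that by (simp add: am(3))
    then have "m \<in> m_star \<gg> \<theta> \<aa> n" using am(2) by (simp add: m_star_def)
    then show "x \<in> subspace_sum \<aa> (m_star \<gg> \<theta> \<aa> n)"
      unfolding subspace_sum_def using am(1,3) by blast
  qed
qed

lemma star_space_complement:
  assumes "x \<in> sl2.weight 0"
  shows "\<exists>u\<in>\<mm>\<^sub>d. x - u \<in> subspace_sum \<aa> (m_star \<gg> \<theta> \<aa> n)"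
proof -
  have d: "subspace \<mm>\<^sub>d" "\<mm>\<^sub>d \<subseteq> sl2.weight 0"
    unfolding Z_weight_0[symmetric] by (auto intro: subspace_inter sl2.subspace_Z sl2.subspace_weight)
  obtain u where "u \<in> \<mm>\<^sub>d" "\<forall>v\<in>\<mm>\<^sub>d. ip (x - u) v = 0"
    using orthogonal_projection[of "\<mm>\<^sub>d" x] d assms sl2.weight_sub by blast
  moreover from this have "x - u \<in> sl2.weight 0"
    using d(2) assms sl2.subspace_weight by (auto intro: subspace_diff)
  ultimately show ?thesis unfolding star_space_eq by blast
qed

lemma subspace_star_space: "subspace (subspace_sum \<aa> (m_star \<gg> \<theta> \<aa> n))"
proof -
  have "y \<in> \<gg>" if "y \<in> \<mm>\<^sub>d" for y using that sl2.weight_sub[of y 0] by (simp add: Z_weight_0[symmetric])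
  then show ?thesis
    unfolding star_space_eq using sl2.subspace_weight[of 0] sl2.weight_sub[of _ 0]
    by (auto simp: subspace_def zero_left add_left scale_left)
qed

lemma dim_star_space: "dim (sl2.weight 0) = dim \<mm>\<^sub>d + dim (subspace_sum \<aa> (m_star \<gg> \<theta> \<aa> n))"
proof -
  let ?W = "subspace_sum \<aa> (m_star \<gg> \<theta> \<aa> n)"
  have d: "subspace \<mm>\<^sub>d" "\<mm>\<^sub>d \<subseteq> sl2.weight 0"
    unfolding Z_weight_0[symmetric] by (auto intro: subspace_inter sl2.subspace_Z sl2.subspace_weight)
  have W: "?W \<subseteq> sl2.weight 0" unfolding star_space_eq by blast
  have eq: "sl2.weight 0 = subspace_sum \<mm>\<^sub>d ?W"
  proof
    show "sl2.weight 0 \<subseteq> subspace_sum \<mm>\<^sub>d ?W"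
    proof
      fix x assume "x \<in> sl2.weight 0"
      then obtain u where "u \<in> \<mm>\<^sub>d" "x - u \<in> ?W" using star_space_complement by blast
      moreover have "x = u + (x - u)" by simp
      ultimately show "x \<in> subspace_sum \<mm>\<^sub>d ?W" unfolding subspace_sum_def[of "\<mm>\<^sub>d"] by blast
    qed
    show "subspace_sum \<mm>\<^sub>d ?W \<subseteq> sl2.weight 0"
    proof
      fix x assume "x \<in> subspace_sum \<mm>\<^sub>d ?W"
      then obtain u w where "u \<in> \<mm>\<^sub>d" "w \<in> ?W" "x = u + w" unfolding subspace_sum_def[of "\<mm>\<^sub>d"] by blast
      then show "x \<in> sl2.weight 0" using d(2) W sl2.subspace_weight by (auto intro: subspace_add)
    qed
  qed
  have "x = 0" if "x \<in> \<mm>\<^sub>d" "x \<in> ?W" for x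
    using that ip_eq_0_iff[of x] sl2.weight_sub[of x 0] unfolding star_space_eq by blast
  then have "dim (subspace_sum \<mm>\<^sub>d ?W) = dim \<mm>\<^sub>d + dim ?W"
    by (intro dim_direct_sum d(1) subspace_star_space)
  with arg_cong[OF eq, of dim] show ?thesis by (rule trans)
qed

lemma limiting_lie_algebra:
  assumes Ad: "\<And>t x. x \<in> \<gg> \<Longrightarrow> Ad (mexp (t *\<^sub>R n)) x \<in> \<gg>"
  shows "is_limiting_lie_algebra \<gg> \<theta> \<aa> n (centralizer_in \<gg> {n})"
proof -
  have Z: "sl2.Z \<inter> sl2.graded {int 0..} = sl2.Z" using sl2.Z_nonneg by auto
  have "Ad_exp_tends_to \<gg> n (sl2.weight 0) (sl2.Z \<inter> sl2.graded {int 0..})"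
  proof (rule sl2.Ad_exp_tends_to_homogeneous[OF Ad sl2.subspace_weight])
    show "sl2.weight 0 \<subseteq> \<gg>" using sl2.weight_sub by blast
    show "dim (sl2.Z \<inter> sl2.graded {int 0..}) = dim (sl2.weight 0)" unfolding Z by (rule sl2.dim_Z)
  qed (use sl2.n_power_surjective in blast)+
  then show ?thesis
    unfolding Z weight_0_sum unfolding sl2.Z_def is_limiting_lie_algebra_def .
qed

lemma star_limiting_space:
  assumes Ad: "\<And>t x. x \<in> \<gg> \<Longrightarrow> Ad (mexp (t *\<^sub>R n)) x \<in> \<gg>"
  shows "is_star_limiting_space \<gg> \<theta> \<aa> n (nil_centralizer \<gg> \<aa> \<Delta> n)"
proof -
  let ?W = "subspace_sum \<aa> (m_star \<gg> \<theta> \<aa> n)"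
  have "Ad_exp_tends_to \<gg> n ?W (sl2.Z \<inter> sl2.graded {int 1..})"
  proof (rule sl2.Ad_exp_tends_to_homogeneous[OF Ad subspace_star_space])
    show "?W \<subseteq> \<gg>" unfolding star_space_eq using sl2.weight_sub by blast
    \<comment> \<open>Both sides are the dimension of weight 0 minus that of
      \<open>\<mm>\<^sub>d\<close>, the weight zero part of the centralizer.\<close>
    show "dim (sl2.Z \<inter> sl2.graded {int 1..}) = dim ?W"
      using sl2.dim_Z sl2.dim_Z_split dim_star_space by (simp add: Z_weight_0)
    fix m v assume m: "1 \<le> m" and v: "v \<in> sl2.Z \<inter> sl2.weight (int m)"
    obtain w where w: "w \<in> sl2.weight 0" "(lie_bracket n ^^ m) w = v"
      using sl2.n_power_surjective v by blast
    obtain u where u: "u \<in> \<mm>\<^sub>d" "w - u \<in> ?W" using star_space_complement[OF w(1)] by blast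
    obtain k where k: "m = Suc k" using m by (cases m) auto
    have "u \<in> sl2.Z" using u(1) Z_weight_0 by blast
    then have "lie_bracket n (w - u) = lie_bracket n w" by (simp add: sl2.Z_iff lie_bracket_simps)
    then have "(lie_bracket n ^^ m) (w - u) = v" using w(2) by (simp add: k funpow_swap1)
    then show "\<exists>w\<in>?W. (lie_bracket n ^^ m) w = v" using u(2) by blast
  qed
  then show ?thesis
    by (simp add: is_star_limiting_space_def nil_centralizer_def nil_w_eq sl2.Z_def)
qed

end

theorem proposition4p19:
  fixes G :: "(complex^'n^'n) set"
    and \<gg> \<aa> :: "(real^'n^'n) set"
    and \<theta> :: "real^'n^'n \<Rightarrow> real^'n^'n"
    and \<Delta> :: "(real^'n^'n \<Rightarrow> real) set"
    and r :: nat
    and nc :: "(real^'n^'n \<Rightarrow> real) \<Rightarrow> real^'n^'n"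
    and n :: "real^'n^'n"
  assumes "linear_algebraic_group_over_Q G"
    and "zariski_connected G"
    and "semisimple_group G"
    and "\<gg> = lie_algebra (real_points_component G)"
    and "cartan_involution \<gg> \<theta>"
    and "maximal_abelian_in (cartan_p \<gg> \<theta>) \<aa>"
    and "r = dim \<aa>" and "r \<ge> 1"
    and "simple_roots \<aa> (restricted_roots \<gg> \<aa>) \<Delta>"
    and "\<And>\<alpha>. \<alpha> \<in> \<Delta> \<Longrightarrow> nc \<alpha> \<in> root_space \<gg> \<aa> \<alpha>"
    and "\<And>\<alpha>. \<alpha> \<in> \<Delta> \<Longrightarrow> cartan_norm \<gg> \<theta> (nc \<alpha>) = 1 / sqrt (real r)"
    and "n = (\<Sum>\<alpha>\<in>\<Delta>. nc \<alpha>)"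
  shows "(\<exists>L. is_star_limiting_space \<gg> \<theta> \<aa> n L \<and> centralizing \<gg> \<aa> \<Delta> n L)
    \<and> is_limiting_lie_algebra \<gg> \<theta> \<aa> n (centralizer_in \<gg> {n})
    \<and> is_star_limiting_space \<gg> \<theta> \<aa> n (nil_centralizer \<gg> \<aa> \<Delta> n)"
proof -
  have g: "\<gg> = lie_algebra (real_points G)"
    using assms(4) by (simp add: lie_algebra_component)
  note group = real_points_group[OF assms(1)]
  have "subspace (lie_algebra (real_points G))"
    using group by (rule subspace_lie_algebra)
  then interpret cartan_pair \<gg> \<theta>
    using assms(5) lie_algebra_bracket[of "real_points G"] group(2) unfolding g
    by unfold_locales blast+
  interpret simple_root_vectors \<gg> \<theta> \<aa> \<Delta> nc
  proof
    \<comment> \<open>The prescribed norm is positive as r \<ge> 1, whereas the zero vector has norm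
      0.\<close>
    show "nc \<alpha> \<noteq> 0" if "\<alpha> \<in> \<Delta>" for \<alpha>
      using assms(8) assms(11)[OF that] zero_left[OF W_closed(1)] by (auto simp: cartan_norm_def)
  qed (use assms in auto)
  have n: "simple_root_vectors.n \<Delta> nc = n"
    using assms(12) by (simp add: n_def)
  have Ad: "Ad (mexp (t *\<^sub>R n)) x \<in> \<gg>" if "x \<in> \<gg>" for t x
    using that n_g group(2) unfolding g n by (intro lie_algebra_Ad)
  have star: "is_star_limiting_space \<gg> \<theta> \<aa> n (nil_centralizer \<gg> \<aa> \<Delta> n)"
    using star_limiting_space Ad unfolding n by blast
  moreover have "is_limiting_lie_algebra \<gg> \<theta> \<aa> n (centralizer_in \<gg> {n})"
    using limiting_lie_algebra Ad unfolding n by blast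
  \<comment> \<open>The correction z = 0 works, as the limit is the nilpotent centralizer of n
    itself.\<close>
  moreover have "centralizing \<gg> \<aa> \<Delta> n (nil_centralizer \<gg> \<aa> \<Delta> n)"
    unfolding centralizing_def nil_w_ge2_def root_space_sum_def
    by (intro bexI[of _ 0]) (simp_all add: span_0)
  ultimately show ?thesis by blast
qed

end
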